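(* Let $\mathcal{G}\rightrightarrows M$ be a Lie groupoid with Lie algebroid $A$. There is a $2$-vector space $$\mathfrak{X}^k_{\mathrm{aff}}(\mathcal{G})\rightrightarrows\mathfrak{X}^k_{\mathrm{mult}}(\mathcal{G}),$$ whose arrows are the affine $k$-vector fields and whose objects are the multiplicative $k$-vector fields on $\mathcal{G}$, with the following groupoid structure: the source and target maps are $$s(\Pi)=\Pi_r:=\Pi-\overrightarrow{\pi},\qquad t(\Pi)=\Pi_l:=\Pi-\overleftarrow{\pi},\qquad \pi=\mathrm{pr}_{\wedge^kA}\Pi|_M,$$ and the multiplication is $$\Pi*\Pi'=\Pi+\overleftarrow{\pi'},\qquad \pi'=\mathrm{pr}_{\wedge^kA}\Pi'|_M,$$ for pairs $\Pi,\Pi'$ of affine $k$-vector fields such that $\Pi_r=\Pi'_l$.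
   Context: A $2$-vector space is a category internal to vector spaces: a category $V_1\rightrightarrows V_0$ whose sets of objects and arrows are vector spaces and whose source, target, identity-assigning and composition maps are all linear (it is then automatically a groupoid). Here the identity-assigning map is the inclusion of multiplicative into affine $k$-vector fields. Conventions: $\mathcal{G}\rightrightarrows M$ has source $s$ and target $t$; $gh$ is defined iff $s(g)=t(h)$; $M\subset\mathcal{G}$ via units. The Lie algebroid is $A=\ker(ds)|_M$ with anchor $\rho=dt|_A$, and $T\mathcal{G}|_M=TM\oplus A$. $\mathrm{pr}_{\wedge^kA}\Pi|_M$ is the $\wedge^kA$-component of $\Pi|_M\in\Gamma(\wedge^k(TM\oplus A))$. Translations: for $u\in\Gamma(A)$, $\overrightarrow{u}(g)=dR_g(u_{t(g)})$ and $\overleftarrow{u}(g)=-dL_g(d\,\mathrm{inv}(u_{s(g)}))$, extended to $\Gamma(\wedge^kA)$ factorwise: $\overrightarrow{X_1\wedge\cdots\wedge X_k}=\overrightarrow{X_1}\wedge\cdots\wedge\overrightarrow{X_k}$ and similarly for $\overleftarrow{\ \cdot\ }$ (for $k=0$: $\overrightarrow f=t^*f$, $\overleftarrow f=s^*f$). A submanifold $S\subset N$ is coisotropic with respect to $\Lambda\in\mathfrak{X}^k(N)$ if for all $x\in S$, $\Lambda_x(\xi_1,\dots,\xi_k)=0$ whenever all $\xi_i\in T_x^*N$ annihilate $T_xS$. $\Pi\in\mathfrak{X}^k(\mathcal{G})$ is multiplicative if $\{(g,h,gh): s(g)=t(h)\}\subset\mathcal{G}^3$ is coisotropic with respect to $\Pi\oplus\Pi\oplus(-1)^{k+1}\Pi$,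 and affine if $\{(g,h,l,hg^{-1}l): s(g)=s(h),\,t(g)=t(l)\}\subset\mathcal{G}^4$ is coisotropic with respect to $\Pi\oplus(-1)^{k+1}\Pi\oplus(-1)^{k+1}\Pi\oplus\Pi$. *)

theory Defs
  imports "HOL-Analysis.Analysis" "HOL-Library.Function_Algebras"
begin

section \<open>Linear structure on function spaces; \<open>2\<close>-vector spaces\<close>

instantiation "fun" :: (type, real_vector) real_vector
begin

definition scaleR_fun_def: "r *\<^sub>R f = (\<lambda>x. r *\<^sub>R f x)"

instance
  by standard (auto simp: scaleR_fun_def plus_fun_def algebra_simps fun_eq_iff)

end

definition linear_map_on :: "'a::real_vector set \<Rightarrow> ('a \<Rightarrow> 'b::real_vector) \<Rightarrow> bool" where
  "linear_map_on V f \<longleftrightarrow>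
     (\<forall>x\<in>V. \<forall>y\<in>V. f (x + y) = f x + f y) \<and> (\<forall>r. \<forall>x\<in>V. f (r *\<^sub>R x) = r *\<^sub>R f x)"

definition composable :: "'a set \<Rightarrow> ('a \<Rightarrow> 'b) \<Rightarrow> ('a \<Rightarrow> 'b) \<Rightarrow> ('a \<times> 'a) set" where
  "composable V1 s t = {(x, y). x \<in> V1 \<and> y \<in> V1 \<and> s x = t y}"

text \<open>
  A category internal to real vector spaces, with arrows \<open>V1\<close>, objects \<open>V0\<close>, source \<open>s\<close>,
  target \<open>t\<close>, identities \<open>e\<close> and composition \<open>c\<close>; \<open>c x y\<close> is the composite ``\<open>x\<close> after \<open>y\<close>''
  and is relevant only if \<open>s x = t y\<close>.
\<close>

definition two_vector_space ::
  "'a::real_vector set \<Rightarrow> 'b::real_vector set \<Rightarrow> ('a \<Rightarrow> 'b) \<Rightarrow> ('a \<Rightarrow> 'b) \<Rightarrow> ('b \<Rightarrow> 'a)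
     \<Rightarrow> ('a \<Rightarrow> 'a \<Rightarrow> 'a) \<Rightarrow> bool" where
  "two_vector_space V1 V0 s t e c \<longleftrightarrow>
     subspace V1 \<and> subspace V0 \<and>
     s ` V1 \<subseteq> V0 \<and> t ` V1 \<subseteq> V0 \<and> e ` V0 \<subseteq> V1 \<and>
     (\<forall>(x, y)\<in>composable V1 s t. c x y \<in> V1 \<and> s (c x y) = s y \<and> t (c x y) = t x) \<and>
     (\<forall>v\<in>V0. s (e v) = v \<and> t (e v) = v) \<and>
     (\<forall>x\<in>V1. c x (e (s x)) = x \<and> c (e (t x)) x = x) \<and>
     (\<forall>x\<in>V1. \<forall>y\<in>V1. \<forall>z\<in>V1. s x = t y \<longrightarrow> s y = t z \<longrightarrow> c (c x y) z = c x (c y z)) \<and>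
     linear_map_on V1 s \<and> linear_map_on V1 t \<and> linear_map_on V0 e \<and>
     linear_map_on (composable V1 s t) (\<lambda>(x, y). c x y)"

definition arrows_invertible ::
  "'a set \<Rightarrow> ('a \<Rightarrow> 'b) \<Rightarrow> ('a \<Rightarrow> 'b) \<Rightarrow> ('b \<Rightarrow> 'a) \<Rightarrow> ('a \<Rightarrow> 'a \<Rightarrow> 'a) \<Rightarrow> bool" where
  "arrows_invertible V1 s t e c \<longleftrightarrow>
     (\<forall>x\<in>V1. \<exists>y\<in>V1. s y = t x \<and> t y = s x \<and> c x y = e (t x) \<and> c y x = e (s x))"


section \<open>Smooth manifolds\<close>

text \<open>
  \<open>C_on n U f\<close>: \<open>f\<close> is of class \<open>C\<^sup>n\<close> on the open set \<open>U\<close>, by iterated directional derivatives;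
  used for finite-dimensional domains only.
\<close>

primrec C_on ::
  "nat \<Rightarrow> 'e::real_normed_vector set \<Rightarrow> ('e \<Rightarrow> 'f::real_normed_vector) \<Rightarrow> bool" where
  "C_on 0 U f \<longleftrightarrow> continuous_on U f"
| "C_on (Suc n) U f \<longleftrightarrow>
     (\<forall>x\<in>U. f differentiable (at x)) \<and> (\<forall>v. C_on n U (\<lambda>x. frechet_derivative f (at x) v))"

definition smooth_on :: "'e::real_normed_vector set \<Rightarrow> ('e \<Rightarrow> 'f::real_normed_vector) \<Rightarrow> bool" where
  "smooth_on U f \<longleftrightarrow> (\<forall>n. C_on n U f)"

type_synonym ('a, 'e) chart = "'a set \<times> ('a \<Rightarrow> 'e)"

abbreviation chart_inv :: "('a, 'e) chart \<Rightarrow> 'e \<Rightarrow> 'a" where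
  "chart_inv c \<equiv> inv_into (fst c) (snd c)"

text \<open>
  The points form the whole type \<open>'a\<close>, with its topology. Besides the atlas, a preferred chart is
  recorded at each point \<open>x\<close>; it identifies the tangent space at \<open>x\<close> with the model space \<open>'e\<close>.
\<close>

record ('a, 'e) manifold =
  Atlas :: "('a, 'e) chart set"
  chart_at :: "'a \<Rightarrow> ('a, 'e) chart"

text \<open>
  The model space is any finite-dimensional normed space, rather than one in class
  \<open>euclidean_space\<close>, because dimension \<open>0\<close> must be allowed (the base of a Lie group is a point).
  Completeness is automatic in finite dimension. Separation and countability are left to the
  topology of \<open>'a\<close>.
\<close>

definition smooth_manifold :: "('a::topological_space, 'e::banach) manifold \<Rightarrow> bool" where
  "smooth_manifold N \<longleftrightarrow>
     (\<exists>B::'e set. finite B \<and> span B = UNIV) \<and>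
     (\<forall>c\<in>Atlas N. open (fst c) \<and> open (snd c ` fst c) \<and>
        homeomorphism (fst c) (snd c ` fst c) (snd c) (chart_inv c)) \<and>
     (\<forall>x. chart_at N x \<in> Atlas N \<and> x \<in> fst (chart_at N x)) \<and>
     (\<forall>c\<in>Atlas N. \<forall>d\<in>Atlas N. smooth_on (snd c ` (fst c \<inter> fst d)) (snd d \<circ> chart_inv c))"

definition model_manifold :: "('e, 'e) manifold" where
  "model_manifold = \<lparr>Atlas = {(UNIV, id)}, chart_at = (\<lambda>_. (UNIV, id))\<rparr>"

definition chart_prod :: "('a, 'e) chart \<Rightarrow> ('b, 'f) chart \<Rightarrow> ('a \<times> 'b, 'e \<times> 'f) chart" where
  "chart_prod c d = (fst c \<times> fst d, map_prod (snd c) (snd d))"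

definition prod_manifold ::
  "('a, 'e) manifold \<Rightarrow> ('b, 'f) manifold \<Rightarrow> ('a \<times> 'b, 'e \<times> 'f) manifold"
  (infixr "\<times>\<^sub>M" 80) where
  "N \<times>\<^sub>M P = \<lparr>Atlas = (\<lambda>(c, d). chart_prod c d) ` (Atlas N \<times> Atlas P),
     chart_at = (\<lambda>(x, y). chart_prod (chart_at N x) (chart_at P y))\<rparr>"

text \<open>Smoothness on an open set \<open>W\<close>, and on an arbitrary subset \<open>S\<close> (local smooth extensions;
  for an embedded submanifold \<open>S\<close> this is smoothness on the manifold \<open>S\<close>).\<close>

definition smooth_map_on ::
  "('a::topological_space, 'e::real_normed_vector) manifold
     \<Rightarrow> ('b::topological_space, 'f::real_normed_vector) manifold \<Rightarrow> 'a set \<Rightarrow> ('a \<Rightarrow> 'b) \<Rightarrow> bool" where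
  "smooth_map_on N P W f \<longleftrightarrow> open W \<and> continuous_on W f \<and>
     (\<forall>c\<in>Atlas N. \<forall>d\<in>Atlas P.
        smooth_on (snd c ` (W \<inter> fst c \<inter> f -` fst d)) (snd d \<circ> f \<circ> chart_inv c))"

definition smooth_map_on_subset ::
  "('a::topological_space, 'e::real_normed_vector) manifold
     \<Rightarrow> ('b::topological_space, 'f::real_normed_vector) manifold \<Rightarrow> 'a set \<Rightarrow> ('a \<Rightarrow> 'b) \<Rightarrow> bool" where
  "smooth_map_on_subset N P S f \<longleftrightarrow>
     (\<forall>x\<in>S. \<exists>W F. x \<in> W \<and> smooth_map_on N P W F \<and> (\<forall>y\<in>W \<inter> S. F y = f y))"

text \<open>The tangent map \<open>T\<^sub>xN \<rightarrow> T\<^bsub>f x\<^esub>P\<close>, with tangent spaces read in the preferred charts.\<close>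

definition tangent_map ::
  "('a, 'e::real_normed_vector) manifold \<Rightarrow> ('b, 'f::real_normed_vector) manifold
     \<Rightarrow> ('a \<Rightarrow> 'b) \<Rightarrow> 'a \<Rightarrow> 'e \<Rightarrow> 'f" where
  "tangent_map N P f x =
     frechet_derivative (snd (chart_at P (f x)) \<circ> f \<circ> chart_inv (chart_at N x))
       (at (snd (chart_at N x) x))"

definition velocity :: "('a, 'e::real_normed_vector) manifold \<Rightarrow> (real \<Rightarrow> 'a) \<Rightarrow> 'e" where
  "velocity N \<gamma> = tangent_map model_manifold N \<gamma> 0 1"

definition curve_in ::
  "('a::topological_space, 'e::real_normed_vector) manifold \<Rightarrow> 'a set \<Rightarrow> 'a \<Rightarrow> (real \<Rightarrow> 'a) \<Rightarrow> bool" where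
  "curve_in N S x \<gamma> \<longleftrightarrow> \<gamma> 0 = x \<and>
     (\<exists>\<epsilon>>0. smooth_map_on model_manifold N {-\<epsilon><..<\<epsilon>} \<gamma> \<and> \<gamma> ` {-\<epsilon><..<\<epsilon>} \<subseteq> S)"

text \<open>For an embedded submanifold \<open>S\<close> of \<open>N\<close>: the subspace \<open>T\<^sub>xS\<close> of \<open>T\<^sub>xN\<close>, and the tangent map
  on it of a smooth map \<open>f\<close> defined on \<open>S\<close> only.\<close>

definition tangent_space ::
  "('a::topological_space, 'e::real_normed_vector) manifold \<Rightarrow> 'a set \<Rightarrow> 'a \<Rightarrow> 'e set" where
  "tangent_space N S x = {velocity N \<gamma> | \<gamma>. curve_in N S x \<gamma>}"

definition tangent_map_on ::
  "('a::topological_space, 'e::real_normed_vector) manifold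
     \<Rightarrow> ('b, 'f::real_normed_vector) manifold \<Rightarrow> 'a set \<Rightarrow> ('a \<Rightarrow> 'b) \<Rightarrow> 'a \<Rightarrow> 'e \<Rightarrow> 'f" where
  "tangent_map_on N P S f x v =
     (THE w. \<exists>\<gamma>. curve_in N S x \<gamma> \<and> velocity N \<gamma> = v \<and> velocity P (f \<circ> \<gamma>) = w)"


section \<open>Multivectors and multivector fields\<close>

text \<open>
  An element of \<open>\<wedge>\<^sup>kV\<close> is represented by the alternating \<open>k\<close>-linear form on \<open>V\<^sup>*\<close> it induces; the
  covector arguments are \<open>\<xi> 0, \<dots>, \<xi> (k - 1)\<close>, and the remaining \<open>\<xi> i\<close> are irrelevant.
\<close>

type_synonym 'e multivector = "(nat \<Rightarrow> 'e \<Rightarrow>\<^sub>L real) \<Rightarrow> real"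

definition multivectors :: "nat \<Rightarrow> 'e::real_normed_vector multivector set" where
  "multivectors k = {\<omega>.
     (\<forall>\<xi> \<eta>. (\<forall>i<k. \<xi> i = \<eta> i) \<longrightarrow> \<omega> \<xi> = \<omega> \<eta>) \<and>
     (\<forall>\<xi>. \<forall>i<k. linear (\<lambda>\<alpha>. \<omega> (\<xi>(i := \<alpha>)))) \<and>
     (\<forall>\<xi>. \<forall>i<k. \<forall>j<k. i \<noteq> j \<longrightarrow> \<xi> i = \<xi> j \<longrightarrow> \<omega> \<xi> = 0)}"

text \<open>The induced map \<open>\<wedge>\<^sup>kL\<close>, for a linear map \<open>L\<close>.\<close>

definition pushforward ::
  "('e::real_normed_vector \<Rightarrow> 'f::real_normed_vector) \<Rightarrow> 'e multivector \<Rightarrow> 'f multivector" where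
  "pushforward L \<omega> = (\<lambda>\<xi>. \<omega> (\<lambda>i. \<xi> i o\<^sub>L Blinfun L))"

definition wedge :: "nat \<Rightarrow> (nat \<Rightarrow> 'e::real_normed_vector) \<Rightarrow> 'e multivector" where
  "wedge k v = (\<lambda>\<xi>. \<Sum>p | p permutes {..<k}. of_int (sign p) * (\<Prod>i<k. blinfun_apply (\<xi> i) (v (p i))))"

lemma pushforward_wedge:
  assumes "bounded_linear L"
  shows "pushforward L (wedge k v) = wedge k (\<lambda>i. L (v i))"
  using assms by (simp add: pushforward_def wedge_def bounded_linear_Blinfun_apply)

text \<open>The \<open>k\<close>-vector fields on \<open>N\<close>; smoothness means smooth components in every chart.\<close>

definition multivector_fields ::
  "nat \<Rightarrow> ('a, 'e::real_normed_vector) manifold \<Rightarrow> ('a \<Rightarrow> 'e multivector) set" where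
  "multivector_fields k N = {\<Lambda>. (\<forall>x. \<Lambda> x \<in> multivectors k) \<and>
     (\<forall>c\<in>Atlas N. \<forall>\<eta>. smooth_on (snd c ` fst c)
        (\<lambda>y. let x = chart_inv c y in pushforward (tangent_map N model_manifold (snd c) x) (\<Lambda> x) \<eta>))}"

definition oplus ::
  "('a \<Rightarrow> 'e::real_normed_vector multivector) \<Rightarrow> ('b \<Rightarrow> 'f::real_normed_vector multivector)
     \<Rightarrow> 'a \<times> 'b \<Rightarrow> ('e \<times> 'f) multivector" (infixr "\<oplus>\<^sub>M" 65) where
  "\<Lambda> \<oplus>\<^sub>M \<Lambda>' =
     (\<lambda>(x, y). pushforward (\<lambda>v. (v, 0)) (\<Lambda> x) + pushforward (\<lambda>w. (0, w)) (\<Lambda>' y))"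

definition coisotropic ::
  "nat \<Rightarrow> ('a::topological_space, 'e::real_normed_vector) manifold \<Rightarrow> 'a set
     \<Rightarrow> ('a \<Rightarrow> 'e multivector) \<Rightarrow> bool" where
  "coisotropic k N S \<Lambda> \<longleftrightarrow>
     (\<forall>x\<in>S. \<forall>\<xi>. (\<forall>i<k. \<forall>v\<in>tangent_space N S x. blinfun_apply (\<xi> i) v = 0) \<longrightarrow> \<Lambda> x \<xi> = 0)"


section \<open>Lie groupoids\<close>

record ('g, 'e, 'm, 'f) groupoid =
  Arr :: "('g, 'e) manifold"
  Obj :: "('m, 'f) manifold"
  src :: "'g \<Rightarrow> 'm"
  tgt :: "'g \<Rightarrow> 'm"
  one :: "'m \<Rightarrow> 'g"
  ginv :: "'g \<Rightarrow> 'g"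
  gmul :: "'g \<Rightarrow> 'g \<Rightarrow> 'g"

text \<open>The product \<open>gmul G g h\<close> is relevant only if \<open>src G g = tgt G h\<close>. The conditions on \<open>src\<close>
  and \<open>tgt\<close> say that they are submersions (they are onto because of \<open>one\<close>).\<close>

definition lie_groupoid ::
  "('g::topological_space, 'e::banach, 'm::topological_space, 'f::banach) groupoid \<Rightarrow> bool" where
  "lie_groupoid G \<longleftrightarrow>
     (\<forall>g h. src G g = tgt G h \<longrightarrow> src G (gmul G g h) = src G h \<and> tgt G (gmul G g h) = tgt G g) \<and>
     (\<forall>g h l. src G g = tgt G h \<longrightarrow> src G h = tgt G l \<longrightarrow>
        gmul G (gmul G g h) l = gmul G g (gmul G h l)) \<and>
     (\<forall>x. src G (one G x) = x \<and> tgt G (one G x) = x) \<and>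
     (\<forall>g. gmul G g (one G (src G g)) = g \<and> gmul G (one G (tgt G g)) g = g) \<and>
     (\<forall>g. src G (ginv G g) = tgt G g \<and> tgt G (ginv G g) = src G g \<and>
        gmul G g (ginv G g) = one G (tgt G g) \<and> gmul G (ginv G g) g = one G (src G g)) \<and>
     smooth_manifold (Arr G) \<and> smooth_manifold (Obj G) \<and>
     smooth_map_on (Arr G) (Obj G) UNIV (src G) \<and>
     smooth_map_on (Arr G) (Obj G) UNIV (tgt G) \<and>
     smooth_map_on (Obj G) (Arr G) UNIV (one G) \<and>
     smooth_map_on (Arr G) (Arr G) UNIV (ginv G) \<and>
     (\<forall>g. surj (tangent_map (Arr G) (Obj G) (src G) g)) \<and>
     (\<forall>g. surj (tangent_map (Arr G) (Obj G) (tgt G) g)) \<and>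
     smooth_map_on_subset (Arr G \<times>\<^sub>M Arr G) (Arr G) {(g, h). src G g = tgt G h}
       (\<lambda>(g, h). gmul G g h)"

context
  fixes G :: "('g::topological_space, 'e::banach, 'm::topological_space, 'f::banach) groupoid"
begin

definition multiplicative_fields :: "nat \<Rightarrow> ('g \<Rightarrow> 'e multivector) set" where
  "multiplicative_fields k = {\<Lambda> \<in> multivector_fields k (Arr G).
     coisotropic k (Arr G \<times>\<^sub>M Arr G \<times>\<^sub>M Arr G)
       {(g, h, gmul G g h) | g h. src G g = tgt G h}
       (\<Lambda> \<oplus>\<^sub>M \<Lambda> \<oplus>\<^sub>M (-1) ^ (k + 1) *\<^sub>R \<Lambda>)}"

definition affine_fields :: "nat \<Rightarrow> ('g \<Rightarrow> 'e multivector) set" where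
  "affine_fields k = {\<Lambda> \<in> multivector_fields k (Arr G).
     coisotropic k (Arr G \<times>\<^sub>M Arr G \<times>\<^sub>M Arr G \<times>\<^sub>M Arr G)
       {(g, h, l, gmul G (gmul G h (ginv G g)) l) | g h l. src G g = src G h \<and> tgt G g = tgt G l}
       (\<Lambda> \<oplus>\<^sub>M (-1) ^ (k + 1) *\<^sub>R \<Lambda> \<oplus>\<^sub>M (-1) ^ (k + 1) *\<^sub>R \<Lambda> \<oplus>\<^sub>M \<Lambda>)}"

definition algebroid :: "'m \<Rightarrow> 'e set" where
  "algebroid x = {v. tangent_map (Arr G) (Obj G) (src G) (one G x) v = 0}"

text \<open>The projection onto \<open>A\<^sub>x\<close> in the decomposition \<open>T\<G>|\<^sub>M = TM \<oplus> A\<close> at the unit of \<open>x\<close>.\<close>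

definition pr_A :: "'m \<Rightarrow> 'e \<Rightarrow> 'e" where
  "pr_A x v =
     (THE a. a \<in> algebroid x \<and> v - a \<in> range (tangent_map (Obj G) (Arr G) (one G) x))"

text \<open>The \<open>\<wedge>\<^sup>kA\<close>-component along the units, with \<open>\<wedge>\<^sup>kA\<^sub>x\<close> seen inside \<open>\<wedge>\<^sup>kT\<G>\<close> at the unit of \<open>x\<close>.\<close>

definition pr_wedge_A :: "('g \<Rightarrow> 'e multivector) \<Rightarrow> 'm \<Rightarrow> 'e multivector" where
  "pr_wedge_A \<Lambda> x = pushforward (pr_A x) (\<Lambda> (one G x))"

text \<open>
  \<open>dR g\<close> is defined on \<open>A\<close> at \<open>tgt G g\<close>, the tangent space of the source fibre on which right
  translation by \<open>g\<close> is defined; \<open>dL g\<close> is defined on the tangent space of the target fibre.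
\<close>

definition dR :: "'g \<Rightarrow> 'e \<Rightarrow> 'e" where
  "dR g = tangent_map_on (Arr G) (Arr G) {h. src G h = tgt G g} (\<lambda>h. gmul G h g)
     (one G (tgt G g))"

definition dL :: "'g \<Rightarrow> 'e \<Rightarrow> 'e" where
  "dL g = tangent_map_on (Arr G) (Arr G) {h. tgt G h = src G g} (\<lambda>h. gmul G g h)
     (one G (src G g))"

text \<open>
  For a section \<open>\<pi>\<close> of \<open>\<wedge>\<^sup>kA\<close>, apply \<open>\<wedge>\<^sup>k\<close> of the maps \<open>A \<rightarrow> T\<^sub>g\<G>\<close> that translate sections of \<open>A\<close>;
  \<open>pushforward_wedge\<close> is the factorwise rule. Composition with \<open>pr_A\<close>, the identity on \<open>A\<close>,
  only extends these maps linearly to the whole tangent space at the unit.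
\<close>

definition right_translate :: "('m \<Rightarrow> 'e multivector) \<Rightarrow> 'g \<Rightarrow> 'e multivector" where
  "right_translate \<pi> g = pushforward (\<lambda>v. dR g (pr_A (tgt G g) v)) (\<pi> (tgt G g))"

definition left_translate :: "('m \<Rightarrow> 'e multivector) \<Rightarrow> 'g \<Rightarrow> 'e multivector" where
  "left_translate \<pi> g =
     pushforward
       (\<lambda>v. - dL g (tangent_map (Arr G) (Arr G) (ginv G) (one G (src G g)) (pr_A (src G g) v)))
       (\<pi> (src G g))"

end

end

(* The conormals of the graph of the multiplication form the graph of the cotangent groupoid T*G over
   the dual A* of the Lie algebroid. Hence a multiplicative k-vector field is a multilinear function P
   on k-tuples of covectors with common sources and targets such that P(ab) = P(a) + P(b), and an
   affine one satisfies P(b a^-1 c) = P(b) - P(a) + P(c), equivalently P(ab) = P(a) + P(b) - P(1_s(a)).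
   In these terms the right and left translates of the A-component are a -> P(1_t(a)) and
   a -> P(1_s(a)), so that all groupoid identities become formal. The arrow inverse to P is P minus
   both translates.

   Tangent vectors are velocities of curves, so the conormals are computed by lifting curves along the
   submersions s and t, which needs the inverse function theorem. *)

theory Submission
  imports Defs
begin

section \<open>Finite-dimensional normed spaces\<close>

text \<open>Two obstacles shape the proof. The model spaces are Banach spaces with a finite spanning
  set, dimension 0 included, so bounded coordinate functionals are built first and carry the
  calculus: a family of linear maps is handled through its values on finitely many vectors.
  Secondly, the product is smooth only through local extensions off the composable pairs. The
  tangent product \<open>Tm\<close> therefore depends on a choice away from composable vectors: it
  is linear on all pairs, but its groupoid laws hold for composable vectors, and its source, target
  and associativity laws come from differentiating along composable curves. The sign in the
  coisotropy conditions disappears because (-1)^(k+1) P(\<xi>) = -P(-\<xi>): negating some covectors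
  turns conormality into a product relation. For affine fields, a conormal of the four-term graph
  must be split as b a^-1 c = b (a^-1 c), with a covector a^-1 c that has to be constructed. Closure
  under translation also requires smooth translates; the projection onto A enters there as a
  difference of two partial derivatives of smooth local maps.\<close>

text \<open>For \<open>c\<close> nonzero the right-hand side is \<open>\<bar>c\<bar>\<close> times
  the distance from \<open>b\<close> to \<open>- (1 / c) *\<^sub>R f\<close>, a point of
  \<open>S\<close>. Thus the norm of a sum controls the coefficient of \<open>b\<close>.\<close>

lemma infdist_scaleR_le:
  fixes b :: "'a::real_normed_vector"
  assumes "subspace S" "f \<in> S"
  shows "\<bar>c\<bar> * infdist b S \<le> norm (c *\<^sub>R b + f)"
proof (cases "c = 0")
  case False
  have "- (1 / c) *\<^sub>R f \<in> S"
    using assms by (rule subspace_scale)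
  then have "infdist b S \<le> dist b (- (1 / c) *\<^sub>R f)"
    by (rule infdist_le)
  also have "\<dots> = norm ((1 / c) *\<^sub>R (c *\<^sub>R b + f))"
    using False by (simp add: dist_norm algebra_simps)
  also have "\<dots> = norm (c *\<^sub>R b + f) / \<bar>c\<bar>"
    by simp
  finally show ?thesis
    using False by (simp add: field_simps)
qed simp

text \<open>Induction over the spanning set. A new vector \<open>b\<close> has positive distance
  from the previous span, which is complete and hence closed, so along a Cauchy sequence the
  coefficients of \<open>b\<close> are Cauchy, and then so are the remainders.\<close>

lemma complete_span_finite:
  fixes F :: "'a::real_normed_vector set"
  assumes "finite F"
  shows "complete (span F)"
  using assms
proof (induction F rule: finite_induct)
  case empty
  then show ?case by (simp add: compact_imp_complete)
next
  case (insert b F)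
  show ?case
  proof (cases "b \<in> span F")
    case True
    then show ?thesis
      using insert.IH by (simp add: span_redundant)
  next
    case False
    let ?d = "infdist b (span F)"
    have d: "?d > 0"
      using False complete_imp_closed[OF insert.IH]
      by (metis infdist_nonneg infdist_zero in_closed_iff_infdist_zero span_0 empty_iff order_le_less)
    show ?thesis
    proof (rule completeI)
      fix x :: "nat \<Rightarrow> 'a"
      assume x: "\<forall>n. x n \<in> span (insert b F)" and cau: "Cauchy x"
      have "\<forall>n. \<exists>c. x n - c *\<^sub>R b \<in> span F"
        using x span_breakdown_eq by blast
      then obtain c where c: "\<And>n. x n - c n *\<^sub>R b \<in> span F"
        by metis
      have le: "\<bar>c m - c n\<bar> * ?d \<le> norm (x m - x n)" for m n
      proof -
        have "(x m - c m *\<^sub>R b) - (x n - c n *\<^sub>R b) \<in> span F"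
          using c span_diff by blast
        from infdist_scaleR_le[OF subspace_span this, of "c m - c n" b]
        show ?thesis
          by (simp add: algebra_simps)
      qed
      have "Cauchy c"
      proof (rule CauchyI)
        fix e :: real assume "e > 0"
        then obtain M where M: "\<forall>m\<ge>M. \<forall>n\<ge>M. norm (x m - x n) < e * ?d"
          using cau d by (meson CauchyD mult_pos_pos)
        have "norm (c m - c n) < e" if "m \<ge> M" "n \<ge> M" for m n
          using le[of m n] M that d
          by (metis mult_less_cancel_right_pos order_le_less_trans real_norm_def)
        then show "\<exists>M. \<forall>m\<ge>M. \<forall>n\<ge>M. norm (c m - c n) < e"
          by blast
      qed
      then obtain c0 where c0: "c \<longlonglongrightarrow> c0"
        using Cauchy_convergent convergent_def by blast
      have cb: "(\<lambda>n. c n *\<^sub>R b) \<longlonglongrightarrow> c0 *\<^sub>R b"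
        by (intro tendsto_intros c0)
      have "Cauchy (\<lambda>n. x n - c n *\<^sub>R b)"
      proof (rule CauchyI)
        fix e :: real assume "e > 0"
        then obtain M N where M: "\<forall>m\<ge>M. \<forall>n\<ge>M. norm (x m - x n) < e / 2"
          and N: "\<forall>m\<ge>N. \<forall>n\<ge>N. norm (c m *\<^sub>R b - c n *\<^sub>R b) < e / 2"
          using CauchyD[OF cau, of "e / 2"] CauchyD[OF LIMSEQ_imp_Cauchy[OF cb], of "e / 2"]
          by auto
        have "norm ((x m - c m *\<^sub>R b) - (x n - c n *\<^sub>R b)) < e" if "m \<ge> max M N" "n \<ge> max M N" for m n
        proof -
          have "norm ((x m - x n) - (c m *\<^sub>R b - c n *\<^sub>R b))
              \<le> norm (x m - x n) + norm (c m *\<^sub>R b - c n *\<^sub>R b)"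
            by (rule norm_triangle_ineq4)
          also have "\<dots> < e / 2 + e / 2"
            using M N that by (intro add_strict_mono) auto
          finally show ?thesis
            by (simp add: algebra_simps)
        qed
        then show "\<exists>M. \<forall>m\<ge>M. \<forall>n\<ge>M. norm ((x m - c m *\<^sub>R b) - (x n - c n *\<^sub>R b)) < e"
          by blast
      qed
      then obtain f where f: "f \<in> span F" "(\<lambda>n. x n - c n *\<^sub>R b) \<longlonglongrightarrow> f"
        using completeE[OF insert.IH, of "\<lambda>n. x n - c n *\<^sub>R b"] c by blast
      have "x \<longlonglongrightarrow> f + c0 *\<^sub>R b"
        using tendsto_add[OF f(2) cb] by simp
      moreover have "f + c0 *\<^sub>R b \<in> span (insert b F)"
        using f(1) by (metis add_diff_cancel_right' span_breakdown_eq)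
      ultimately show "\<exists>l\<in>span (insert b F). x \<longlonglongrightarrow> l"
        by blast
    qed
  qed
qed

text \<open>Finite dimension as a finite system of bounded functionals that reproduces every vector;
  the empty system covers dimension 0.\<close>

definition coordinates :: "'e::real_normed_vector set \<Rightarrow> ('e \<Rightarrow> 'e \<Rightarrow>\<^sub>L real) \<Rightarrow> bool" where
  "coordinates B cf \<longleftrightarrow> finite B \<and> (\<forall>x. (\<Sum>b\<in>B. blinfun_apply (cf b) x *\<^sub>R b) = x)"

definition findim :: "'e::real_normed_vector itself \<Rightarrow> bool" where
  "findim _ \<longleftrightarrow> (\<exists>B cf. coordinates (B::'e set) cf)"

lemma findimE:
  assumes "findim TYPE('e::real_normed_vector)"
  obtains B and cf :: "'e::real_normed_vector \<Rightarrow> 'e \<Rightarrow>\<^sub>L real" where "coordinates B cf"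
  using assms unfolding findim_def by blast

text \<open>A basis is extracted. The coefficient of \<open>b\<close> is bounded by the reciprocal
  of the distance from \<open>b\<close> to the span of the other basis vectors, which is positive
  because that span is closed.\<close>

lemma findim_span:
  assumes "finite (B::'e::real_normed_vector set)" "span B = UNIV"
  shows "findim TYPE('e)"
proof -
  obtain C where C: "C \<subseteq> B" "independent C" "span C = UNIV"
    using assms by (metis maximal_independent_subset span_mono span_span subset_antisym subset_UNIV)
  have fin: "finite C"
    using C assms finite_subset by blast
  let ?r = "\<lambda>b x. representation C x b"
  have sum: "(\<Sum>b\<in>C. ?r b x *\<^sub>R b) = x" for x
    by (rule sum_representation_eq[OF C(2) _ fin]) (auto simp: C(3))
  have bl: "bounded_linear (?r b)" if b: "b \<in> C" for b
  proof -
    let ?S = "span (C - {b})"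
    have "b \<notin> ?S"
      using C(2) b dependent_def by blast
    then have d: "infdist b ?S > 0"
      using complete_imp_closed[OF complete_span_finite[of "C - {b}"]] fin
      by (metis finite_Diff infdist_nonneg in_closed_iff_infdist_zero span_0 empty_iff order_le_less)
    have le: "norm (?r b x) \<le> norm x * (1 / infdist b ?S)" for x
    proof -
      have "(\<Sum>a\<in>C - {b}. ?r a x *\<^sub>R a) \<in> ?S"
        by (intro span_sum span_scale span_base)
      moreover have "?r b x *\<^sub>R b + (\<Sum>a\<in>C - {b}. ?r a x *\<^sub>R a) = x"
        using sum[of x] by (simp add: sum.remove[OF fin b])
      ultimately have "\<bar>?r b x\<bar> * infdist b ?S \<le> norm x"
        using infdist_scaleR_le[OF subspace_span] by metis
      then show ?thesis
        using d by (simp add: field_simps)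
    qed
    show ?thesis
      using C(2,3) le
      by (intro bounded_linear_intro[where K="1 / infdist b ?S"])
        (auto simp: representation_add representation_scale)
  qed
  have "coordinates C (\<lambda>b. Blinfun (?r b))"
    unfolding coordinates_def using fin sum
    by (simp add: bl bounded_linear_Blinfun_apply cong: sum.cong)
  then show ?thesis
    unfolding findim_def by blast
qed

lemma findim_linear_bounded:
  fixes f :: "'e::real_normed_vector \<Rightarrow> 'f::real_normed_vector"
  assumes "findim TYPE('e)" "linear f"
  shows "bounded_linear f"
proof -
  obtain B and cf :: "'e \<Rightarrow> 'e \<Rightarrow>\<^sub>L real" where B: "coordinates B cf"
    using assms(1) by (rule findimE)
  have eq: "f x = (\<Sum>b\<in>B. blinfun_apply (cf b) x *\<^sub>R f b)" for x
  proof -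
    have "f x = f (\<Sum>b\<in>B. blinfun_apply (cf b) x *\<^sub>R b)"
      using B by (simp add: coordinates_def)
    then show ?thesis
      by (simp add: linear_sum[OF assms(2)] linear_scale[OF assms(2)])
  qed
  have "bounded_linear (\<lambda>x. \<Sum>b\<in>B. blinfun_apply (cf b) x *\<^sub>R f b)"
    by (intro bounded_linear_sum bounded_linear_scaleR_left[THEN bounded_linear_compose]
        blinfun.bounded_linear_right)
  then show ?thesis
    by (simp add: eq[abs_def, symmetric] eq[symmetric])
qed

lemma findim_real: "findim TYPE(real)"
  by (rule findim_span[of "{1}"]) (auto simp: span_singleton)

lemma findim_prod:
  assumes "findim TYPE('e::real_normed_vector)" "findim TYPE('f::real_normed_vector)"
  shows "findim TYPE('e \<times> 'f)"
proof -
  obtain B and cf :: "'e \<Rightarrow> 'e \<Rightarrow>\<^sub>L real" where B: "coordinates B cf"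
    using assms(1) by (rule findimE)
  obtain C and cg :: "'f \<Rightarrow> 'f \<Rightarrow>\<^sub>L real" where C: "coordinates C cg"
    using assms(2) by (rule findimE)
  let ?D = "(\<lambda>b. (b, 0)) ` B \<union> (\<lambda>c. (0, c)) ` C"
  have "(x, y) \<in> span ?D" for x y
  proof -
    have "(\<Sum>b\<in>B. blinfun_apply (cf b) x *\<^sub>R (b, 0::'f)) + (\<Sum>c\<in>C. blinfun_apply (cg c) y *\<^sub>R (0::'e, c)) \<in> span ?D"
      by (intro span_add span_sum span_scale span_base) auto
    moreover have "(\<Sum>b\<in>B. blinfun_apply (cf b) x *\<^sub>R (b, 0::'f)) = (x, 0)"
      using B by (simp add: coordinates_def prod_eq_iff fst_sum snd_sum)
    moreover have "(\<Sum>c\<in>C. blinfun_apply (cg c) y *\<^sub>R (0::'e, c)) = (0, y)"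
      using C by (simp add: coordinates_def prod_eq_iff fst_sum snd_sum)
    ultimately show ?thesis
      by simp
  qed
  then have "span ?D = UNIV"
    by auto
  then show ?thesis
    using B C by (intro findim_span[of ?D]) (auto simp: coordinates_def)
qed

section \<open>Calculus of smooth functions\<close>

lemma has_frechet_derivative:
  "f differentiable (at x) \<Longrightarrow> (f has_derivative frechet_derivative f (at x)) (at x)"
  by (simp add: frechet_derivative_works)

lemma frechet_derivative_eqI:
  "(f has_derivative f') (at x) \<Longrightarrow> frechet_derivative f (at x) = f'"
  by (metis frechet_derivative_at)

lemma C_on_subset: "C_on n U f \<Longrightarrow> V \<subseteq> U \<Longrightarrow> C_on n V f"
proof (induction n arbitrary: f)
  case 0
  then show ?case by (simp add: continuous_on_subset)
next
  case (Suc n)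
  then show ?case by (auto simp: subset_iff)
qed

text \<open>The derivative depends on the germ of a function, so openness of \<open>U\<close> lets
  the equality be differentiated repeatedly.\<close>

lemma C_on_cong:
  assumes "open U" "\<And>x. x \<in> U \<Longrightarrow> f x = g x"
  shows "C_on n U f \<longleftrightarrow> C_on n U g"
proof -
  have "C_on n U g" if "C_on n U f" "\<And>x. x \<in> U \<Longrightarrow> f x = g x" for f g :: "'a \<Rightarrow> 'b"
    using that
  proof (induction n arbitrary: f g)
    case 0
    then show ?case by (auto cong: continuous_on_cong)
  next
    case (Suc n)
    have d: "(g has_derivative frechet_derivative f (at x)) (at x)" if "x \<in> U" for x
    proof (rule has_derivative_transform_within_open[OF _ assms(1) that Suc.prems(2)])
      show "(f has_derivative frechet_derivative f (at x)) (at x)"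
        using Suc.prems that by (auto simp: frechet_derivative_works)
    qed
    then have "frechet_derivative g (at x) = frechet_derivative f (at x)" if "x \<in> U" for x
      using that by (simp add: frechet_derivative_eqI)
    then have "C_on n U (\<lambda>x. frechet_derivative g (at x) v)" for v
      using Suc.IH[of "\<lambda>x. frechet_derivative f (at x) v"] Suc.prems(1) by simp
    with d show ?case
      by (auto simp: differentiable_def)
  qed
  with assms(2) show ?thesis by metis
qed

lemma C_on_locally:
  assumes "\<And>x. x \<in> U \<Longrightarrow> \<exists>V. open V \<and> x \<in> V \<and> C_on n V f"
  shows "C_on n U f"
  using assms
proof (induction n arbitrary: f)
  case 0
  have "isCont f x" if "x \<in> U" for x
    using 0[OF that] by (auto simp: continuous_on_eq_continuous_at)
  then show ?case
    by (simp add: continuous_at_imp_continuous_on)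
next
  case (Suc n)
  show ?case
    unfolding C_on.simps
  proof (intro conjI ballI allI)
    show "f differentiable (at x)" if "x \<in> U" for x
      using Suc.prems[OF that] by auto
    show "C_on n U (\<lambda>x. frechet_derivative f (at x) v)" for v
    proof (rule Suc.IH)
      show "\<exists>V. open V \<and> x \<in> V \<and> C_on n V (\<lambda>x. frechet_derivative f (at x) v)" if "x \<in> U" for x
        using Suc.prems[OF that] by auto
    qed
  qed
qed

text \<open>The recursion clause for \<open>Suc n\<close> does not contain the one for
  \<open>n\<close>; at the bottom, differentiability supplies continuity.\<close>

lemma C_on_SucD: "C_on (Suc n) U f \<Longrightarrow> C_on n U f"
proof (induction n arbitrary: f)
  case 0
  then show ?case
    by (auto intro!: continuous_at_imp_continuous_on differentiable_imp_continuous_within)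
next
  case (Suc n)
  then have "C_on n U (\<lambda>x. frechet_derivative f (at x) v)" for v
    by (metis C_on.simps(2))
  with Suc.prems show ?case
    by simp
qed

lemma C_on_const: "C_on n U (\<lambda>x. c)"
  by (induction n arbitrary: c) auto

lemma C_on_bounded_linear:
  assumes "bounded_linear L" shows "C_on n U L"
proof (cases n)
  case 0
  then show ?thesis
    using assms by (simp add: bounded_linear.linear linear_continuous_on)
next
  case (Suc m)
  have "(L has_derivative L) (at x)" for x
    using assms by (rule bounded_linear_imp_has_derivative)
  then have "frechet_derivative L (at x) = L" "L differentiable (at x)" for x
    by (auto simp: frechet_derivative_eqI differentiable_def)
  then show ?thesis
    using Suc by (simp add: C_on_const)
qed

lemma C_on_bounded_linear_compose:
  assumes "bounded_linear L" "open U" "C_on n U f"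
  shows "C_on n U (\<lambda>x. L (f x))"
  using assms(3)
proof (induction n arbitrary: f)
  case 0
  then show ?case
    using assms(1) by (simp add: bounded_linear.continuous_on)
next
  case (Suc n)
  have d: "((\<lambda>x. L (f x)) has_derivative (\<lambda>v. L (frechet_derivative f (at x) v))) (at x)" if "x \<in> U" for x
    using Suc.prems that by (intro bounded_linear.has_derivative[OF assms(1)] has_frechet_derivative) auto
  have "C_on n U (\<lambda>x. frechet_derivative (\<lambda>x. L (f x)) (at x) v)" for v
    using Suc C_on_cong[OF assms(2), of "\<lambda>x. frechet_derivative (\<lambda>x. L (f x)) (at x) v"
        "\<lambda>x. L (frechet_derivative f (at x) v)"]
    by (auto simp: frechet_derivative_eqI[OF d])
  with d show ?case
    by (auto simp: differentiable_def)
qed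

lemma C_on_add:
  assumes "open U" "C_on n U f" "C_on n U g"
  shows "C_on n U (\<lambda>x. f x + g x)"
  using assms(2,3)
proof (induction n arbitrary: f g)
  case 0
  then show ?case by (simp add: continuous_on_add)
next
  case (Suc n)
  have d: "((\<lambda>x. f x + g x) has_derivative
      (\<lambda>v. frechet_derivative f (at x) v + frechet_derivative g (at x) v)) (at x)" if "x \<in> U" for x
    using Suc.prems that by (intro has_derivative_add has_frechet_derivative) auto
  have "C_on n U (\<lambda>x. frechet_derivative (\<lambda>x. f x + g x) (at x) v)" for v
    using Suc C_on_cong[OF assms(1), of "\<lambda>x. frechet_derivative (\<lambda>x. f x + g x) (at x) v"
        "\<lambda>x. frechet_derivative f (at x) v + frechet_derivative g (at x) v"]
    by (auto simp: frechet_derivative_eqI[OF d])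
  with d show ?case
    by (auto simp: differentiable_def)
qed

lemma C_on_bilinear:
  assumes "bounded_bilinear b" "open U" "C_on n U f" "C_on n U g"
  shows "C_on n U (\<lambda>x. b (f x) (g x))"
  using assms(3,4)
proof (induction n arbitrary: f g)
  case 0
  then show ?case
    using bounded_bilinear.continuous_on[OF assms(1)] by simp
next
  case (Suc n)
  have d: "((\<lambda>x. b (f x) (g x)) has_derivative
      (\<lambda>v. b (f x) (frechet_derivative g (at x) v) + b (frechet_derivative f (at x) v) (g x))) (at x)"
    if "x \<in> U" for x
    using Suc.prems that by (intro bounded_bilinear.FDERIV[OF assms(1)] has_frechet_derivative) auto
  have "C_on n U f" "C_on n U g"
    using Suc.prems by (auto intro: C_on_SucD)
  then have "C_on n U (\<lambda>x. b (f x) (frechet_derivative g (at x) v) + b (frechet_derivative f (at x) v) (g x))" for v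
    using Suc.prems by (intro C_on_add[OF assms(2)] Suc.IH) auto
  then have "C_on n U (\<lambda>x. frechet_derivative (\<lambda>x. b (f x) (g x)) (at x) v)" for v
    using C_on_cong[OF assms(2), of "\<lambda>x. frechet_derivative (\<lambda>x. b (f x) (g x)) (at x) v"
        "\<lambda>x. b (f x) (frechet_derivative g (at x) v) + b (frechet_derivative f (at x) v) (g x)"]
    by (auto simp: frechet_derivative_eqI[OF d])
  with d show ?case
    by (auto simp: differentiable_def)
qed

lemma C_on_sum:
  assumes "open U" "finite I" "\<And>i. i \<in> I \<Longrightarrow> C_on n U (f i)"
  shows "C_on n U (\<lambda>x. \<Sum>i\<in>I. f i x)"
  using assms(2,3) by (induction I rule: finite_induct) (auto simp: C_on_const intro!: C_on_add[OF assms(1)])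

lemma C_on_Pair:
  assumes "open U" "C_on n U f" "C_on n U g"
  shows "C_on n U (\<lambda>x. (f x, g x))"
proof -
  have "C_on n U (\<lambda>x. (f x, 0) + (0, g x))"
    by (intro C_on_add assms C_on_bounded_linear_compose[of "\<lambda>x. (x, 0)"]
        C_on_bounded_linear_compose[of "\<lambda>x. (0, x)"] bounded_linear_Pair bounded_linear_ident bounded_linear_zero)
  then show ?thesis
    by simp
qed

lemma linear_coordinates:
  assumes "coordinates B cf" "linear L"
  shows "L v = (\<Sum>b\<in>B. blinfun_apply (cf b) v *\<^sub>R L b)"
proof -
  have "L v = L (\<Sum>b\<in>B. blinfun_apply (cf b) v *\<^sub>R b)"
    using assms(1) by (simp add: coordinates_def)
  then show ?thesis
    by (simp add: linear_sum[OF assms(2)] linear_scale[OF assms(2)])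
qed

text \<open>The moving vector \<open>h x\<close> is expanded in finitely many coordinates, so
  regularity at each fixed vector suffices. This replaces regularity of \<open>A\<close> as an
  operator-valued map.\<close>

lemma C_on_linear_family:
  fixes A :: "'a::real_normed_vector \<Rightarrow> 'b::real_normed_vector \<Rightarrow> 'c::real_normed_vector"
  assumes "findim TYPE('b)" "open U" "\<And>x. x \<in> U \<Longrightarrow> linear (A x)"
    "\<And>b. C_on n U (\<lambda>x. A x b)" "C_on n U h"
  shows "C_on n U (\<lambda>x. A x (h x))"
proof -
  obtain B and cf :: "'b \<Rightarrow> 'b \<Rightarrow>\<^sub>L real" where B: "coordinates B cf"
    using assms(1) by (rule findimE)
  have "C_on n U (\<lambda>x. \<Sum>b\<in>B. blinfun_apply (cf b) (h x) *\<^sub>R A x b)"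
    using B assms(2,4,5)
    by (intro C_on_sum C_on_bilinear[OF bounded_bilinear_scaleR]
        C_on_bounded_linear_compose[OF blinfun.bounded_linear_right])
      (auto simp: coordinates_def)
  then show ?thesis
    using C_on_cong[OF assms(2), of "\<lambda>x. A x (h x)" "\<lambda>x. \<Sum>b\<in>B. blinfun_apply (cf b) (h x) *\<^sub>R A x b"]
      linear_coordinates[OF B assms(3)] by auto
qed

text \<open>By the chain rule the derivative is the linear family
  \<open>frechet_derivative f (at (g x))\<close> applied to the moving vector
  \<open>frechet_derivative g (at x) v\<close>. The induction varies \<open>f\<close>, whose place
  is taken by its directional derivatives.\<close>

lemma C_on_compose:
  fixes f :: "'b::real_normed_vector \<Rightarrow> 'c::real_normed_vector" and g :: "'a::real_normed_vector \<Rightarrow> 'b"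
  assumes "findim TYPE('b)" "open U" "C_on n V f" "C_on n U g" "g ` U \<subseteq> V"
  shows "C_on n U (\<lambda>x. f (g x))"
  using assms(3,4)
proof (induction n arbitrary: f)
  case 0
  then show ?case
    using assms(5) continuous_on_compose2 by auto
next
  case (Suc n)
  have d: "((\<lambda>x. f (g x)) has_derivative
      (\<lambda>v. frechet_derivative f (at (g x)) (frechet_derivative g (at x) v))) (at x)" if "x \<in> U" for x
    using Suc.prems that assms(5)
      has_derivative_compose[OF has_frechet_derivative[of g x] has_frechet_derivative[of f "g x"]]
    by (auto simp: o_def)
  have g: "C_on n U g"
    using Suc.prems by (blast intro: C_on_SucD)
  have "C_on n U (\<lambda>x. frechet_derivative f (at (g x)) (frechet_derivative g (at x) v))" for v
  proof (rule C_on_linear_family[OF assms(1,2)])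
    show "linear (frechet_derivative f (at (g x)))" if "x \<in> U" for x
      using that Suc.prems(1) assms(5) by (intro linear_frechet_derivative) auto
    show "C_on n U (\<lambda>x. frechet_derivative f (at (g x)) b)" for b
      using Suc.prems(1) by (intro Suc.IH g) auto
    show "C_on n U (\<lambda>x. frechet_derivative g (at x) v)"
      using Suc.prems(2) by simp
  qed
  then have "C_on n U (\<lambda>x. frechet_derivative (\<lambda>x. f (g x)) (at x) v)" for v
    using C_on_cong[OF assms(2), of "\<lambda>x. frechet_derivative (\<lambda>x. f (g x)) (at x) v"
        "\<lambda>x. frechet_derivative f (at (g x)) (frechet_derivative g (at x) v)"]
    by (auto simp: frechet_derivative_eqI[OF d])
  with d show ?case
    by (auto simp: differentiable_def)
qed

lemma smooth_on_subset: "smooth_on U f \<Longrightarrow> V \<subseteq> U \<Longrightarrow> smooth_on V f"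
  unfolding smooth_on_def by (blast intro: C_on_subset)

lemma smooth_on_cong:
  "open U \<Longrightarrow> (\<And>x. x \<in> U \<Longrightarrow> f x = g x) \<Longrightarrow> smooth_on U f \<longleftrightarrow> smooth_on U g"
  unfolding smooth_on_def by (simp add: C_on_cong[of U f g])

lemma smooth_on_locally:
  "(\<And>x. x \<in> U \<Longrightarrow> \<exists>V. open V \<and> x \<in> V \<and> smooth_on V f) \<Longrightarrow> smooth_on U f"
  unfolding smooth_on_def by (intro allI C_on_locally) blast

lemma smooth_on_const: "smooth_on U (\<lambda>x. c)"
  by (simp add: smooth_on_def C_on_const)

lemma smooth_on_bounded_linear: "bounded_linear L \<Longrightarrow> smooth_on U L"
  by (simp add: smooth_on_def C_on_bounded_linear)

lemma smooth_on_ident: "smooth_on U (\<lambda>x. x)"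
  by (rule smooth_on_bounded_linear[OF bounded_linear_ident])

lemma smooth_on_bounded_linear_compose:
  "bounded_linear L \<Longrightarrow> open U \<Longrightarrow> smooth_on U f \<Longrightarrow> smooth_on U (\<lambda>x. L (f x))"
  by (simp add: smooth_on_def C_on_bounded_linear_compose)

lemma smooth_on_add: "open U \<Longrightarrow> smooth_on U f \<Longrightarrow> smooth_on U g \<Longrightarrow> smooth_on U (\<lambda>x. f x + g x)"
  by (simp add: smooth_on_def C_on_add)

lemma smooth_on_sum:
  "open U \<Longrightarrow> finite I \<Longrightarrow> (\<And>i. i \<in> I \<Longrightarrow> smooth_on U (f i)) \<Longrightarrow> smooth_on U (\<lambda>x. \<Sum>i\<in>I. f i x)"
  by (simp add: smooth_on_def C_on_sum)

lemma smooth_on_bilinear: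
  "bounded_bilinear b \<Longrightarrow> open U \<Longrightarrow> smooth_on U f \<Longrightarrow> smooth_on U g \<Longrightarrow> smooth_on U (\<lambda>x. b (f x) (g x))"
  by (simp add: smooth_on_def C_on_bilinear)

lemmas smooth_on_mult = smooth_on_bilinear[OF bounded_bilinear_mult]

lemma smooth_on_minus: "open U \<Longrightarrow> smooth_on U f \<Longrightarrow> smooth_on U (\<lambda>x. - f x)"
  by (rule smooth_on_bounded_linear_compose[OF bounded_linear_minus[OF bounded_linear_ident]])

lemma smooth_on_diff: "open U \<Longrightarrow> smooth_on U f \<Longrightarrow> smooth_on U g \<Longrightarrow> smooth_on U (\<lambda>x. f x - g x)"
  using smooth_on_add[OF _ _ smooth_on_minus, of U f g] by simp

lemma smooth_on_Pair: "open U \<Longrightarrow> smooth_on U f \<Longrightarrow> smooth_on U g \<Longrightarrow> smooth_on U (\<lambda>x. (f x, g x))"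
  by (simp add: smooth_on_def C_on_Pair)

lemma smooth_on_compose:
  fixes f :: "'b::real_normed_vector \<Rightarrow> 'c::real_normed_vector" and g :: "'a::real_normed_vector \<Rightarrow> 'b"
  assumes "findim TYPE('b)" "open U" "smooth_on V f" "smooth_on U g" "g ` U \<subseteq> V"
  shows "smooth_on U (\<lambda>x. f (g x))"
  unfolding smooth_on_def
proof
  show "C_on n U (\<lambda>x. f (g x))" for n
    using C_on_compose[OF assms(1,2) _ _ assms(5), of n f] assms(3,4) by (simp add: smooth_on_def)
qed

lemma smooth_on_differentiable: "smooth_on U f \<Longrightarrow> x \<in> U \<Longrightarrow> f differentiable (at x)"
  unfolding smooth_on_def by (drule spec[of _ "Suc 0"]) simp

lemma smooth_on_continuous_on: "smooth_on U f \<Longrightarrow> continuous_on U f"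
  unfolding smooth_on_def by (drule spec[of _ 0]) simp

lemma smooth_on_frechet_derivative:
  assumes "smooth_on U f" shows "smooth_on U (\<lambda>x. frechet_derivative f (at x) v)"
  unfolding smooth_on_def
proof
  show "C_on n U (\<lambda>x. frechet_derivative f (at x) v)" for n
    using assms[unfolded smooth_on_def, rule_format, of "Suc n"] by simp
qed

section \<open>Inverse functions and lifts of curves\<close>

lemma coordinates_norm_le:
  assumes "coordinates B cf" "linear L"
  shows "norm (L u) \<le> (\<Sum>b\<in>B. norm (cf b) * norm (L b)) * norm u"
proof -
  have "norm (L u) \<le> (\<Sum>b\<in>B. norm (blinfun_apply (cf b) u *\<^sub>R L b))"
    unfolding linear_coordinates[OF assms, of u] by (rule norm_sum)
  also have "\<dots> \<le> (\<Sum>b\<in>B. norm (cf b) * norm (L b) * norm u)"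
  proof (rule sum_mono)
    fix b
    have "norm (blinfun_apply (cf b) u) * norm (L b) \<le> (norm (cf b) * norm u) * norm (L b)"
      by (intro mult_right_mono norm_blinfun norm_ge_zero)
    then show "norm (blinfun_apply (cf b) u *\<^sub>R L b) \<le> norm (cf b) * norm (L b) * norm u"
      by (simp add: mult_ac)
  qed
  finally show ?thesis
    by (simp add: sum_distrib_right)
qed

text \<open>A substitute for continuity in operator norm: continuity at the finitely many coordinate
  vectors bounds the deviation uniformly in \<open>u\<close>.\<close>

lemma linear_family_norm_le:
  fixes A :: "'a::real_normed_vector \<Rightarrow> 'b::real_normed_vector \<Rightarrow> 'c::real_normed_vector"
  assumes "findim TYPE('b)" "open U" "\<And>x. x \<in> U \<Longrightarrow> linear (A x)" "\<And>b. smooth_on U (\<lambda>x. A x b)" "x0 \<in> U"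
  shows "\<exists>\<epsilon>. (\<epsilon> \<longlongrightarrow> 0) (nhds x0) \<and> (\<forall>x. 0 \<le> \<epsilon> x) \<and>
    (\<forall>x\<in>U. \<forall>u. norm (A x u - A x0 u) \<le> \<epsilon> x * norm u)"
proof -
  obtain B and cf :: "'b \<Rightarrow> 'b \<Rightarrow>\<^sub>L real" where B: "coordinates B cf"
    using assms(1) by (rule findimE)
  define \<epsilon> where "\<epsilon> x = (\<Sum>b\<in>B. norm (cf b) * norm (A x b - A x0 b))" for x
  have "isCont (\<lambda>x. A x b) x0" for b
    using smooth_on_continuous_on[OF assms(4)] assms(2,5) continuous_on_eq_continuous_at by blast
  then have "isCont \<epsilon> x0"
    unfolding \<epsilon>_def by (intro continuous_intros)
  then have "(\<epsilon> \<longlongrightarrow> \<epsilon> x0) (nhds x0)"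
    by (simp add: isCont_def tendsto_at_iff_tendsto_nhds)
  then have "(\<epsilon> \<longlongrightarrow> 0) (nhds x0)"
    by (simp add: \<epsilon>_def)
  moreover have "0 \<le> \<epsilon> x" for x
    by (simp add: \<epsilon>_def sum_nonneg)
  moreover have "norm (A x u - A x0 u) \<le> \<epsilon> x * norm u" if "x \<in> U" for x u
    using coordinates_norm_le[OF B linear_compose_sub[OF assms(3)[OF that] assms(3)[OF assms(5)]]]
    by (simp add: \<epsilon>_def)
  ultimately show ?thesis
    by blast
qed

text \<open>For \<open>u = R x w\<close>, applying \<open>R x0\<close> to
  \<open>A x u - A x0 u\<close> gives \<open>R x0 w - u\<close>. Once
  \<open>K * \<epsilon> x < 1 / 2\<close>, this bounds \<open>u\<close> by
  \<open>2 * norm (R x0 w)\<close>, and then the difference itself. Joint continuity in both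
  arguments is what the inverse rule for derivatives will ask for.\<close>

lemma inverse_family_tendsto:
  fixes A :: "'a::real_normed_vector \<Rightarrow> 'b::real_normed_vector \<Rightarrow> 'b" and R :: "'a \<Rightarrow> 'b \<Rightarrow> 'b"
  assumes "findim TYPE('b)" "open U" and lin: "\<And>x. x \<in> U \<Longrightarrow> linear (A x)"
    and sm: "\<And>b. smooth_on U (\<lambda>x. A x b)"
    and linR: "\<And>x. x \<in> U \<Longrightarrow> linear (R x)"
    and inv: "\<And>x b. x \<in> U \<Longrightarrow> A x (R x b) = b" "\<And>x b. x \<in> U \<Longrightarrow> R x (A x b) = b"
    and x0: "x0 \<in> U"
  shows "((\<lambda>p. R (fst p) (snd p)) \<longlongrightarrow> R x0 w0) (nhds (x0, w0))"
proof -
  obtain \<epsilon> where \<epsilon>: "(\<epsilon> \<longlongrightarrow> 0) (nhds x0)" "\<And>x. 0 \<le> \<epsilon> x"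
    "\<And>x u. x \<in> U \<Longrightarrow> norm (A x u - A x0 u) \<le> \<epsilon> x * norm u"
    using linear_family_norm_le[of U A, OF assms(1,2) lin sm x0] by blast
  have bl: "bounded_linear (R x0)"
    using findim_linear_bounded assms(1) linR x0 by blast
  then obtain K where K: "K > 0" "\<And>u. norm (R x0 u) \<le> norm u * K"
    using bounded_linear.pos_bounded by blast
  have fst_lim: "filterlim fst (nhds x0) (nhds (x0, w0))"
    using tendsto_fst[OF filterlim_ident, of "(x0, w0)"] by simp
  have "((\<lambda>x. K * \<epsilon> x) \<longlongrightarrow> 0) (nhds x0)"
    using tendsto_mult_right_zero[OF \<epsilon>(1)] by simp
  then have ev1: "eventually (\<lambda>x. K * \<epsilon> x < 1 / 2) (nhds x0)"
    by (rule order_tendstoD) simp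
  have ev2: "eventually (\<lambda>x. x \<in> U) (nhds x0)"
    using assms(2) x0 by (rule eventually_nhds_in_open)
  have ev: "eventually (\<lambda>p. norm (R (fst p) (snd p) - R x0 (snd p))
      \<le> K * \<epsilon> (fst p) * (2 * norm (R x0 (snd p)))) (nhds (x0, w0))"
    using filterlim_iff[THEN iffD1, OF fst_lim, rule_format, OF eventually_conj[OF ev1 ev2]]
  proof eventually_elim
    case (elim p)
    let ?x = "fst p" and ?w = "snd p"
    let ?u = "R ?x ?w"
    have x: "?x \<in> U" and h: "K * \<epsilon> ?x < 1 / 2"
      using elim by auto
    have "R x0 (A ?x ?u - A x0 ?u) = R x0 ?w - ?u"
      using linR[OF x0] x x0 by (simp add: linear_diff inv)
    then have le: "norm (?u - R x0 ?w) \<le> K * \<epsilon> ?x * norm ?u"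
      using order_trans[OF K(2)[of "A ?x ?u - A x0 ?u"] mult_right_mono[OF \<epsilon>(3)[OF x, of ?u], of K]] K(1)
      by (simp add: norm_minus_commute mult_ac)
    have "norm ?u \<le> norm (?u - R x0 ?w) + norm (R x0 ?w)"
      by (metis norm_triangle_sub add.commute)
    also have "\<dots> \<le> 1 / 2 * norm ?u + norm (R x0 ?w)"
      using le mult_right_mono[OF less_imp_le[OF h] norm_ge_zero[of ?u]] by simp
    finally have "norm ?u \<le> 2 * norm (R x0 ?w)"
      by simp
    then show ?case
      using le K(1) \<epsilon>(2)[of ?x] by (meson mult_left_mono mult_nonneg_nonneg order_trans less_imp_le)
  qed
  have Rlim: "((\<lambda>p. R x0 (snd p)) \<longlongrightarrow> R x0 w0) (nhds (x0, w0))"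
    using bounded_linear.tendsto[OF bl tendsto_snd[OF filterlim_ident, of "(x0, w0)"]] by simp
  have "((\<lambda>p. K * \<epsilon> (fst p) * (2 * norm (R x0 (snd p)))) \<longlongrightarrow> K * 0 * (2 * norm (R x0 w0))) (nhds (x0, w0))"
    by (intro tendsto_intros Rlim filterlim_compose[OF \<epsilon>(1) fst_lim])
  then have "((\<lambda>p. R (fst p) (snd p) - R x0 (snd p)) \<longlongrightarrow> 0) (nhds (x0, w0))"
    using Lim_null_comparison[OF ev] by simp
  from tendsto_add[OF this Rlim] show ?thesis
    by simp
qed

text \<open>The formula D(A^-1) w = - A^-1 (DA) A^-1 w. It comes from differentiating the inverse of
  the map from \<open>(x, u)\<close> to \<open>(x, A x u)\<close> and then freezing the second
  argument.\<close>

lemma inverse_family_has_derivative: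
  fixes A :: "'a::real_normed_vector \<Rightarrow> 'b::real_normed_vector \<Rightarrow> 'b" and R :: "'a \<Rightarrow> 'b \<Rightarrow> 'b"
  assumes fin: "findim TYPE('b)" and B: "coordinates (B :: 'b set) cf" and "open U" and lin: "\<And>x. x \<in> U \<Longrightarrow> linear (A x)"
    and sm: "\<And>b. smooth_on U (\<lambda>x. A x b)"
    and linR: "\<And>x. x \<in> U \<Longrightarrow> linear (R x)"
    and inv: "\<And>x b. x \<in> U \<Longrightarrow> A x (R x b) = b" "\<And>x b. x \<in> U \<Longrightarrow> R x (A x b) = b"
    and x0: "x0 \<in> U"
  shows "((\<lambda>x. R x w) has_derivative (\<lambda>v. - R x0 (\<Sum>b\<in>B. blinfun_apply (cf b) (R x0 w) *\<^sub>R
     frechet_derivative (\<lambda>x. A x b) (at x0) v))) (at x0)"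
proof -
  define Q where "Q u v = (\<Sum>b\<in>B. blinfun_apply (cf b) u *\<^sub>R frechet_derivative (\<lambda>x. A x b) (at x0) v)" for u v
  have bl: "bounded_linear (R x0)"
    using findim_linear_bounded fin linR x0 by blast
  have dA: "((\<lambda>x. A x b) has_derivative frechet_derivative (\<lambda>x. A x b) (at x0)) (at x0)" for b
    using smooth_on_differentiable[OF sm x0] by (rule has_frechet_derivative)
  have blQ: "bounded_linear (Q u)" for u
    unfolding Q_def using dA[THEN has_derivative_bounded_linear]
    by (intro bounded_linear_sum bounded_linear_const_scaleR)
  \<comment> \<open>Written through coordinates, \<open>G\<close> is differentiable by the sum and
    product rules; over \<open>U\<close> it is the map from \<open>(x, u)\<close> to
    \<open>(x, A x u)\<close>.\<close>
  define G where "G p = (fst p, \<Sum>b\<in>B. blinfun_apply (cf b) (snd p) *\<^sub>R A (fst p) b)" for p :: "'a \<times> 'b"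
  have G: "G (x, u) = (x, A x u)" if "x \<in> U" for x u
    by (simp add: G_def linear_coordinates[OF B lin[OF that], symmetric])
  let ?u = "R x0 w"
  have dG: "(G has_derivative (\<lambda>q. (fst q, Q ?u (fst q) + A x0 (snd q)))) (at (x0, ?u))"
  proof -
    have dA': "((\<lambda>p. A (fst p) b) has_derivative (\<lambda>q. frechet_derivative (\<lambda>x. A x b) (at x0) (fst q))) (at (x0, ?u))" for b
      by (rule has_derivative_compose[OF has_derivative_fst[OF has_derivative_ident]]) (simp add: dA)
    have dc: "((\<lambda>p. blinfun_apply (cf b) (snd p)) has_derivative (\<lambda>q. blinfun_apply (cf b) (snd q))) (at (x0, ?u))" for b
      by (rule bounded_linear.has_derivative[OF blinfun.bounded_linear_right has_derivative_snd[OF has_derivative_ident]])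
    have "(G has_derivative (\<lambda>q. (fst q, \<Sum>b\<in>B. blinfun_apply (cf b) (snd (x0, ?u)) *\<^sub>R frechet_derivative (\<lambda>x. A x b) (at x0) (fst q)
        + blinfun_apply (cf b) (snd q) *\<^sub>R A (fst (x0, ?u)) b))) (at (x0, ?u))"
      unfolding G_def
      by (rule has_derivative_Pair[OF has_derivative_fst[OF has_derivative_ident]
          has_derivative_sum[OF has_derivative_scaleR[OF dc dA']]])
    then show ?thesis
      by (simp add: Q_def sum.distrib linear_coordinates[OF B lin[OF x0], symmetric])
  qed
  have "((\<lambda>p. (fst p, R (fst p) (snd p))) has_derivative (\<lambda>q. (fst q, R x0 (snd q - Q ?u (fst q))))) (at (x0, w))"
  proof (rule has_derivative_inverse_basic[of G _ _ _ _ "U \<times> UNIV"])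
    show "(G has_derivative (\<lambda>q. (fst q, Q ?u (fst q) + A x0 (snd q)))) (at (fst (x0, w), R (fst (x0, w)) (snd (x0, w))))"
      using dG by simp
    show "bounded_linear (\<lambda>q. (fst q, R x0 (snd q - Q ?u (fst q))))"
      by (intro bounded_linear_Pair bounded_linear_fst bounded_linear_compose[OF bl]
          bounded_linear_sub bounded_linear_snd bounded_linear_compose[OF blQ bounded_linear_fst])
    show "(\<lambda>q. (fst q, R x0 (snd q - Q ?u (fst q)))) \<circ> (\<lambda>q. (fst q, Q ?u (fst q) + A x0 (snd q))) = id"
      using inv x0 by (auto simp: fun_eq_iff)
    have "((\<lambda>p. (fst p, R (fst p) (snd p))) \<longlongrightarrow> (x0, R x0 w)) (nhds (x0, w))"
      using tendsto_Pair[OF tendsto_fst[OF filterlim_ident, of "(x0, w)"]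
          inverse_family_tendsto[OF fin assms(3) lin sm linR inv x0]] by simp
    then show "continuous (at (x0, w)) (\<lambda>p. (fst p, R (fst p) (snd p)))"
      using tendsto_at_iff_tendsto_nhds[of "\<lambda>p. (fst p, R (fst p) (snd p))" "(x0, w)"]
      by (simp add: continuous_at)
    show "open (U \<times> UNIV)"
      using assms(3) by (simp add: open_Times)
    show "G (fst z, R (fst z) (snd z)) = z" if "z \<in> U \<times> UNIV" for z
      using that G inv by auto
  qed (use x0 in auto)
  then have "((\<lambda>p. R (fst p) (snd p)) has_derivative (\<lambda>q. R x0 (snd q - Q ?u (fst q)))) (at (x0, w))"
    by (auto dest: has_derivative_snd)
  from has_derivative_compose[of "\<lambda>x. (x, w)" "\<lambda>v. (v, 0)" x0 UNIV, OF _ this]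
  have "((\<lambda>x. R x w) has_derivative (\<lambda>v. R x0 (0 - Q ?u v))) (at x0)"
    by (simp add: has_derivative_Pair)
  then show ?thesis
    using linear_neg[OF linR[OF x0]] by (simp add: Q_def)
qed

text \<open>Bootstrapping: the derivative of \<open>R\<close> is expressed by \<open>R\<close>
  itself and derivatives of \<open>A\<close>, so class n passes to class n + 1. The vector
  \<open>w\<close> varies in the induction because \<open>R\<close> is also applied to a moving
  vector.\<close>

lemma smooth_on_inverse_family:
  fixes A :: "'a::real_normed_vector \<Rightarrow> 'b::real_normed_vector \<Rightarrow> 'b" and R :: "'a \<Rightarrow> 'b \<Rightarrow> 'b"
  assumes fin: "findim TYPE('b)" and U: "open U" and lin: "\<And>x. x \<in> U \<Longrightarrow> linear (A x)"
    and sm: "\<And>b. smooth_on U (\<lambda>x. A x b)"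
    and linR: "\<And>x. x \<in> U \<Longrightarrow> linear (R x)"
    and inv: "\<And>x b. x \<in> U \<Longrightarrow> A x (R x b) = b" "\<And>x b. x \<in> U \<Longrightarrow> R x (A x b) = b"
  shows "smooth_on U (\<lambda>x. R x w)"
proof -
  obtain B and cf :: "'b \<Rightarrow> 'b \<Rightarrow>\<^sub>L real" where B: "coordinates B cf"
    using fin by (rule findimE)
  have d: "((\<lambda>x. R x w) has_derivative (\<lambda>v. - R x0 (\<Sum>b\<in>B. blinfun_apply (cf b) (R x0 w) *\<^sub>R
     frechet_derivative (\<lambda>x. A x b) (at x0) v))) (at x0)" if "x0 \<in> U" for x0 w
    by (rule inverse_family_has_derivative[OF fin B U lin sm linR inv that])
  have "C_on n U (\<lambda>x. R x w)" for n w
  proof (induction n arbitrary: w)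
    case 0
    have "isCont (\<lambda>x. R x w) x" if "x \<in> U" for x
      using d[OF that] has_derivative_continuous by blast
    then show ?case
      by (simp add: continuous_at_imp_continuous_on)
  next
    case (Suc n)
    let ?q = "\<lambda>v x. \<Sum>b\<in>B. blinfun_apply (cf b) (R x w) *\<^sub>R frechet_derivative (\<lambda>x. A x b) (at x) v"
    have "C_on n U (\<lambda>x. frechet_derivative (\<lambda>x. A x b) (at x) v)" for b v
      using smooth_on_frechet_derivative[OF sm] by (simp add: smooth_on_def)
    then have "C_on n U (?q v)" for v
      using B by (intro C_on_sum U C_on_bilinear[OF bounded_bilinear_scaleR]
          C_on_bounded_linear_compose[OF blinfun.bounded_linear_right] Suc.IH) (auto simp: coordinates_def)
    then have "C_on n U (\<lambda>x. R x (?q v x))" for v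
      by (intro C_on_linear_family[OF fin U linR Suc.IH])
    then have "C_on n U (\<lambda>x. - R x (?q v x))" for v
      by (rule C_on_bounded_linear_compose[OF bounded_linear_minus[OF bounded_linear_ident] U])
    then have "C_on n U (\<lambda>x. frechet_derivative (\<lambda>x. R x w) (at x) v)" for v
      using C_on_cong[OF U, of "\<lambda>x. frechet_derivative (\<lambda>x. R x w) (at x) v"  "\<lambda>x. - R x (?q v x)"]
        frechet_derivative_eqI[OF d] by simp
    then show ?case
      using d by (auto simp: differentiable_def)
  qed
  then show ?thesis
    by (simp add: smooth_on_def)
qed

section \<open>Inverse function theorem by contraction\<close>

text \<open>Solutions are the fixed points of the map sending \<open>x\<close> to
  \<open>x - f x + y\<close>, a contraction with constant 1/2 of the closed ball. The strict bound
  on \<open>y\<close> puts the fixed point into the open ball.\<close>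

lemma near_identity_solve:
  fixes f :: "'a::banach \<Rightarrow> 'a"
  assumes le: "\<And>x x'. x \<in> cball x0 r \<Longrightarrow> x' \<in> cball x0 r \<Longrightarrow>
      norm ((x - f x) - (x' - f x')) \<le> 1 / 2 * norm (x - x')"
    and y: "norm (y - f x0) < r / 2"
  shows "\<exists>x\<in>ball x0 r. f x = y"
proof -
  let ?S = "cball x0 r"
  have r0: "r > 0"
    using y norm_ge_zero[of "y - f x0"] by linarith
  then have x0: "x0 \<in> ?S"
    by simp
  have "\<exists>!x\<in>?S. x - f x + y = x"
  proof (rule Banach_fix[where c = "1 / 2"])
    show "(\<lambda>x. x - f x + y) ` ?S \<subseteq> ?S"
    proof clarify
      fix x assume x: "x \<in> ?S"
      have "norm ((x - f x) - (x0 - f x0)) \<le> 1 / 2 * r"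
        using le[OF x x0] x by (auto simp: dist_norm norm_minus_commute)
      then have "norm ((x - f x + y) - x0) \<le> 1 / 2 * r + r / 2"
        using norm_triangle_ineq[of "(x - f x) - (x0 - f x0)" "y - f x0"] y
        by (simp add: algebra_simps)
      then show "x - f x + y \<in> ?S"
        by (auto simp: dist_norm norm_minus_commute)
    qed
    show "dist (x - f x + y) (z - f z + y) \<le> 1 / 2 * dist x z" if "x \<in> ?S" "z \<in> ?S" for x z
      using le[OF that] by (simp add: dist_norm)
  qed (use r0 in \<open>auto simp: complete_eq_closed\<close>)
  then obtain x where x: "x \<in> ?S" "f x = y"
    by auto
  have "norm (x - x0) \<le> norm ((x - f x) - (x0 - f x0)) + norm (y - f x0)"
    using norm_triangle_ineq[of "(x - f x) - (x0 - f x0)" "y - f x0"] x by simp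
  also have "\<dots> < 1 / 2 * norm (x - x0) + r / 2"
    using le[OF x(1) x0] y by linarith
  finally show ?thesis
    using x by (auto simp: dist_norm norm_minus_commute)
qed

text \<open>The same contraction, now on the whole space, gives surjectivity; a kernel vector has at
  most half of its own norm.\<close>

lemma linear_near_identity_bij:
  fixes P :: "'a::banach \<Rightarrow> 'a"
  assumes "linear P" and le: "\<And>u. norm (P u - u) \<le> 1 / 2 * norm u"
  shows "bij P"
proof (rule bijI)
  have "u = 0" if "P u = 0" for u
    using le[of u] that by simp
  then show "inj P"
    using assms(1) by (simp add: linear_injective_0)
  show "surj P"
  proof (rule surjI)
    fix w
    have "\<exists>!x\<in>UNIV. x - P x + w = x"
    proof (rule Banach_fix[where c = "1 / 2"])
      show "dist (x - P x + w) (z - P z + w) \<le> 1 / 2 * dist x z" for x z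
        using le[of "z - x"] by (simp add: dist_norm linear_diff[OF assms(1)] algebra_simps norm_minus_commute)
    qed (auto simp: complete_UNIV)
    then have "\<exists>x. P x = w"
      by auto
    then show "P (SOME x. P x = w) = w"
      by (rule someI_ex)
  qed
qed

lemma linear_inv_bij:
  assumes "linear P" "bij P"
  shows "linear (inv P)"
proof (rule linearI)
  note s = surj_f_inv_f[OF bij_is_surj[OF assms(2)]] and i = bij_is_inj[OF assms(2)]
  show "inv P (a + b) = inv P a + inv P b" for a b
    by (rule injD[OF i]) (simp add: s linear_add[OF assms(1)])
  show "inv P (c *\<^sub>R b) = c *\<^sub>R inv P b" for c b
    by (rule injD[OF i]) (simp add: s linear_scale[OF assms(1)])
qed

text \<open>The derivative at \<open>x0\<close> is normalised to the identity, so the identity minus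
  \<open>f\<close> is a contraction on a small ball and \<open>near_identity_solve\<close> provides
  the inverse.\<close>

lemma smooth_local_inverse:
  fixes f :: "'a::banach \<Rightarrow> 'a"
  assumes fin: "findim TYPE('a)" and U: "open U" "x0 \<in> U" and sm: "smooth_on U f"
    and id: "\<And>v. frechet_derivative f (at x0) v = v"
  obtains V g where "open V" "f x0 \<in> V" "smooth_on V g" "g (f x0) = x0" "g ` V \<subseteq> U"
    "\<And>y. y \<in> V \<Longrightarrow> f (g y) = y"
proof -
  let ?D = "\<lambda>x. frechet_derivative f (at x)"
  have der: "(f has_derivative ?D x) (at x)" if "x \<in> U" for x
    using smooth_on_differentiable[OF sm that] by (rule has_frechet_derivative)
  have lin: "linear (?D x)" if "x \<in> U" for x
    using has_derivative_linear[OF der[OF that]] .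
  obtain \<epsilon> where \<epsilon>: "(\<epsilon> \<longlongrightarrow> 0) (nhds x0)" "\<And>x. 0 \<le> \<epsilon> x"
    "\<And>x u. x \<in> U \<Longrightarrow> norm (?D x u - ?D x0 u) \<le> \<epsilon> x * norm u"
    using linear_family_norm_le[of U ?D, OF fin U(1) lin smooth_on_frechet_derivative[OF sm] U(2)] by blast
  have "eventually (\<lambda>x. x \<in> U \<and> \<epsilon> x < 1 / 2) (nhds x0)"
    using \<epsilon>(1) by (intro eventually_conj eventually_nhds_in_open U order_tendstoD) auto
  \<comment> \<open>On this closed ball the derivative stays within 1/2 of the identity, which
    serves both the contraction estimate and the invertibility of each derivative.\<close>
  then obtain r where r: "r > 0" "\<And>x. dist x x0 \<le> r \<Longrightarrow> x \<in> U \<and> \<epsilon> x < 1 / 2"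
    by (auto simp: eventually_nhds_metric_le)
  have near: "norm (?D x u - u) \<le> 1 / 2 * norm u" if "x \<in> cball x0 r" for x u
  proof -
    have x: "x \<in> U" "\<epsilon> x < 1 / 2"
      using r(2)[of x] that by (auto simp: dist_commute)
    have "norm (?D x u - u) \<le> \<epsilon> x * norm u"
      using \<epsilon>(3)[OF x(1), of u] id by simp
    also have "\<dots> \<le> 1 / 2 * norm u"
      using x(2) by (intro mult_right_mono) auto
    finally show ?thesis .
  qed
  have sub: "cball x0 r \<subseteq> U"
    using r(2) by (auto simp: dist_commute)
  have contr: "norm ((x - f x) - (x' - f x')) \<le> 1 / 2 * norm (x - x')"
    if "x \<in> cball x0 r" "x' \<in> cball x0 r" for x x'
  proof (rule differentiable_bound[where f = "\<lambda>x. x - f x" and f' = "\<lambda>x u. u - ?D x u" and S = "cball x0 r"])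
    show "((\<lambda>x. x - f x) has_derivative (\<lambda>u. u - ?D x u)) (at x within cball x0 r)" if "x \<in> cball x0 r" for x
      using has_derivative_at_withinI[OF has_derivative_diff[OF has_derivative_ident der]] that sub by blast
    show "onorm (\<lambda>u. u - ?D x u) \<le> 1 / 2" if "x \<in> cball x0 r" for x
      using near[OF that] by (intro onorm_bound) (auto simp: norm_minus_commute)
  qed (use that in auto)
  define V where "V = ball (f x0) (r / 2)"
  have "\<exists>x\<in>ball x0 r. f x = y" if "y \<in> V" for y
    using that contr by (intro near_identity_solve) (auto simp: V_def dist_norm norm_minus_commute)
  then obtain g where g: "\<And>y. y \<in> V \<Longrightarrow> g y \<in> ball x0 r" "\<And>y. y \<in> V \<Longrightarrow> f (g y) = y"
    by metis
  \<comment> \<open>Half of \<open>norm (x - x')\<close> is absorbed on the left, whence the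
    Lipschitz constant 2 of the inverse.\<close>
  have lip: "norm (x - x') \<le> 2 * norm (f x - f x')" if "x \<in> cball x0 r" "x' \<in> cball x0 r" for x x'
    using contr[OF that] norm_triangle_ineq[of "(x - f x) - (x' - f x')" "f x - f x'"] by simp
  have gl: "dist (g y) (g z) \<le> 2 * dist y z" if "y \<in> V" "z \<in> V" for y z
    using lip[of "g y" "g z"] g that by (auto simp: dist_norm less_imp_le)
  have openV: "open V" "f x0 \<in> V"
    using r(1) by (auto simp: V_def)
  have gx0: "g (f x0) = x0"
  proof -
    have "norm (g (f x0) - x0) \<le> 0"
      using lip[of "g (f x0)" x0] g[OF openV(2)] r(1) by (auto simp: less_imp_le)
    then show ?thesis by simp
  qed
  have contg: "continuous (at y) g" if "y \<in> V" for y
  proof -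
    have "2-lipschitz_on V g"
      using gl by (auto simp: lipschitz_on_def)
    then show ?thesis
      using lipschitz_on_continuous_on openV that continuous_on_eq_continuous_at by blast
  qed
  have bij: "bij (?D x)" if "x \<in> ball x0 r" for x
  proof (rule linear_near_identity_bij)
    have "x \<in> cball x0 r"
      using that by auto
    then show "linear (?D x)" "\<And>u. norm (?D x u - u) \<le> 1 / 2 * norm u"
      using lin sub near by blast+
  qed
  have bU: "ball x0 r \<subseteq> U"
    using sub by force
  define R where "R x = inv (?D x)" for x
  have linR: "linear (R x)" if "x \<in> ball x0 r" for x
    unfolding R_def using that bU by (intro linear_inv_bij lin bij) auto
  have R1: "?D x (R x w) = w" "R x (?D x w) = w" if "x \<in> ball x0 r" for x w
    using bij[OF that] by (auto simp: R_def bij_is_surj surj_f_inv_f bij_is_inj)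
  have smR: "smooth_on (ball x0 r) (\<lambda>x. R x w)" for w
  proof (rule smooth_on_inverse_family[OF fin open_ball])
    show "linear (?D x)" if "x \<in> ball x0 r" for x
      using that bU lin by auto
    show "smooth_on (ball x0 r) (\<lambda>x. ?D x b)" for b
      by (rule smooth_on_subset[OF smooth_on_frechet_derivative[OF sm] bU])
  qed (simp_all add: linR R1)
  have derg: "(g has_derivative R (g y)) (at y)" if "y \<in> V" for y
  proof (rule has_derivative_inverse_basic[where f = f and f' = "?D (g y)" and T = V])
    show "(f has_derivative ?D (g y)) (at (g y))"
      using g(1)[OF that] bU by (intro der) auto
    show "bounded_linear (R (g y))"
      using findim_linear_bounded[OF fin linR[OF g(1)[OF that]]] .
    show "R (g y) \<circ> ?D (g y) = id"
      using R1(2)[OF g(1)[OF that]] by (auto simp: fun_eq_iff)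
  qed (use contg that openV g in auto)
  \<comment> \<open>The derivative of \<open>g\<close> at \<open>y\<close> is
    \<open>R (g y)\<close>, so class n of \<open>g\<close> gives class n of its derivative.\<close>
  have "C_on n V g" for n
  proof (induction n)
    case 0
    show ?case
      using contg by (simp add: continuous_at_imp_continuous_on)
  next
    case (Suc n)
    have "C_on n V (\<lambda>y. R (g y) w)" for w
      using g(1) smR[of w] by (intro C_on_compose[OF fin openV(1) _ Suc, of "ball x0 r"]) (auto simp: smooth_on_def)
    then have "C_on n V (\<lambda>y. frechet_derivative g (at y) w)" for w
      using C_on_cong[OF openV(1), of "\<lambda>y. frechet_derivative g (at y) w" "\<lambda>y. R (g y) w"]
        frechet_derivative_eqI[OF derg] by simp
    then show ?case
      using derg by (auto simp: differentiable_def)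
  qed
  then have "smooth_on V g"
    by (simp add: smooth_on_def)
  moreover have "g ` V \<subseteq> U"
    using g(1) bU by auto
  ultimately show thesis
    using that openV gx0 g(2) by blast
qed

section \<open>Lifting curves through submersions\<close>

text \<open>The inverse function theorem is applied to \<open>\<Psi>\<close> on the product of the
  time line and the target; its inverse at \<open>(\<tau>, 0)\<close> solves the lifting equation at
  time \<open>\<tau>\<close>. The ansatz \<open>c\<close> already moves with velocity
  \<open>v\<close>, so the lift starts with exactly that velocity.\<close>

lemma lift_curve_coordinates:
  fixes f :: "'e::banach \<Rightarrow> 'f::banach" and \<delta> :: "real \<Rightarrow> 'f"
  assumes fin: "findim TYPE('e)" "findim TYPE('f)"
    and U: "open U" "x0 \<in> U" "smooth_on U f"
    and I: "open I" "0 \<in> I" "smooth_on I \<delta>" "\<delta> 0 = f x0"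
    and surj: "surj (frechet_derivative f (at x0))"
    and v: "frechet_derivative f (at x0) v = frechet_derivative \<delta> (at 0) 1"
  obtains J \<gamma> where "open J" "0 \<in> J" "J \<subseteq> I" "smooth_on J \<gamma>" "\<gamma> 0 = x0" "\<gamma> ` J \<subseteq> U"
    "\<And>\<tau>. \<tau> \<in> J \<Longrightarrow> f (\<gamma> \<tau>) = \<delta> \<tau>" "frechet_derivative \<gamma> (at 0) 1 = v"
proof -
  let ?D = "frechet_derivative f (at x0)"
  have derf: "(f has_derivative ?D) (at x0)"
    using smooth_on_differentiable[OF U(3,2)] by (rule has_frechet_derivative)
  have lin: "linear ?D"
    using has_derivative_linear[OF derf] .
  have der\<delta>: "(\<delta> has_derivative frechet_derivative \<delta> (at 0)) (at 0)"
    using smooth_on_differentiable[OF I(3,2)] by (rule has_frechet_derivative)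
  obtain K where K: "linear K" "?D \<circ> K = id"
    using linear_surjective_right_inverse[OF lin surj] by blast
  have DK: "?D (K z) = z" for z
    using fun_cong[OF K(2), of z] by simp
  have blK: "bounded_linear K"
    using findim_linear_bounded[OF fin(2) K(1)] .
  have finp: "findim TYPE(real \<times> 'f)"
    by (intro findim_prod findim_real fin)
  \<comment> \<open>Time moves along \<open>v\<close>; the second variable moves through the image
    of the right inverse \<open>K\<close>, a complement of the kernel, and will correct the
    error.\<close>
  define c where "c p = x0 + (fst p *\<^sub>R v + K (snd p))" for p :: "real \<times> 'f"
  define c' where "c' p = fst p *\<^sub>R v + K (snd p)" for p :: "real \<times> 'f"
  have blc: "bounded_linear c'"
    unfolding c'_def by (intro bounded_linear_add bounded_linear_scaleR_left[THEN bounded_linear_compose]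
        bounded_linear_fst bounded_linear_compose[OF blK bounded_linear_snd])
  have c_eq: "c p = x0 + c' p" for p
    by (simp add: c_def c'_def)
  have contc: "continuous_on UNIV c"
    unfolding c_eq by (intro continuous_on_add continuous_on_const linear_continuous_on blc)
  define W where "W = fst -` I \<inter> c -` U"
  have W: "open W"
    unfolding W_def using I(1) U(1) contc by (intro open_Int open_vimage continuous_on_fst continuous_on_id) auto
  \<comment> \<open>At the origin the assumption on \<open>v\<close> cancels the time derivative of
    the second component and \<open>K\<close> makes its other partial derivative the identity, so
    the whole derivative is the identity, as \<open>smooth_local_inverse\<close> requires.\<close>
  define \<Psi> where "\<Psi> p = (fst p, f (c p) - \<delta> (fst p))" for p
  have c0: "c (0, 0) = x0"
    using linear_0[OF K(1)] by (simp add: c_def)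
  have W0: "(0, 0) \<in> W"
    using I(2) U(2) by (simp add: W_def c0)
  have smc: "smooth_on W c"
    unfolding c_eq by (intro smooth_on_add W smooth_on_const smooth_on_bounded_linear blc)
  have sm\<Psi>: "smooth_on W \<Psi>"
    unfolding \<Psi>_def
    by (intro smooth_on_Pair smooth_on_diff W smooth_on_bounded_linear bounded_linear_fst
        smooth_on_compose[OF fin(1) W U(3) smc] smooth_on_compose[OF findim_real W I(3)])
      (auto simp: W_def)
  have "(c has_derivative c') (at (0, 0))"
    unfolding c_eq
    using has_derivative_add[OF has_derivative_const bounded_linear_imp_has_derivative[OF blc], of x0 "at (0, 0)"] by simp
  from has_derivative_compose[OF this, of f ?D] derf
  have dfc: "((\<lambda>p. f (c p)) has_derivative (\<lambda>q. ?D (c' q))) (at (0, 0))"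
    by (simp add: c0)
  have d\<delta>: "((\<lambda>p. \<delta> (fst p)) has_derivative (\<lambda>q. frechet_derivative \<delta> (at 0) (fst q))) (at (0::real, 0::'f))"
    by (rule has_derivative_compose[OF has_derivative_fst[OF has_derivative_ident]]) (simp add: der\<delta>)
  have lin\<delta>: "frechet_derivative \<delta> (at 0) t = t *\<^sub>R ?D v" for t
    using linear_scale[OF has_derivative_linear[OF der\<delta>], of t 1] v by simp
  have "(\<Psi> has_derivative (\<lambda>q. (fst q, ?D (c' q) - frechet_derivative \<delta> (at 0) (fst q)))) (at (0, 0))"
    unfolding \<Psi>_def
    by (rule has_derivative_Pair[OF has_derivative_fst[OF has_derivative_ident] has_derivative_diff[OF dfc d\<delta>]])
  moreover have "?D (c' q) - frechet_derivative \<delta> (at 0) (fst q) = snd q" for q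
    by (simp add: c'_def linear_add[OF lin] linear_scale[OF lin] DK lin\<delta>)
  ultimately have d\<Psi>: "(\<Psi> has_derivative (\<lambda>q. q)) (at (0, 0))"
    by simp
  have \<Psi>0: "\<Psi> (0, 0) = (0, 0)"
    using I(4) by (simp add: \<Psi>_def c0)
  obtain V g where V: "open V" "(0, 0) \<in> V" "smooth_on V g" "g (0, 0) = (0, 0)" "g ` V \<subseteq> W"
    "\<And>y. y \<in> V \<Longrightarrow> \<Psi> (g y) = y"
    using smooth_local_inverse[OF finp W W0 sm\<Psi>] frechet_derivative_eqI[OF d\<Psi>] \<Psi>0 by metis
  define \<gamma> where "\<gamma> \<tau> = c (g (\<tau>, 0))" for \<tau>
  define J where "J = (\<lambda>\<tau>. (\<tau>, 0::'f)) -` V"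
  have J: "open J" "0 \<in> J"
    unfolding J_def using V(1,2) by (auto intro!: open_vimage continuous_intros)
  have g: "g (\<tau>, 0) \<in> W" "\<Psi> (g (\<tau>, 0)) = (\<tau>, 0)" if "\<tau> \<in> J" for \<tau>
    using that V(5,6) by (auto simp: J_def)
  have smg: "smooth_on J (\<lambda>\<tau>. g (\<tau>, 0))"
    by (rule smooth_on_compose[OF finp J(1) V(3)])
      (auto simp: J_def intro!: smooth_on_bounded_linear bounded_linear_Pair bounded_linear_ident bounded_linear_zero)
  have sm\<gamma>: "smooth_on J \<gamma>"
    unfolding \<gamma>_def by (rule smooth_on_compose[OF finp J(1) smc smg]) (use g in auto)
  have fstg: "fst (g (\<tau>, 0)) = \<tau>" if "\<tau> \<in> J" for \<tau>
    using g(2)[OF that] by (simp add: \<Psi>_def)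
  let ?G = "frechet_derivative g (at (0, 0))"
  have dg: "(g has_derivative ?G) (at (0, 0))"
    using smooth_on_differentiable[OF V(3,2)] by (rule has_frechet_derivative)
  \<comment> \<open>Since \<open>\<Psi>\<close> has identity derivative and
    \<open>\<Psi> (g y) = y\<close> nearby, \<open>g\<close> has identity derivative too; hence
    \<open>\<gamma>\<close> has initial velocity \<open>c' (1, 0) = v\<close>.\<close>
  have "((\<lambda>y. \<Psi> (g y)) has_derivative ?G) (at (0, 0))"
    using has_derivative_compose[OF dg, of \<Psi> "\<lambda>q. q"] d\<Psi> V(4) by simp
  moreover have "((\<lambda>y. \<Psi> (g y)) has_derivative (\<lambda>q. q)) (at (0, 0))"
    by (rule has_derivative_transform_within_open[OF has_derivative_ident V(1,2)]) (simp add: V(6))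
  ultimately have G: "?G = (\<lambda>q. q)"
    by (rule has_derivative_unique)
  have "((\<lambda>\<tau>. g (\<tau>, 0)) has_derivative (\<lambda>t. (t, 0))) (at 0)"
    using has_derivative_compose[of "\<lambda>\<tau>. (\<tau>, 0::'f)" "\<lambda>t. (t, 0)" 0 UNIV g "\<lambda>q. q"] dg
    by (simp add: G has_derivative_Pair)
  moreover have "(c has_derivative c') (at (g (0, 0)))"
    unfolding c_eq
    using has_derivative_add[OF has_derivative_const bounded_linear_imp_has_derivative[OF blc], of x0] by simp
  ultimately have "(\<gamma> has_derivative (\<lambda>t. c' (t, 0))) (at 0)"
    unfolding \<gamma>_def using has_derivative_compose[of "\<lambda>\<tau>. g (\<tau>, 0)" "\<lambda>t. (t, 0)" 0 UNIV c c'] by simp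
  then have "frechet_derivative \<gamma> (at 0) 1 = v"
    using linear_0[OF K(1)] by (simp add: frechet_derivative_eqI c'_def)
  moreover have "\<gamma> 0 = x0"
    by (simp add: \<gamma>_def V(4) c0)
  moreover have "J \<subseteq> I"
  proof
    fix \<tau> assume "\<tau> \<in> J"
    then show "\<tau> \<in> I"
      using g(1)[of \<tau>] fstg[of \<tau>] by (simp add: W_def)
  qed
  moreover have "\<gamma> ` J \<subseteq> U"
    using g(1) by (auto simp: \<gamma>_def W_def)
  moreover have "f (\<gamma> \<tau>) = \<delta> \<tau>" if "\<tau> \<in> J" for \<tau>
    using g(2)[OF that] fstg[OF that] by (simp add: \<Psi>_def \<gamma>_def)
  ultimately show thesis
    using that J sm\<gamma> by blast
qed

section \<open>Smooth maps between manifolds\<close>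

lemma findim_finite_span:
  assumes "findim TYPE('e::real_normed_vector)"
  shows "\<exists>B::'e::real_normed_vector set. finite B \<and> span B = UNIV"
proof -
  obtain B and cf :: "'e \<Rightarrow> 'e \<Rightarrow>\<^sub>L real" where B: "coordinates B cf"
    using assms by (rule findimE)
  have "x \<in> span B" for x
  proof -
    have "(\<Sum>b\<in>B. blinfun_apply (cf b) x *\<^sub>R b) \<in> span B"
      by (intro span_sum span_scale span_base)
    then show ?thesis
      using B by (simp add: coordinates_def)
  qed
  then show ?thesis
    using B by (auto simp: coordinates_def)
qed

lemma smooth_manifold_findim:
  "smooth_manifold (N :: ('a::topological_space, 'e::banach) manifold) \<Longrightarrow> findim TYPE('e)"
  unfolding smooth_manifold_def by (auto intro: findim_span)

lemma
  assumes "smooth_manifold N"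
  shows chart_at_Atlas: "chart_at N x \<in> Atlas N"
    and in_chart_at: "x \<in> fst (chart_at N x)"
  using assms by (auto simp: smooth_manifold_def)

lemma
  assumes "smooth_manifold N" "c \<in> Atlas N"
  shows chart_open: "open (fst c)"
    and chart_image_open_all: "open (snd c ` fst c)"
    and chart_inv_chart: "x \<in> fst c \<Longrightarrow> chart_inv c (snd c x) = x"
    and chart_chart_inv: "y \<in> snd c ` fst c \<Longrightarrow> snd c (chart_inv c y) = y"
    and chart_inv_in: "y \<in> snd c ` fst c \<Longrightarrow> chart_inv c y \<in> fst c"
    and chart_continuous: "continuous_on (fst c) (snd c)"
    and chart_inv_continuous: "continuous_on (snd c ` fst c) (chart_inv c)"
proof -
  have h: "open (fst c)" "open (snd c ` fst c)"
    "homeomorphism (fst c) (snd c ` fst c) (snd c) (chart_inv c)"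
    using assms by (auto simp: smooth_manifold_def)
  then show "open (fst c)" "open (snd c ` fst c)" "x \<in> fst c \<Longrightarrow> chart_inv c (snd c x) = x"
    "y \<in> snd c ` fst c \<Longrightarrow> snd c (chart_inv c y) = y" "y \<in> snd c ` fst c \<Longrightarrow> chart_inv c y \<in> fst c"
    "continuous_on (fst c) (snd c)" "continuous_on (snd c ` fst c) (chart_inv c)"
    by (auto simp: homeomorphism_def)
qed

lemma chart_transition:
  assumes "smooth_manifold N" "c \<in> Atlas N" "d \<in> Atlas N"
  shows "smooth_on (snd c ` (fst c \<inter> fst d)) (\<lambda>y. snd d (chart_inv c y))"
  using assms unfolding smooth_manifold_def by (auto simp: o_def)

lemma open_preimage_on:
  assumes "continuous_on S f" "open S" "open T"
  shows "open {x \<in> S. f x \<in> T}"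
proof -
  have "open (f -` T \<inter> S)"
    using assms by (simp add: continuous_on_open_vimage)
  moreover have "f -` T \<inter> S = {x \<in> S. f x \<in> T}"
    by auto
  ultimately show ?thesis by simp
qed

lemma chart_image_open:
  assumes N: "smooth_manifold N" "c \<in> Atlas N" and A: "open A" "A \<subseteq> fst c"
  shows "open (snd c ` A)"
proof -
  have "snd c ` A = {y \<in> snd c ` fst c. chart_inv c y \<in> A}"
    using A(2) by (force simp: chart_inv_chart[OF N])
  then show ?thesis
    using open_preimage_on[OF chart_inv_continuous[OF N] chart_image_open_all[OF N] A(1)] by simp
qed

section \<open>Germs of smooth maps\<close>

text \<open>Hiding the domain makes smoothness a property of the germ, so compositions need no
  bookkeeping of open sets.\<close>

definition smooth_near ::
  "('a::topological_space, 'e::banach) manifold \<Rightarrow> ('b::topological_space, 'f::banach) manifold \<Rightarrow>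
     ('a \<Rightarrow> 'b) \<Rightarrow> 'a \<Rightarrow> bool" where
  "smooth_near N P f x \<longleftrightarrow> (\<exists>W. x \<in> W \<and> smooth_map_on N P W f)"

text \<open>Smoothness tested in a single pair of charts: by \<open>smooth_nearI\<close> one pair
  suffices, by \<open>smooth_nearD\<close> every pair passes.\<close>

definition smooth_in_charts ::
  "('a, 'e::real_normed_vector) chart \<Rightarrow> ('b, 'f::real_normed_vector) chart \<Rightarrow> ('a \<Rightarrow> 'b) \<Rightarrow> 'a \<Rightarrow> bool" where
  "smooth_in_charts c d f x \<longleftrightarrow> x \<in> fst c \<and> f x \<in> fst d \<and>
     (\<exists>V. open V \<and> snd c x \<in> V \<and> V \<subseteq> snd c ` fst c \<and> (\<forall>y\<in>V. f (chart_inv c y) \<in> fst d) \<and>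
        smooth_on V (\<lambda>y. snd d (f (chart_inv c y))))"

text \<open>Other charts are reached through transition maps on both sides. Continuity of
  \<open>f\<close> comes from its coordinate expression followed by the inverse of the target
  chart.\<close>

lemma smooth_nearI:
  assumes N: "smooth_manifold N" and P: "smooth_manifold P"
    and c: "c \<in> Atlas N" and d: "d \<in> Atlas P" and s: "smooth_in_charts c d f x"
  shows "smooth_near N P f x"
proof -
  obtain V where V: "open V" "snd c x \<in> V" "V \<subseteq> snd c ` fst c" "\<And>y. y \<in> V \<Longrightarrow> f (chart_inv c y) \<in> fst d"
    "smooth_on V (\<lambda>y. snd d (f (chart_inv c y)))" and x: "x \<in> fst c"
    using s unfolding smooth_in_charts_def by blast
  define W where "W = {x \<in> fst c. snd c x \<in> V}"
  have W: "open W"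
    unfolding W_def by (rule open_preimage_on[OF chart_continuous[OF N c] chart_open[OF N c] V(1)])
  have fW: "f z \<in> fst d" if "z \<in> W" for z
    using V(4)[of "snd c z"] that by (simp add: W_def chart_inv_chart[OF N c])
  have "continuous_on W (\<lambda>z. chart_inv d (snd d (f (chart_inv c (snd c z)))))"
  proof (rule continuous_on_compose2[OF chart_inv_continuous[OF P d]])
    show "continuous_on W (\<lambda>z. snd d (f (chart_inv c (snd c z))))"
      by (rule continuous_on_compose2[OF smooth_on_continuous_on[OF V(5)]])
        (auto simp: W_def intro: continuous_on_subset[OF chart_continuous[OF N c]])
  qed (auto simp: W_def intro!: V(4))
  moreover have "chart_inv d (snd d (f (chart_inv c (snd c z)))) = f z" if "z \<in> W" for z
    using fW[OF that] that by (simp add: W_def chart_inv_chart[OF N c] chart_inv_chart[OF P d])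
  ultimately have cont: "continuous_on W f"
    by (simp cong: continuous_on_cong)
  have "smooth_on (snd c' ` (W \<inter> fst c' \<inter> f -` fst d')) (snd d' \<circ> f \<circ> chart_inv c')"
    if c': "c' \<in> Atlas N" and d': "d' \<in> Atlas P" for c' d'
  proof -
    let ?A = "W \<inter> fst c' \<inter> f -` fst d'"
    let ?S = "snd c' ` ?A"
    have "open {z \<in> W. f z \<in> fst d'}"
      by (rule open_preimage_on[OF cont W chart_open[OF P d']])
    moreover have "?A = {z \<in> W. f z \<in> fst d'} \<inter> fst c'"
      by auto
    ultimately have "open ?A"
      using chart_open[OF N c'] by auto
    then have S: "open ?S"
      by (rule chart_image_open[OF N c']) auto
    \<comment> \<open>The route goes from \<open>c'\<close> to \<open>c\<close>, then through
      \<open>f\<close> from \<open>c\<close> to \<open>d\<close>, then on to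
      \<open>d'\<close>.\<close>
    have 1: "smooth_on ?S (\<lambda>y. snd c (chart_inv c' y))"
      by (rule smooth_on_subset[OF chart_transition[OF N c' c]]) (auto simp: W_def)
    have 2: "smooth_on ?S (\<lambda>y. snd d (f (chart_inv c (snd c (chart_inv c' y)))))"
      by (rule smooth_on_compose[OF smooth_manifold_findim[OF N] S V(5) 1])
        (auto simp: chart_inv_chart[OF N c'] W_def)
    have 3: "smooth_on ?S (\<lambda>y. snd d' (chart_inv d (snd d (f (chart_inv c (snd c (chart_inv c' y)))))))"
      by (rule smooth_on_compose[OF smooth_manifold_findim[OF P] S chart_transition[OF P d d'] 2])
        (auto simp: chart_inv_chart[OF N c'] chart_inv_chart[OF N c] W_def intro!: imageI fW[unfolded W_def])
    have "snd d' (chart_inv d (snd d (f (chart_inv c (snd c (chart_inv c' y)))))) = (snd d' \<circ> f \<circ> chart_inv c') y"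
      if "y \<in> ?S" for y
      using that fW by (auto simp: chart_inv_chart[OF N c'] chart_inv_chart[OF N c] chart_inv_chart[OF P d] W_def)
    with 3 show ?thesis
      using smooth_on_cong[OF S] by (metis (no_types, lifting))
  qed
  then have "smooth_map_on N P W f"
    using W cont by (simp add: smooth_map_on_def)
  moreover have "x \<in> W"
    using x V(2) by (simp add: W_def)
  ultimately show ?thesis
    by (auto simp: smooth_near_def)
qed

lemma smooth_nearD:
  assumes N: "smooth_manifold N" and P: "smooth_manifold P" and f: "smooth_near N P f x"
    and c: "c \<in> Atlas N" "x \<in> fst c" and d: "d \<in> Atlas P" "f x \<in> fst d"
  shows "smooth_in_charts c d f x"
proof -
  obtain W where W: "x \<in> W" "open W" "continuous_on W f"
    and s: "smooth_on (snd c ` (W \<inter> fst c \<inter> f -` fst d)) (snd d \<circ> f \<circ> chart_inv c)"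
    using f c d by (auto simp: smooth_near_def smooth_map_on_def)
  let ?A = "W \<inter> fst c \<inter> f -` fst d"
  have "open {z \<in> W. f z \<in> fst d}"
    by (rule open_preimage_on[OF W(3,2) chart_open[OF P d(1)]])
  moreover have "?A = {z \<in> W. f z \<in> fst d} \<inter> fst c"
    by auto
  ultimately have "open ?A"
    using chart_open[OF N c(1)] by auto
  then have "open (snd c ` ?A)"
    by (rule chart_image_open[OF N c(1)]) auto
  then show ?thesis
    using W(1) c d s unfolding smooth_in_charts_def
    by (intro conjI exI[of _ "snd c ` ?A"]) (auto simp: chart_inv_chart[OF N c(1)] o_def)
qed

lemma smooth_map_on_near: "smooth_map_on N P W f \<Longrightarrow> x \<in> W \<Longrightarrow> smooth_near N P f x"
  by (auto simp: smooth_near_def)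

lemma smooth_near_eventually: "smooth_near N P f x \<Longrightarrow> eventually (smooth_near N P f) (nhds x)"
  unfolding smooth_near_def eventually_nhds smooth_map_on_def by blast

lemma smooth_near_filterlim:
  assumes "smooth_near N P f x"
  shows "filterlim f (nhds (f x)) (nhds x)"
proof -
  obtain W where W: "x \<in> W" "open W" "continuous_on W f"
    using assms by (auto simp: smooth_near_def smooth_map_on_def)
  have "eventually (\<lambda>y. f y \<in> S) (nhds x)" if "open S" "f x \<in> S" for S
    using open_preimage_on[OF W(3,2) that(1)] W(1) that(2) unfolding eventually_nhds
    by (intro exI[of _ "{y \<in> W. f y \<in> S}"]) auto
  then show ?thesis
    by (simp add: filterlim_iff eventually_nhds) metis
qed

lemma smooth_near_eventually_compose:
  "smooth_near N P f x \<Longrightarrow> eventually Q (nhds (f x)) \<Longrightarrow> eventually (\<lambda>y. Q (f y)) (nhds x)"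
  using smooth_near_filterlim filterlim_iff by blast

lemma chart_inv_filterlim:
  assumes N: "smooth_manifold N" and c: "c \<in> Atlas N" "x \<in> fst c"
  shows "filterlim (chart_inv c) (nhds x) (nhds (snd c x))"
proof -
  have "eventually (\<lambda>y. chart_inv c y \<in> S) (nhds (snd c x))" if "open S" "x \<in> S" for S
    using open_preimage_on[OF chart_inv_continuous[OF N c(1)] chart_image_open_all[OF N c(1)] that(1)] c(2) that(2)
    unfolding eventually_nhds
    by (intro exI[of _ "{y \<in> snd c ` fst c. chart_inv c y \<in> S}"]) (auto simp: chart_inv_chart[OF N c(1)])
  then show ?thesis
    by (simp add: filterlim_iff eventually_nhds) metis
qed

lemma smooth_near_compose:
  assumes N: "smooth_manifold N" and P: "smooth_manifold P" and Q: "smooth_manifold Q"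
    and f: "smooth_near N P f x" and h: "smooth_near P Q h (f x)"
  shows "smooth_near N Q (\<lambda>x. h (f x)) x"
proof -
  let ?c = "chart_at N x" and ?d = "chart_at P (f x)" and ?e = "chart_at Q (h (f x))"
  note cN = chart_at_Atlas[OF N, of x] and cP = chart_at_Atlas[OF P, of "f x"] and cQ = chart_at_Atlas[OF Q, of "h (f x)"]
  obtain V where V: "open V" "snd ?c x \<in> V" "V \<subseteq> snd ?c ` fst ?c"
    "\<And>y. y \<in> V \<Longrightarrow> f (chart_inv ?c y) \<in> fst ?d" "smooth_on V (\<lambda>y. snd ?d (f (chart_inv ?c y)))"
    using smooth_nearD[OF N P f cN in_chart_at[OF N] cP in_chart_at[OF P]] unfolding smooth_in_charts_def by blast
  obtain V2 where V2: "open V2" "snd ?d (f x) \<in> V2" "V2 \<subseteq> snd ?d ` fst ?d"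
    "\<And>y. y \<in> V2 \<Longrightarrow> h (chart_inv ?d y) \<in> fst ?e" "smooth_on V2 (\<lambda>y. snd ?e (h (chart_inv ?d y)))"
    using smooth_nearD[OF P Q h cP in_chart_at[OF P] cQ in_chart_at[OF Q]] unfolding smooth_in_charts_def by blast
  let ?V = "{y \<in> V. snd ?d (f (chart_inv ?c y)) \<in> V2}"
  have oV: "open ?V"
    by (rule open_preimage_on[OF smooth_on_continuous_on[OF V(5)] V(1) V2(1)])
  have eq: "chart_inv ?d (snd ?d (f (chart_inv ?c y))) = f (chart_inv ?c y)" if "y \<in> ?V" for y
    using that V(4) by (simp add: chart_inv_chart[OF P cP])
  have "smooth_on ?V (\<lambda>y. snd ?e (h (chart_inv ?d (snd ?d (f (chart_inv ?c y))))))"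
    by (rule smooth_on_compose[OF smooth_manifold_findim[OF P] oV V2(5)])
      (auto intro: smooth_on_subset[OF V(5)])
  then have "smooth_on ?V (\<lambda>y. snd ?e (h (f (chart_inv ?c y))))"
    using smooth_on_cong[OF oV, of "\<lambda>y. snd ?e (h (chart_inv ?d (snd ?d (f (chart_inv ?c y)))))"
        "\<lambda>y. snd ?e (h (f (chart_inv ?c y)))"] eq by simp
  moreover have "h (f (chart_inv ?c y)) \<in> fst ?e" if "y \<in> ?V" for y
    using V2(4)[of "snd ?d (f (chart_inv ?c y))"] eq[OF that] that by simp
  ultimately have "smooth_in_charts ?c ?e (\<lambda>x. h (f x)) x"
    unfolding smooth_in_charts_def using oV V(2,3) V2(2)
    by (intro conjI in_chart_at N Q exI[of _ ?V])
      (auto simp: chart_inv_chart[OF N cN] in_chart_at[OF N])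
  then show ?thesis
    by (rule smooth_nearI[OF N Q cN cQ])
qed

lemma smooth_near_cong:
  assumes N: "smooth_manifold N" and P: "smooth_manifold P"
    and f: "smooth_near N P f x" and ev: "eventually (\<lambda>y. f y = g y) (nhds x)"
  shows "smooth_near N P g x"
proof -
  let ?c = "chart_at N x" and ?d = "chart_at P (f x)"
  note cN = chart_at_Atlas[OF N, of x] and cP = chart_at_Atlas[OF P, of "f x"]
  have gx: "g x = f x"
    using eventually_nhds_x_imp_x[OF ev] by simp
  obtain V where V: "open V" "snd ?c x \<in> V" "V \<subseteq> snd ?c ` fst ?c"
    "\<And>y. y \<in> V \<Longrightarrow> f (chart_inv ?c y) \<in> fst ?d" "smooth_on V (\<lambda>y. snd ?d (f (chart_inv ?c y)))"
    using smooth_nearD[OF N P f cN in_chart_at[OF N] cP in_chart_at[OF P]] unfolding smooth_in_charts_def by blast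
  have "eventually (\<lambda>y. f (chart_inv ?c y) = g (chart_inv ?c y)) (nhds (snd ?c x))"
    by (rule filterlim_iff[THEN iffD1, rule_format, OF chart_inv_filterlim[OF N cN in_chart_at[OF N]] ev])
  then obtain S where S: "open S" "snd ?c x \<in> S" "\<And>y. y \<in> S \<Longrightarrow> f (chart_inv ?c y) = g (chart_inv ?c y)"
    unfolding eventually_nhds by blast
  have VS: "open (V \<inter> S)"
    using V(1) S(1) by auto
  have "smooth_on (V \<inter> S) (\<lambda>y. snd ?d (g (chart_inv ?c y)))"
    using smooth_on_cong[OF VS, of "\<lambda>y. snd ?d (f (chart_inv ?c y))" "\<lambda>y. snd ?d (g (chart_inv ?c y))"]
      S(3) smooth_on_subset[OF V(5), of "V \<inter> S"] by simp
  moreover have "g (chart_inv ?c y) \<in> fst ?d" if "y \<in> V \<inter> S" for y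
    using V(4)[of y] S(3)[of y] that by simp
  ultimately have "smooth_in_charts ?c ?d g x"
    unfolding smooth_in_charts_def using VS V(2,3) S(2) in_chart_at[OF N] in_chart_at[OF P, of "f x"] gx
    by (intro conjI exI[of _ "V \<inter> S"]) auto
  then show ?thesis
    by (rule smooth_nearI[OF N P cN cP])
qed

lemma smooth_near_ident:
  assumes N: "smooth_manifold N" shows "smooth_near N N (\<lambda>x. x) x"
proof (rule smooth_nearI[OF N N chart_at_Atlas[OF N] chart_at_Atlas[OF N]])
  note cN = chart_at_Atlas[OF N, of x]
  let ?V = "snd (chart_at N x) ` fst (chart_at N x)"
  have "smooth_on ?V (\<lambda>y. snd (chart_at N x) (chart_inv (chart_at N x) y))"
    using chart_transition[OF N cN cN] by simp
  then show "smooth_in_charts (chart_at N x) (chart_at N x) (\<lambda>x. x) x"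
    unfolding smooth_in_charts_def
    using in_chart_at[OF N] chart_image_open_all[OF N cN] chart_inv_in[OF N cN]
    by (intro conjI exI[of _ ?V]) auto
qed

lemma smooth_near_const:
  assumes N: "smooth_manifold N" and P: "smooth_manifold P" shows "smooth_near N P (\<lambda>x. p) x"
proof (rule smooth_nearI[OF N P chart_at_Atlas[OF N] chart_at_Atlas[OF P]])
  show "smooth_in_charts (chart_at N x) (chart_at P p) (\<lambda>x. p) x"
    unfolding smooth_in_charts_def
    using in_chart_at[OF N] in_chart_at[OF P] chart_image_open_all[OF N chart_at_Atlas[OF N, of x]]
    by (intro conjI exI[of _ "snd (chart_at N x) ` fst (chart_at N x)"]) (auto simp: smooth_on_const)
qed

section \<open>Products of manifolds\<close>

lemma fst_chart_prod [simp]: "fst (chart_prod c d) = fst c \<times> fst d"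
  and snd_chart_prod [simp]: "snd (chart_prod c d) = map_prod (snd c) (snd d)"
  by (simp_all add: chart_prod_def)

text \<open>\<open>inv_into\<close> makes a choice on the product domain; injectivity of the product
  chart there forces it to be the pair of inverses.\<close>

lemma chart_inv_prod:
  assumes N: "smooth_manifold N" "c \<in> Atlas N" and P: "smooth_manifold P" "d \<in> Atlas P"
    and "y \<in> snd c ` fst c" "z \<in> snd d ` fst d"
  shows "chart_inv (chart_prod c d) (y, z) = (chart_inv c y, chart_inv d z)"
proof (rule inv_into_f_eq)
  show "inj_on (snd (chart_prod c d)) (fst (chart_prod c d))"
    by (auto intro!: inj_onI dest!: arg_cong[of _ _ "chart_inv c"] arg_cong[of _ _ "chart_inv d"]
        simp: chart_inv_chart[OF N] chart_inv_chart[OF P])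
qed (use assms in \<open>auto simp: chart_chart_inv[OF N] chart_chart_inv[OF P] chart_inv_in[OF N] chart_inv_in[OF P]\<close>)

lemmas chart_inv_prod' = chart_inv_prod[unfolded fst_chart_prod snd_chart_prod]

lemma smooth_manifold_prod:
  assumes N: "smooth_manifold N" and P: "smooth_manifold P"
  shows "smooth_manifold (N \<times>\<^sub>M P)"
  unfolding smooth_manifold_def
proof (intro conjI ballI allI)
  show "\<exists>B::('b \<times> 'd) set. finite B \<and> span B = UNIV"
    using findim_prod[OF smooth_manifold_findim[OF N] smooth_manifold_findim[OF P]] by (rule findim_finite_span)
next
  fix e assume "e \<in> Atlas (N \<times>\<^sub>M P)"
  then obtain c d where e: "e = chart_prod c d" and c: "c \<in> Atlas N" and d: "d \<in> Atlas P"
    by (auto simp: prod_manifold_def)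
  have im: "snd e ` fst e = (snd c ` fst c) \<times> (snd d ` fst d)"
    by (auto simp: e)
  show "open (fst e)"
    using chart_open[OF N c] chart_open[OF P d] by (simp add: e open_Times)
  show "open (snd e ` fst e)"
    using chart_image_open_all[OF N c] chart_image_open_all[OF P d] by (simp add: im open_Times)
  show "homeomorphism (fst e) (snd e ` fst e) (snd e) (chart_inv e)"
  proof -
    have "continuous_on (fst e) (\<lambda>p. (snd c (fst p), snd d (snd p)))"
      by (intro continuous_on_Pair continuous_on_compose2[OF chart_continuous[OF N c]]
          continuous_on_compose2[OF chart_continuous[OF P d]] continuous_on_fst continuous_on_snd continuous_on_id)
        (auto simp: e)
    then have 1: "continuous_on (fst e) (snd e)"
      by (simp add: e map_prod_def case_prod_beta')
    have "continuous_on (snd e ` fst e) (\<lambda>p. (chart_inv c (fst p), chart_inv d (snd p)))"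
      by (intro continuous_on_Pair continuous_on_compose2[OF chart_inv_continuous[OF N c]]
          continuous_on_compose2[OF chart_inv_continuous[OF P d]] continuous_on_fst continuous_on_snd continuous_on_id)
        (auto simp: e)
    then have 2: "continuous_on (snd e ` fst e) (chart_inv e)"
      by (rule continuous_on_eq) (auto simp: e chart_inv_prod'[OF N c P d])
    have 3: "chart_inv e (snd e p) = p" if "p \<in> fst e" for p
      using that by (auto simp: e chart_inv_prod'[OF N c P d] chart_inv_chart[OF N c] chart_inv_chart[OF P d])
    have "chart_inv e ` (snd e ` fst e) = fst e"
      by (simp add: image_image 3)
    then show ?thesis
      using 1 2 3 by (simp add: homeomorphism_def)
  qed
next
  show "chart_at (N \<times>\<^sub>M P) x \<in> Atlas (N \<times>\<^sub>M P)" for x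
    by (auto simp: prod_manifold_def chart_at_Atlas[OF N] chart_at_Atlas[OF P] split: prod.split)
  show "x \<in> fst (chart_at (N \<times>\<^sub>M P) x)" for x
    by (auto simp: prod_manifold_def in_chart_at[OF N] in_chart_at[OF P] split: prod.split)
next
  fix e e' assume "e \<in> Atlas (N \<times>\<^sub>M P)" "e' \<in> Atlas (N \<times>\<^sub>M P)"
  then obtain c d c' d' where e: "e = chart_prod c d" and c: "c \<in> Atlas N" and d: "d \<in> Atlas P"
    and e': "e' = chart_prod c' d'" and c': "c' \<in> Atlas N" and d': "d' \<in> Atlas P"
    by (auto simp: prod_manifold_def)
  let ?X = "snd c ` (fst c \<inter> fst c')" and ?Y = "snd d ` (fst d \<inter> fst d')"
  have im: "snd e ` (fst e \<inter> fst e') = ?X \<times> ?Y"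
    by (auto simp: e e' intro!: image_eqI)
  have XY: "open (?X \<times> ?Y)"
    using chart_open[OF N c'] chart_open[OF P d'] chart_open[OF N c] chart_open[OF P d]
    by (intro open_Times chart_image_open[OF N c] chart_image_open[OF P d]) auto
  have "smooth_on (?X \<times> ?Y) (\<lambda>p. (snd c' (chart_inv c (fst p)), snd d' (chart_inv d (snd p))))"
    by (intro smooth_on_Pair XY smooth_on_compose[OF smooth_manifold_findim[OF N] XY chart_transition[OF N c c']]
        smooth_on_compose[OF smooth_manifold_findim[OF P] XY chart_transition[OF P d d']]
        smooth_on_bounded_linear bounded_linear_fst bounded_linear_snd) auto
  moreover have "(snd c' (chart_inv c (fst p)), snd d' (chart_inv d (snd p))) = (snd e' \<circ> chart_inv e) p"
    if "p \<in> ?X \<times> ?Y" for p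
    using that by (auto simp: e e' chart_inv_prod'[OF N c P d])
  ultimately show "smooth_on (snd e ` (fst e \<inter> fst e')) (snd e' \<circ> chart_inv e)"
    unfolding im by (rule iffD1[OF smooth_on_cong[OF XY], rotated])
qed

lemma smooth_near_Pair:
  assumes N: "smooth_manifold N" and P: "smooth_manifold P" and Q: "smooth_manifold Q"
    and f: "smooth_near N P f x" and g: "smooth_near N Q g x"
  shows "smooth_near N (P \<times>\<^sub>M Q) (\<lambda>x. (f x, g x)) x"
proof -
  let ?c = "chart_at N x" and ?d = "chart_at P (f x)" and ?e = "chart_at Q (g x)"
  note cN = chart_at_Atlas[OF N, of x] and cP = chart_at_Atlas[OF P, of "f x"] and cQ = chart_at_Atlas[OF Q, of "g x"]
  obtain V where V: "open V" "snd ?c x \<in> V" "V \<subseteq> snd ?c ` fst ?c"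
    "\<And>y. y \<in> V \<Longrightarrow> f (chart_inv ?c y) \<in> fst ?d" "smooth_on V (\<lambda>y. snd ?d (f (chart_inv ?c y)))"
    using smooth_nearD[OF N P f cN in_chart_at[OF N] cP in_chart_at[OF P]] unfolding smooth_in_charts_def by blast
  obtain V2 where V2: "open V2" "snd ?c x \<in> V2" "V2 \<subseteq> snd ?c ` fst ?c"
    "\<And>y. y \<in> V2 \<Longrightarrow> g (chart_inv ?c y) \<in> fst ?e" "smooth_on V2 (\<lambda>y. snd ?e (g (chart_inv ?c y)))"
    using smooth_nearD[OF N Q g cN in_chart_at[OF N] cQ in_chart_at[OF Q]] unfolding smooth_in_charts_def by blast
  have "open (V \<inter> V2)"
    using V(1) V2(1) by auto
  moreover have "smooth_on (V \<inter> V2) (\<lambda>y. (snd ?d (f (chart_inv ?c y)), snd ?e (g (chart_inv ?c y))))"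
    using V(1,5) V2(1,5) by (intro smooth_on_Pair) (auto intro: smooth_on_subset)
  ultimately have "smooth_in_charts ?c (chart_prod ?d ?e) (\<lambda>x. (f x, g x)) x"
    unfolding smooth_in_charts_def using V(2-4) V2(2-4)
    by (intro conjI exI[of _ "V \<inter> V2"]) (auto simp: in_chart_at[OF N] in_chart_at[OF P] in_chart_at[OF Q])
  then show ?thesis
    by (rule smooth_nearI[OF N smooth_manifold_prod[OF P Q] cN, rotated])
      (use cP cQ in \<open>auto simp: prod_manifold_def\<close>)
qed

lemma
  assumes N: "smooth_manifold N" and P: "smooth_manifold P"
  shows smooth_near_fst: "smooth_near (N \<times>\<^sub>M P) N fst p"
    and smooth_near_snd: "smooth_near (N \<times>\<^sub>M P) P snd p"
proof -
  obtain x y where p: "p = (x, y)" by force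
  let ?c = "chart_at N x" and ?d = "chart_at P y"
  note cN = chart_at_Atlas[OF N, of x] and cP = chart_at_Atlas[OF P, of y]
  have A: "chart_prod ?c ?d \<in> Atlas (N \<times>\<^sub>M P)"
    using cN cP by (auto simp: prod_manifold_def)
  let ?V = "(snd ?c ` fst ?c) \<times> (snd ?d ` fst ?d)"
  have V: "open ?V"
    by (intro open_Times chart_image_open_all[OF N cN] chart_image_open_all[OF P cP])
  have im: "snd (chart_prod ?c ?d) ` fst (chart_prod ?c ?d) = ?V"
    by auto
  have "snd ?c (fst (chart_inv (chart_prod ?c ?d) q)) = fst q" "snd ?d (snd (chart_inv (chart_prod ?c ?d) q)) = snd q"
    "fst (chart_inv (chart_prod ?c ?d) q) \<in> fst ?c" "snd (chart_inv (chart_prod ?c ?d) q) \<in> fst ?d"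
    if "q \<in> ?V" for q
    using that by (auto simp: chart_inv_prod'[OF N cN P cP] chart_inv_chart[OF N cN] chart_inv_chart[OF P cP])
  moreover have "smooth_on ?V fst" "smooth_on ?V snd"
    by (intro smooth_on_bounded_linear bounded_linear_fst bounded_linear_snd)+
  ultimately have "smooth_on ?V (\<lambda>q. snd ?c (fst (chart_inv (chart_prod ?c ?d) q)))"
    "smooth_on ?V (\<lambda>q. snd ?d (snd (chart_inv (chart_prod ?c ?d) q)))"
    and m: "\<And>q. q \<in> ?V \<Longrightarrow> fst (chart_inv (chart_prod ?c ?d) q) \<in> fst ?c"
    "\<And>q. q \<in> ?V \<Longrightarrow> snd (chart_inv (chart_prod ?c ?d) q) \<in> fst ?d"
    using smooth_on_cong[OF V, of fst "\<lambda>q. snd ?c (fst (chart_inv (chart_prod ?c ?d) q))"]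
      smooth_on_cong[OF V, of snd "\<lambda>q. snd ?d (snd (chart_inv (chart_prod ?c ?d) q))"] by simp_all
  then have "smooth_in_charts (chart_prod ?c ?d) ?c fst p" "smooth_in_charts (chart_prod ?c ?d) ?d snd p"
    unfolding smooth_in_charts_def im using V in_chart_at[OF N, of x] in_chart_at[OF P, of y]
    by (simp_all add: p del: snd_chart_prod; intro exI[of _ ?V]; simp)+
  then show "smooth_near (N \<times>\<^sub>M P) N fst p" "smooth_near (N \<times>\<^sub>M P) P snd p"
    by (auto intro: smooth_nearI[OF smooth_manifold_prod[OF N P] N A cN] smooth_nearI[OF smooth_manifold_prod[OF N P] P A cP])
qed

section \<open>Model spaces as manifolds\<close>

lemma chart_inv_id [simp]: "inv_into UNIV id = id"
  by (simp add: fun_eq_iff inv_f_eq)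

lemma smooth_manifold_model:
  assumes "findim TYPE('e::banach)"
  shows "smooth_manifold (model_manifold :: ('e::banach, 'e) manifold)"
  using findim_finite_span[OF assms] smooth_on_ident[of UNIV]
  by (auto simp: smooth_manifold_def model_manifold_def homeomorphism_def id_def o_def continuous_on_id)

lemma smooth_manifold_model_real: "smooth_manifold (model_manifold :: (real, real) manifold)"
  by (rule smooth_manifold_model[OF findim_real])

lemma Atlas_model: "(UNIV, id) \<in> Atlas model_manifold"
  and chart_at_model [simp]: "chart_at model_manifold x = (UNIV, id)"
  by (simp_all add: model_manifold_def)

lemma smooth_near_chart:
  assumes N: "smooth_manifold (N :: ('a::topological_space, 'e::banach) manifold)" and c: "c \<in> Atlas N" "x \<in> fst c"
  shows "smooth_near N model_manifold (snd c) x"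
proof -
  have "smooth_on (snd c ` fst c) (\<lambda>y. snd c (chart_inv c y))"
    using chart_transition[OF N c(1,1)] by simp
  then have "smooth_in_charts c (UNIV, id) (snd c) x"
    unfolding smooth_in_charts_def using c chart_image_open_all[OF N c(1)]
    by (intro conjI exI[of _ "snd c ` fst c"]) auto
  then show ?thesis
    by (rule smooth_nearI[OF N smooth_manifold_model[OF smooth_manifold_findim[OF N]] c(1) Atlas_model])
qed

lemma smooth_near_chart_inv:
  assumes N: "smooth_manifold (N :: ('a::topological_space, 'e::banach) manifold)" and c: "c \<in> Atlas N" "y \<in> snd c ` fst c"
  shows "smooth_near model_manifold N (chart_inv c) y"
proof -
  have "smooth_on (snd c ` fst c) (\<lambda>y. snd c (chart_inv c y))"
    using chart_transition[OF N c(1,1)] by simp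
  then have "smooth_in_charts (UNIV, id) c (chart_inv c) y"
    unfolding smooth_in_charts_def using c chart_image_open_all[OF N c(1)] chart_inv_in[OF N c(1)]
    by (intro conjI exI[of _ "snd c ` fst c"]) auto
  then show ?thesis
    by (rule smooth_nearI[OF smooth_manifold_model[OF smooth_manifold_findim[OF N]] N Atlas_model c(1)])
qed

lemma smooth_near_modelI:
  fixes f :: "'e::banach \<Rightarrow> 'f::banach"
  assumes "findim TYPE('e)" "findim TYPE('f)" "open U" "x \<in> U" "smooth_on U f"
  shows "smooth_near model_manifold model_manifold f x"
  using assms(3-5) unfolding smooth_in_charts_def
  by (intro smooth_nearI[OF smooth_manifold_model smooth_manifold_model Atlas_model Atlas_model] assms(1,2))
    (auto simp: smooth_in_charts_def)

section \<open>Tangent maps\<close>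

lemma tangent_map_has_derivative:
  assumes N: "smooth_manifold N" and P: "smooth_manifold P" and f: "smooth_near N P f x"
  shows "((\<lambda>y. snd (chart_at P (f x)) (f (chart_inv (chart_at N x) y))) has_derivative tangent_map N P f x)
     (at (snd (chart_at N x) x))"
proof -
  let ?c = "chart_at N x" and ?d = "chart_at P (f x)"
  obtain V where V: "open V" "snd ?c x \<in> V" "smooth_on V (\<lambda>y. snd ?d (f (chart_inv ?c y)))"
    using smooth_nearD[OF N P f chart_at_Atlas[OF N] in_chart_at[OF N] chart_at_Atlas[OF P] in_chart_at[OF P]]
    unfolding smooth_in_charts_def by blast
  show ?thesis
    using has_frechet_derivative[OF smooth_on_differentiable[OF V(3,2)]] by (simp add: tangent_map_def o_def)
qed

lemma tangent_map_eqI: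
  assumes "((\<lambda>y. snd (chart_at P (f x)) (f (chart_inv (chart_at N x) y))) has_derivative L) (at (snd (chart_at N x) x))"
  shows "tangent_map N P f x = L"
  using frechet_derivative_eqI[OF assms] by (simp add: tangent_map_def o_def)

lemma tangent_map_bounded_linear:
  "smooth_manifold N \<Longrightarrow> smooth_manifold P \<Longrightarrow> smooth_near N P f x \<Longrightarrow> bounded_linear (tangent_map N P f x)"
  using tangent_map_has_derivative has_derivative_bounded_linear by blast

lemma tangent_map_linear:
  "smooth_manifold N \<Longrightarrow> smooth_manifold P \<Longrightarrow> smooth_near N P f x \<Longrightarrow> linear (tangent_map N P f x)"
  using tangent_map_bounded_linear bounded_linear.linear by blast

text \<open>The chain rule in coordinates. The middle chart and its inverse cancel only near the
  point, hence the neighbourhood \<open>V\<close>.\<close>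

lemma tangent_map_compose:
  assumes N: "smooth_manifold N" and P: "smooth_manifold P" and Q: "smooth_manifold Q"
    and f: "smooth_near N P f x" and h: "smooth_near P Q h (f x)"
  shows "tangent_map N Q (\<lambda>x. h (f x)) x v = tangent_map P Q h (f x) (tangent_map N P f x v)"
proof -
  let ?c = "chart_at N x" and ?d = "chart_at P (f x)" and ?e = "chart_at Q (h (f x))"
  note cN = chart_at_Atlas[OF N, of x] and cP = chart_at_Atlas[OF P, of "f x"]
  obtain V where V: "open V" "snd ?c x \<in> V" "\<And>y. y \<in> V \<Longrightarrow> f (chart_inv ?c y) \<in> fst ?d"
    using smooth_nearD[OF N P f cN in_chart_at[OF N] cP in_chart_at[OF P]] unfolding smooth_in_charts_def by blast
  have x: "chart_inv ?c (snd ?c x) = x"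
    by (rule chart_inv_chart[OF N cN in_chart_at[OF N]])
  have "((\<lambda>y. snd ?e (h (chart_inv ?d (snd ?d (f (chart_inv ?c y)))))) has_derivative
      (\<lambda>v. tangent_map P Q h (f x) (tangent_map N P f x v))) (at (snd ?c x))"
    using has_derivative_compose[OF tangent_map_has_derivative[OF N P f]] tangent_map_has_derivative[OF P Q h]
    by (simp add: x)
  then have "((\<lambda>y. snd ?e (h (f (chart_inv ?c y)))) has_derivative
      (\<lambda>v. tangent_map P Q h (f x) (tangent_map N P f x v))) (at (snd ?c x))"
    by (rule has_derivative_transform_within_open[OF _ V(1,2)]) (simp add: chart_inv_chart[OF P cP V(3)])
  then show ?thesis
    by (simp add: tangent_map_eqI)
qed

lemma tangent_map_cong:
  assumes N: "smooth_manifold N" and ev: "eventually (\<lambda>y. f y = g y) (nhds x)"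
  shows "tangent_map N P f x = tangent_map N P g x"
proof -
  let ?c = "chart_at N x"
  note cN = chart_at_Atlas[OF N, of x]
  have gx: "g x = f x"
    using eventually_nhds_x_imp_x[OF ev] by simp
  have "eventually (\<lambda>y. f (chart_inv ?c y) = g (chart_inv ?c y)) (nhds (snd ?c x))"
    by (rule filterlim_iff[THEN iffD1, rule_format, OF chart_inv_filterlim[OF N cN in_chart_at[OF N]] ev])
  then obtain S where S: "open S" "snd ?c x \<in> S" "\<And>y. y \<in> S \<Longrightarrow> f (chart_inv ?c y) = g (chart_inv ?c y)"
    unfolding eventually_nhds by blast
  \<comment> \<open>Both functions have the same candidates for a derivative, so the choice made by
    \<open>frechet_derivative\<close> is the same even if there is none.\<close>
  have "((\<lambda>y. snd (chart_at P (f x)) (f (chart_inv ?c y))) has_derivative D) (at (snd ?c x)) \<longleftrightarrow>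
      ((\<lambda>y. snd (chart_at P (f x)) (g (chart_inv ?c y))) has_derivative D) (at (snd ?c x))" for D
    by (rule iffI; erule has_derivative_transform_within_open[OF _ S(1,2)]; simp add: S(3))
  then show ?thesis
    by (simp add: tangent_map_def frechet_derivative_def o_def gx)
qed

lemma tangent_map_Pair:
  assumes N: "smooth_manifold N" and P: "smooth_manifold P" and Q: "smooth_manifold Q"
    and f: "smooth_near N P f x" and g: "smooth_near N Q g x"
  shows "tangent_map N (P \<times>\<^sub>M Q) (\<lambda>x. (f x, g x)) x v = (tangent_map N P f x v, tangent_map N Q g x v)"
proof -
  have "tangent_map N (P \<times>\<^sub>M Q) (\<lambda>x. (f x, g x)) x = (\<lambda>v. (tangent_map N P f x v, tangent_map N Q g x v))"
    by (rule tangent_map_eqI)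
      (use has_derivative_Pair[OF tangent_map_has_derivative[OF N P f] tangent_map_has_derivative[OF N Q g]]
        in \<open>simp add: prod_manifold_def\<close>)
  then show ?thesis by simp
qed

lemma chart_chart_inv_has_derivative:
  assumes N: "smooth_manifold N"
  shows "((\<lambda>y. snd (chart_at N x) (chart_inv (chart_at N x) y)) has_derivative (\<lambda>v. v)) (at (snd (chart_at N x) x))"
  using chart_at_Atlas[OF N, of x] in_chart_at[OF N, of x]
  by (intro has_derivative_transform_within_open[OF has_derivative_ident chart_image_open_all[OF N]])
    (auto simp: chart_chart_inv[OF N])

lemma tangent_map_ident:
  assumes N: "smooth_manifold N"
  shows "tangent_map N N (\<lambda>x. x) x v = v"
  using tangent_map_eqI[where f = "\<lambda>x. x", OF chart_chart_inv_has_derivative[OF N]] by simp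

text \<open>The preferred chart at \<open>x\<close> is the one in which tangent vectors at
  \<open>x\<close> are read, so it is invisible at the level of derivatives.\<close>

lemma tangent_map_chart_inv:
  assumes N: "smooth_manifold N"
  shows "tangent_map model_manifold N (chart_inv (chart_at N x)) (snd (chart_at N x) x) = (\<lambda>v. v)"
  using chart_chart_inv_has_derivative[OF N, of x] chart_inv_chart[OF N chart_at_Atlas[OF N] in_chart_at[OF N], of x]
  by (intro tangent_map_eqI) simp

lemma tangent_map_const: "tangent_map N P (\<lambda>x. p) x v = 0"
proof -
  have "tangent_map N P (\<lambda>x. p) x = (\<lambda>v. 0)"
    by (rule tangent_map_eqI) (rule has_derivative_const)
  then show ?thesis by simp
qed

text \<open>The identity is the pair of the two projections; comparing components of its tangent map
  avoids a computation in product charts.\<close>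

lemma
  assumes N: "smooth_manifold N" and P: "smooth_manifold P"
  shows tangent_map_fst: "tangent_map (N \<times>\<^sub>M P) N fst p v = fst v"
    and tangent_map_snd: "tangent_map (N \<times>\<^sub>M P) P snd p v = snd v"
proof -
  note NP = smooth_manifold_prod[OF N P]
  have "v = tangent_map (N \<times>\<^sub>M P) (N \<times>\<^sub>M P) (\<lambda>p. (fst p, snd p)) p v"
    using tangent_map_ident[OF NP] by simp
  also have "\<dots> = (tangent_map (N \<times>\<^sub>M P) N fst p v, tangent_map (N \<times>\<^sub>M P) P snd p v)"
    by (rule tangent_map_Pair[OF NP N P smooth_near_fst[OF N P] smooth_near_snd[OF N P]])
  finally show "tangent_map (N \<times>\<^sub>M P) N fst p v = fst v" "tangent_map (N \<times>\<^sub>M P) P snd p v = snd v"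
    by (metis fst_conv, metis snd_conv)
qed

lemma tangent_map_model:
  "tangent_map model_manifold model_manifold f x = frechet_derivative f (at x)"
  by (simp add: tangent_map_def)

section \<open>Curves and velocities\<close>

text \<open>The interval is traded for the filter \<open>nhds 0\<close>, so that conditions on
  several curves combine without choosing a common interval.\<close>

lemma curve_in_iff:
  assumes N: "smooth_manifold N"
  shows "curve_in N S x \<gamma> \<longleftrightarrow> \<gamma> 0 = x \<and> smooth_near model_manifold N \<gamma> 0 \<and> eventually (\<lambda>\<tau>. \<gamma> \<tau> \<in> S) (nhds 0)"
proof
  assume "curve_in N S x \<gamma>"
  then obtain \<epsilon> where e: "\<gamma> 0 = x" "\<epsilon> > 0" "smooth_map_on model_manifold N {-\<epsilon><..<\<epsilon>} \<gamma>" "\<gamma> ` {-\<epsilon><..<\<epsilon>} \<subseteq> S"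
    by (auto simp: curve_in_def)
  have "eventually (\<lambda>\<tau>. \<gamma> \<tau> \<in> S) (nhds 0)"
    unfolding eventually_nhds using e by (intro exI[of _ "{-\<epsilon><..<\<epsilon>}"]) auto
  then show "\<gamma> 0 = x \<and> smooth_near model_manifold N \<gamma> 0 \<and> eventually (\<lambda>\<tau>. \<gamma> \<tau> \<in> S) (nhds 0)"
    using e by (auto intro: smooth_map_on_near)
next
  assume a: "\<gamma> 0 = x \<and> smooth_near model_manifold N \<gamma> 0 \<and> eventually (\<lambda>\<tau>. \<gamma> \<tau> \<in> S) (nhds 0)"
  then obtain W where W: "0 \<in> W" "smooth_map_on model_manifold N W \<gamma>"
    by (auto simp: smooth_near_def)
  obtain T where T: "open T" "0 \<in> T" "\<And>\<tau>. \<tau> \<in> T \<Longrightarrow> \<gamma> \<tau> \<in> S"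
    using a unfolding eventually_nhds by blast
  have "open (W \<inter> T)" "0 \<in> W \<inter> T"
    using W T by (auto simp: smooth_map_on_def)
  then obtain \<epsilon> where e: "\<epsilon> > 0" "ball 0 \<epsilon> \<subseteq> W \<inter> T"
    using open_contains_ball by blast
  have sub: "{-\<epsilon><..<\<epsilon>} \<subseteq> W \<inter> T"
    using e(2) by (simp add: ball_eq_greaterThanLessThan)
  have "smooth_map_on model_manifold N {-\<epsilon><..<\<epsilon>} \<gamma>"
    unfolding smooth_map_on_def
  proof (intro conjI ballI)
    show "continuous_on {-\<epsilon><..<\<epsilon>} \<gamma>"
      using W(2) sub by (auto simp: smooth_map_on_def elim: continuous_on_subset)
    show "smooth_on (snd c ` ({-\<epsilon><..<\<epsilon>} \<inter> fst c \<inter> \<gamma> -` fst d)) (snd d \<circ> \<gamma> \<circ> chart_inv c)"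
      if "c \<in> Atlas model_manifold" "d \<in> Atlas N" for c d
    proof (rule smooth_on_subset)
      show "smooth_on (snd c ` (W \<inter> fst c \<inter> \<gamma> -` fst d)) (snd d \<circ> \<gamma> \<circ> chart_inv c)"
        using W(2) that by (simp add: smooth_map_on_def)
      show "snd c ` ({-\<epsilon><..<\<epsilon>} \<inter> fst c \<inter> \<gamma> -` fst d) \<subseteq> snd c ` (W \<inter> fst c \<inter> \<gamma> -` fst d)"
        using sub by (intro image_mono) blast
    qed
  qed simp
  then show "curve_in N S x \<gamma>"
    using a e(1) sub T(3) unfolding curve_in_def by (intro conjI exI[of _ \<epsilon>]) auto
qed

lemma velocity_compose:
  assumes "smooth_manifold N" "smooth_manifold P" "smooth_near model_manifold N \<gamma> 0" "smooth_near N P f (\<gamma> 0)"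
  shows "velocity P (\<lambda>\<tau>. f (\<gamma> \<tau>)) = tangent_map N P f (\<gamma> 0) (velocity N \<gamma>)"
  unfolding velocity_def using tangent_map_compose[OF smooth_manifold_model_real assms] .

lemma curve_with_velocity:
  assumes N: "smooth_manifold N"
  obtains \<gamma> where "\<gamma> 0 = x" "smooth_near model_manifold N \<gamma> 0" "velocity N \<gamma> = v"
proof -
  let ?c = "chart_at N x"
  note cN = chart_at_Atlas[OF N, of x] and fin = smooth_manifold_findim[OF N]
  have x: "snd ?c x \<in> snd ?c ` fst ?c" "chart_inv ?c (snd ?c x) = x"
    using in_chart_at[OF N] chart_inv_chart[OF N cN] by auto
  \<comment> \<open>A straight line in the preferred chart. It may leave the image of the chart, but
    only its germ at 0 matters.\<close>
  define l where "l \<tau> = snd ?c x + \<tau> *\<^sub>R v" for \<tau>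
  have l0: "l 0 = snd ?c x"
    by (simp add: l_def)
  have sl: "smooth_near model_manifold model_manifold l 0"
    unfolding l_def
    by (intro smooth_near_modelI[of UNIV] findim_real fin open_UNIV UNIV_I smooth_on_add smooth_on_const
        smooth_on_bounded_linear bounded_linear_scaleR_left)
  have ci: "smooth_near model_manifold N (chart_inv ?c) (l 0)"
    unfolding l0 by (rule smooth_near_chart_inv[OF N cN x(1)])
  have "(l has_derivative (\<lambda>\<tau>. \<tau> *\<^sub>R v)) (at 0)"
    unfolding l_def by (auto intro!: derivative_eq_intros)
  then have dl: "tangent_map model_manifold model_manifold l 0 1 = v"
    by (simp add: tangent_map_model frechet_derivative_eqI)
  then have "velocity N (\<lambda>\<tau>. chart_inv ?c (l \<tau>)) = v"
    unfolding velocity_def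
    using tangent_map_compose[OF smooth_manifold_model_real smooth_manifold_model[OF fin] N sl ci, of 1] dl
    by (simp add: l0 tangent_map_chart_inv[OF N])
  moreover have "smooth_near model_manifold N (\<lambda>\<tau>. chart_inv ?c (l \<tau>)) 0"
    by (rule smooth_near_compose[OF smooth_manifold_model_real smooth_manifold_model[OF fin] N sl ci])
  ultimately show thesis
    by (intro that[of "\<lambda>\<tau>. chart_inv ?c (l \<tau>)"]) (simp_all add: l0 x(2))
qed

text \<open>\<open>lift_curve_coordinates\<close> in the preferred charts. Equality of coordinates
  becomes equality of points because both curves stay in the domain of the target chart.\<close>

lemma curve_lift:
  assumes N: "smooth_manifold N" and P: "smooth_manifold P" and f: "smooth_near N P f x"
    and surj: "surj (tangent_map N P f x)"
    and \<delta>: "smooth_near model_manifold P \<delta> 0" "\<delta> 0 = f x" "velocity P \<delta> = tangent_map N P f x v"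
  obtains \<gamma> where "\<gamma> 0 = x" "smooth_near model_manifold N \<gamma> 0" "velocity N \<gamma> = v"
    "eventually (\<lambda>\<tau>. f (\<gamma> \<tau>) = \<delta> \<tau>) (nhds 0)"
proof -
  let ?c = "chart_at N x" and ?d = "chart_at P (f x)"
  note cN = chart_at_Atlas[OF N, of x] and cP = chart_at_Atlas[OF P, of "f x"]
  note finN = smooth_manifold_findim[OF N] and finP = smooth_manifold_findim[OF P]
  obtain V where V: "open V" "snd ?c x \<in> V" "V \<subseteq> snd ?c ` fst ?c"
    "\<And>y. y \<in> V \<Longrightarrow> f (chart_inv ?c y) \<in> fst ?d" "smooth_on V (\<lambda>y. snd ?d (f (chart_inv ?c y)))"
    using smooth_nearD[OF N P f cN in_chart_at[OF N] cP in_chart_at[OF P]] unfolding smooth_in_charts_def by blast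
  have x: "chart_inv ?c (snd ?c x) = x"
    by (rule chart_inv_chart[OF N cN in_chart_at[OF N]])
  obtain I where I: "open I" "0 \<in> I" "\<And>\<tau>. \<tau> \<in> I \<Longrightarrow> \<delta> \<tau> \<in> fst ?d" "smooth_on I (\<lambda>\<tau>. snd ?d (\<delta> \<tau>))"
    using smooth_nearD[OF smooth_manifold_model_real P \<delta>(1) Atlas_model _ cP] in_chart_at[OF P, of "f x"] \<delta>(2)
    unfolding smooth_in_charts_def by auto
  have D: "frechet_derivative (\<lambda>y. snd ?d (f (chart_inv ?c y))) (at (snd ?c x)) = tangent_map N P f x"
    by (rule frechet_derivative_eqI[OF tangent_map_has_derivative[OF N P f]])
  have "frechet_derivative (\<lambda>\<tau>. snd ?d (\<delta> \<tau>)) (at 0) 1 = velocity P \<delta>"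
    by (simp add: velocity_def tangent_map_def o_def \<delta>(2))
  then have v: "frechet_derivative (\<lambda>y. snd ?d (f (chart_inv ?c y))) (at (snd ?c x)) v =
      frechet_derivative (\<lambda>\<tau>. snd ?d (\<delta> \<tau>)) (at 0) 1"
    using \<delta>(3) D by simp
  have d0: "snd ?d (\<delta> 0) = snd ?d (f (chart_inv ?c (snd ?c x)))"
    by (simp add: x \<delta>(2))
  have surj': "surj (frechet_derivative (\<lambda>y. snd ?d (f (chart_inv ?c y))) (at (snd ?c x)))"
    by (simp add: D surj)
  obtain J g where J: "open J" "0 \<in> J" "J \<subseteq> I" "smooth_on J g" "g 0 = snd ?c x" "g ` J \<subseteq> V"
    "\<And>\<tau>. \<tau> \<in> J \<Longrightarrow> snd ?d (f (chart_inv ?c (g \<tau>))) = snd ?d (\<delta> \<tau>)" "frechet_derivative g (at 0) 1 = v"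
    using lift_curve_coordinates[OF finN finP V(1,2,5) I(1,2,4) d0 surj' v] by blast
  have sg: "smooth_near model_manifold model_manifold g 0"
    by (rule smooth_near_modelI[OF findim_real finN J(1,2,4)])
  have ci: "smooth_near model_manifold N (chart_inv ?c) (g 0)"
    unfolding J(5) using in_chart_at[OF N] by (intro smooth_near_chart_inv[OF N cN]) auto
  then have vel: "velocity N (\<lambda>\<tau>. chart_inv ?c (g \<tau>)) = v"
    unfolding velocity_def
    using tangent_map_compose[OF smooth_manifold_model_real smooth_manifold_model[OF finN] N sg ci, of 1] J(8)
    by (simp add: J(5) tangent_map_model tangent_map_chart_inv[OF N])
  have sm: "smooth_near model_manifold N (\<lambda>\<tau>. chart_inv ?c (g \<tau>)) 0"
    by (rule smooth_near_compose[OF smooth_manifold_model_real smooth_manifold_model[OF finN] N sg ci])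
  have "f (chart_inv ?c (g \<tau>)) = \<delta> \<tau>" if "\<tau> \<in> J" for \<tau>
  proof -
    have "f (chart_inv ?c (g \<tau>)) \<in> fst ?d" "\<delta> \<tau> \<in> fst ?d"
      using that J(3,6) V(4) I(3) by auto
    then show ?thesis
      using J(7)[OF that] chart_inv_chart[OF P cP] by metis
  qed
  then have "eventually (\<lambda>\<tau>. f (chart_inv ?c (g \<tau>)) = \<delta> \<tau>) (nhds 0)"
    unfolding eventually_nhds using J(1,2) by blast
  then show thesis
    using that[of "\<lambda>\<tau>. chart_inv ?c (g \<tau>)"] vel sm by (simp add: J(5) x)
qed

section \<open>Affine and multiplicative functions on the cotangent groupoid\<close>

type_synonym ('a, 'b) covector_function = "'a \<Rightarrow> (nat \<Rightarrow> 'b \<Rightarrow>\<^sub>L real) \<Rightarrow> real"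

text \<open>The algebra of the tangent groupoid, separated from manifolds. \<open>Tm\<close> is
  linear on all pairs with composable base points, so vectors can be split additively, while its
  groupoid laws concern vectors with \<open>dS g v = dT h w\<close>.\<close>

locale tangent_groupoid =
  fixes src tgt :: "'g \<Rightarrow> 'm" and one :: "'m \<Rightarrow> 'g" and ginv :: "'g \<Rightarrow> 'g" and mul :: "'g \<Rightarrow> 'g \<Rightarrow> 'g"
    and dS dT :: "'g \<Rightarrow> 'e::real_normed_vector \<Rightarrow> 'f::real_normed_vector"
    and d1 :: "'m \<Rightarrow> 'f \<Rightarrow> 'e" and dI :: "'g \<Rightarrow> 'e \<Rightarrow> 'e" and Tm :: "'g \<Rightarrow> 'g \<Rightarrow> 'e \<Rightarrow> 'e \<Rightarrow> 'e"
  assumes src_mul: "src g = tgt h \<Longrightarrow> src (mul g h) = src h"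
    and tgt_mul: "src g = tgt h \<Longrightarrow> tgt (mul g h) = tgt g"
    and mul_assoc: "src g = tgt h \<Longrightarrow> src h = tgt l \<Longrightarrow> mul (mul g h) l = mul g (mul h l)"
    and src_one [simp]: "src (one x) = x" and tgt_one [simp]: "tgt (one x) = x"
    and mul_one_right: "x = src g \<Longrightarrow> mul g (one x) = g" and mul_one_left: "x = tgt g \<Longrightarrow> mul (one x) g = g"
    and src_ginv [simp]: "src (ginv g) = tgt g" and tgt_ginv [simp]: "tgt (ginv g) = src g"
    and mul_ginv: "mul g (ginv g) = one (tgt g)" and ginv_mul: "mul (ginv g) g = one (src g)"
    and fin: "findim TYPE('e)"
    and dS_linear: "linear (dS g)" and dT_linear: "linear (dT g)"
    and d1_linear: "linear (d1 x)" and dI_linear: "linear (dI g)"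
    and Tm_linear: "src g = tgt h \<Longrightarrow> linear (\<lambda>p. Tm g h (fst p) (snd p))"
    and dS_surj: "surj (dS g)"
    and dS_d1 [simp]: "dS (one x) (d1 x y) = y" and dT_d1 [simp]: "dT (one x) (d1 x y) = y"
    and dS_dI [simp]: "dS (ginv g) (dI g v) = dT g v" and dT_dI [simp]: "dT (ginv g) (dI g v) = dS g v"
    and dS_Tm: "src g = tgt h \<Longrightarrow> dS g v = dT h w \<Longrightarrow> dS (mul g h) (Tm g h v w) = dS h w"
    and dT_Tm: "src g = tgt h \<Longrightarrow> dS g v = dT h w \<Longrightarrow> dT (mul g h) (Tm g h v w) = dT g v"
    and Tm_assoc: "src g = tgt h \<Longrightarrow> src h = tgt l \<Longrightarrow> dS g u = dT h v \<Longrightarrow> dS h v = dT l w \<Longrightarrow>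
      Tm (mul g h) l (Tm g h u v) w = Tm g (mul h l) u (Tm h l v w)"
    and Tm_one_right: "x = src g \<Longrightarrow> Tm g (one x) v (d1 x (dS g v)) = v"
    and Tm_one_left: "x = tgt g \<Longrightarrow> Tm (one x) g (d1 x (dT g v)) v = v"
    and Tm_dI_right: "Tm g (ginv g) v (dI g v) = d1 (tgt g) (dT g v)"
    and Tm_dI_left: "Tm (ginv g) g (dI g v) v = d1 (src g) (dS g v)"
begin

lemma linear_zero [simp]: "dS g 0 = 0" "dT g 0 = 0" "d1 x 0 = 0" "dI g 0 = 0"
  by (simp_all add: linear_0 dS_linear dT_linear d1_linear dI_linear)

lemma Tm_zero [simp]: "src g = tgt h \<Longrightarrow> Tm g h 0 0 = 0"
  using linear_0[OF Tm_linear] by (simp add: zero_prod_def)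

lemma Tm_add: "src g = tgt h \<Longrightarrow> Tm g h (v + v') (w + w') = Tm g h v w + Tm g h v' w'"
  using linear_add[OF Tm_linear, of g h "(v, w)" "(v', w')"] by simp

lemma ginv_one [simp]: "ginv (one x) = one x"
  using mul_one_right[of x "ginv (one x)"] ginv_mul[of "one x"] by simp

text \<open>The projection onto A along the tangent space of the units, in closed form;
  \<open>pr_A_eq\<close> identifies it with \<open>pr_A\<close>.\<close>

definition prA :: "'m \<Rightarrow> 'e \<Rightarrow> 'e" where
  "prA x v = v - d1 x (dS (one x) v)"

lemma prA_linear: "linear (prA x)"
  unfolding prA_def using linear_compose[OF dS_linear d1_linear]
  by (intro linear_compose_sub) (auto simp: o_def linear_ident)

lemma dS_prA [simp]: "dS (one x) (prA x v) = 0"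
  by (simp add: prA_def linear_diff[OF dS_linear])

lemma prA_d1 [simp]: "prA x (d1 x y) = 0"
  by (simp add: prA_def)

lemma prA_ident: "dS (one x) a = 0 \<Longrightarrow> prA x a = a"
  by (simp add: prA_def)

lemma dS_dI_one [simp]: "dS (one x) (dI (one x) v) = dT (one x) v"
  and dT_dI_one [simp]: "dT (one x) (dI (one x) v) = dS (one x) v"
  using dS_dI[of "one x" v] dT_dI[of "one x" v] by simp_all

lemma Tm_one_vertical: "x = src g \<Longrightarrow> dS g a = 0 \<Longrightarrow> Tm g (one x) a 0 = a"
  using Tm_one_right[of x g a] by simp

text \<open>Split \<open>v\<close> into its vertical part, multiplied with 0, and its unit part,
  multiplied with \<open>w\<close>; both products are given by the unit laws.\<close>

lemma Tm_one_one:
  assumes "dS (one x) v = dT (one x) w"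
  shows "Tm (one x) (one x) v w = v + w - d1 x (dS (one x) v)"
proof -
  have "Tm (one x) (one x) (prA x v + d1 x (dT (one x) w)) (0 + w) = prA x v + w"
    by (subst Tm_add) (simp_all add: Tm_one_left Tm_one_vertical)
  then show ?thesis
    using assms by (simp add: prA_def algebra_simps)
qed

text \<open>Inserting the explicit product \<open>Tm_one_one\<close> into \<open>Tm_dI_right\<close>
  at a unit leaves an equation that can be solved for the inverse.\<close>

lemma dI_one: "dI (one x) w = d1 x (dS (one x) w) + d1 x (dT (one x) w) - w"
  using Tm_dI_right[of "one x" w] Tm_one_one[of x w "dI (one x) w"] by (simp add: algebra_simps)

lemma dI_prA: "dI (one x) (prA x w) = d1 x (dT (one x) w) - w"
  unfolding dI_one[of x "prA x w"] dS_prA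
  by (simp add: prA_def linear_diff[OF dT_linear] linear_diff[OF d1_linear])

section \<open>Source, target and product of covectors\<close>

text \<open>The transpose of right translation after projection onto A. Evaluating a multivector at
  the unit on such covectors is evaluating its right translate.\<close>

definition cotangent_tgt :: "'g \<Rightarrow> ('e \<Rightarrow>\<^sub>L real) \<Rightarrow> 'e \<Rightarrow>\<^sub>L real" where
  "cotangent_tgt g \<xi> = \<xi> o\<^sub>L Blinfun (\<lambda>v. Tm (one (tgt g)) g (prA (tgt g) v) 0)"

text \<open>The transpose of left translation after inversion; the minus sign is the one in the
  definition of left translates.\<close>

definition cotangent_src :: "'g \<Rightarrow> ('e \<Rightarrow>\<^sub>L real) \<Rightarrow> 'e \<Rightarrow>\<^sub>L real" where
  "cotangent_src g \<xi> = \<xi> o\<^sub>L Blinfun (\<lambda>v. - Tm g (one (src g)) 0 (dI (one (src g)) (prA (src g) v)))"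

lemma right_translation_linear: "linear (\<lambda>v. Tm (one (tgt g)) g (prA (tgt g) v) 0)"
proof -
  have "linear (\<lambda>v. (prA (tgt g) v, 0::'e))"
    using prA_linear[of "tgt g"] by (auto intro!: linearI simp: linear_add linear_scale)
  from linear_compose[OF this Tm_linear[of "one (tgt g)" g]] show ?thesis
    by (simp add: o_def)
qed

lemma left_translation_linear: "linear (\<lambda>v. - Tm g (one (src g)) 0 (dI (one (src g)) (prA (src g) v)))"
proof -
  have "linear (\<lambda>v. - (0::'e, dI (one (src g)) (prA (src g) v)))"
    using prA_linear[of "src g"] dI_linear[of "one (src g)"] by (auto intro!: linearI simp: linear_add linear_scale)
  from linear_compose[OF this Tm_linear[of g "one (src g)"]] show ?thesis
    using linear_neg[OF Tm_linear[of g "one (src g)"], of "(0, _)"] by (simp add: o_def)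
qed

lemma cotangent_tgt_apply: "blinfun_apply (cotangent_tgt g \<xi>) v = blinfun_apply \<xi> (Tm (one (tgt g)) g (prA (tgt g) v) 0)"
  by (simp add: cotangent_tgt_def bounded_linear_Blinfun_apply[OF findim_linear_bounded[OF fin right_translation_linear]])

lemma cotangent_src_apply:
  "blinfun_apply (cotangent_src g \<xi>) v = - blinfun_apply \<xi> (Tm g (one (src g)) 0 (dI (one (src g)) (prA (src g) v)))"
  by (simp add: cotangent_src_def bounded_linear_Blinfun_apply[OF findim_linear_bounded[OF fin left_translation_linear]]
      blinfun.minus_right)

text \<open>The graph of the partial product of the cotangent groupoid \<open>T\<^sup>*G\<close>, a groupoid over \<open>A\<^sup>*\<close>: the
  covector \<open>\<gamma>\<close> at \<open>gh\<close> is the product of \<open>\<alpha>\<close> at \<open>g\<close> and \<open>\<beta>\<close> at \<open>h\<close>. An element of \<open>A\<^sup>*\<close> is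
  represented by the unit covector, i.e. by its extension by zero on the tangent space of the units;
  with this convention \<open>cotangent_src\<close> and \<open>cotangent_tgt\<close> are the source and the target.\<close>

definition cotangent_product :: "'g \<Rightarrow> 'g \<Rightarrow> ('e \<Rightarrow>\<^sub>L real) \<Rightarrow> ('e \<Rightarrow>\<^sub>L real) \<Rightarrow> ('e \<Rightarrow>\<^sub>L real) \<Rightarrow> bool" where
  "cotangent_product g h \<alpha> \<beta> \<gamma> \<longleftrightarrow> (\<forall>v w. dS g v = dT h w \<longrightarrow>
     blinfun_apply \<gamma> (Tm g h v w) = blinfun_apply \<alpha> v + blinfun_apply \<beta> w)"

lemma cotangent_productD: "cotangent_product g h \<alpha> \<beta> \<gamma> \<Longrightarrow> dS g v = dT h w \<Longrightarrow>
    blinfun_apply \<gamma> (Tm g h v w) = blinfun_apply \<alpha> v + blinfun_apply \<beta> w"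
  by (simp add: cotangent_product_def)

text \<open>The left unit law of the cotangent groupoid: the unit part of \<open>v\<close> acts
  trivially on \<open>w\<close>, and its vertical part contributes the target covector.\<close>

lemma cotangent_product_unit_left: "cotangent_product (one (tgt g)) g (cotangent_tgt g \<xi>) \<xi> \<xi>"
  unfolding cotangent_product_def
proof (intro allI impI)
  fix v w assume e: "dS (one (tgt g)) v = dT g w"
  let ?x = "tgt g"
  have "Tm (one ?x) g (prA ?x v + d1 ?x (dT g w)) (0 + w) = Tm (one ?x) g (prA ?x v) 0 + w"
    by (subst Tm_add) (simp_all add: Tm_one_left)
  then have "Tm (one ?x) g v w = Tm (one ?x) g (prA ?x v) 0 + w"
    using e by (simp add: prA_def)
  then show "blinfun_apply \<xi> (Tm (one ?x) g v w) = blinfun_apply (cotangent_tgt g \<xi>) v + blinfun_apply \<xi> w"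
    by (simp add: cotangent_tgt_apply blinfun.add_right)
qed

text \<open>The right unit law. By \<open>dI_prA\<close>, \<open>w\<close> is a unit vector minus
  \<open>dI\<close> of its vertical part, which accounts for the sign in
  \<open>cotangent_src\<close>.\<close>

lemma cotangent_product_unit_right: "cotangent_product g (one (src g)) \<xi> (cotangent_src g \<xi>) \<xi>"
  unfolding cotangent_product_def
proof (intro allI impI)
  fix v w assume e: "dS g v = dT (one (src g)) w"
  let ?x = "src g"
  have "Tm g (one ?x) (v + 0) (d1 ?x (dS g v) + - dI (one ?x) (prA ?x w)) =
      v + Tm g (one ?x) 0 (- dI (one ?x) (prA ?x w))"
    by (subst Tm_add) (simp_all add: Tm_one_right)
  moreover have "d1 ?x (dS g v) + - dI (one ?x) (prA ?x w) = w"
    by (simp add: dI_prA e)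
  moreover have "Tm g (one ?x) 0 (- z) = - Tm g (one ?x) 0 z" for z
    using linear_neg[OF Tm_linear[of g "one ?x"], of "(0, z)"] by simp
  ultimately show "blinfun_apply \<xi> (Tm g (one ?x) v w) = blinfun_apply \<xi> v + blinfun_apply (cotangent_src g \<xi>) w"
    by (simp add: cotangent_src_apply blinfun.diff_right)
qed

text \<open>Only composable covectors have a product. The relation is tested on the vectors 0 a^-1
  at \<open>g\<close> and a 0 at \<open>h\<close> with \<open>a\<close> vertical; they are
  composable and their product is 0 by associativity.\<close>

lemma cotangent_product_src_tgt:
  assumes gh: "src g = tgt h" and c: "cotangent_product g h \<alpha> \<beta> \<gamma>"
  shows "cotangent_src g \<alpha> = cotangent_tgt h \<beta>"
proof (rule blinfun_eqI)
  fix v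
  let ?x = "tgt h"
  define a where "a = prA ?x v"
  let ?b = "dI (one ?x) a"
  have a: "dS (one ?x) a = 0"
    by (simp add: a_def)
  have m: "mul (one ?x) h = h" "mul g (one ?x) = g" "mul (one ?x) (one ?x) = one ?x"
    using gh by (simp_all add: mul_one_left mul_one_right)
  have ba: "Tm (one ?x) (one ?x) ?b a = 0"
    using Tm_dI_left[of "one ?x" a] a by simp
  have S: "dS g (Tm g (one ?x) 0 ?b) = dT (one ?x) a"
    using dS_Tm[of g "one ?x" 0 ?b] gh a m by simp
  have T: "dT h (Tm (one ?x) h a 0) = dT (one ?x) a"
    using dT_Tm[of "one ?x" h a 0] a m by simp
  have "Tm g h (Tm g (one ?x) 0 ?b) (Tm (one ?x) h a 0) = Tm g h 0 (Tm (one ?x) h ?b (Tm (one ?x) h a 0))"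
    using Tm_assoc[of g "one ?x" h 0 ?b "Tm (one ?x) h a 0"] gh a m T by simp
  also have "Tm (one ?x) h ?b (Tm (one ?x) h a 0) = 0"
    using Tm_assoc[of "one ?x" "one ?x" h ?b a 0] a m ba by simp
  finally have "Tm g h (Tm g (one ?x) 0 ?b) (Tm (one ?x) h a 0) = 0"
    using gh by simp
  then have "0 = blinfun_apply \<alpha> (Tm g (one ?x) 0 ?b) + blinfun_apply \<beta> (Tm (one ?x) h a 0)"
    using cotangent_productD[OF c, of "Tm g (one ?x) 0 ?b" "Tm (one ?x) h a 0"] S T by simp
  then show "blinfun_apply (cotangent_src g \<alpha>) v = blinfun_apply (cotangent_tgt h \<beta>) v"
    using gh by (simp add: cotangent_src_apply cotangent_tgt_apply a_def)
qed

text \<open>For vertical \<open>a\<close>, associativity rewrites its translate by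
  \<open>mul g h\<close> as the product of its translate by \<open>g\<close> with the zero vector at
  \<open>h\<close>.\<close>

lemma cotangent_product_tgt:
  assumes gh: "src g = tgt h" and c: "cotangent_product g h \<alpha> \<beta> \<gamma>"
  shows "cotangent_tgt (mul g h) \<gamma> = cotangent_tgt g \<alpha>"
proof (rule blinfun_eqI)
  fix v
  let ?x = "tgt g"
  let ?a = "prA ?x v"
  have m: "mul (one ?x) g = g"
    by (simp add: mul_one_left)
  have S: "dS g (Tm (one ?x) g ?a 0) = 0"
    using dS_Tm[of "one ?x" g ?a 0] m by simp
  have "Tm (one ?x) (mul g h) ?a 0 = Tm g h (Tm (one ?x) g ?a 0) 0"
    using Tm_assoc[of "one ?x" g h ?a 0 0] gh m by simp
  then show "blinfun_apply (cotangent_tgt (mul g h) \<gamma>) v = blinfun_apply (cotangent_tgt g \<alpha>) v"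
    using cotangent_productD[OF c, of "Tm (one ?x) g ?a 0" 0] S gh by (simp add: cotangent_tgt_apply tgt_mul)
qed

lemma cotangent_product_src:
  assumes gh: "src g = tgt h" and c: "cotangent_product g h \<alpha> \<beta> \<gamma>"
  shows "cotangent_src (mul g h) \<gamma> = cotangent_src h \<beta>"
proof (rule blinfun_eqI)
  fix v
  let ?x = "src h"
  let ?b = "dI (one ?x) (prA ?x v)"
  have m: "mul h (one ?x) = h"
    by (simp add: mul_one_right)
  have T: "dT h (Tm h (one ?x) 0 ?b) = 0"
    using dT_Tm[of h "one ?x" 0 ?b] m by simp
  have "Tm (mul g h) (one ?x) 0 ?b = Tm g h 0 (Tm h (one ?x) 0 ?b)"
    using Tm_assoc[of g h "one ?x" 0 0 ?b] gh m by simp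
  then show "blinfun_apply (cotangent_src (mul g h) \<gamma>) v = blinfun_apply (cotangent_src h \<beta>) v"
    using cotangent_productD[OF c, of 0 "Tm h (one ?x) 0 ?b"] T gh by (simp add: cotangent_src_apply src_mul)
qed

definition unit_covector :: "'m \<Rightarrow> ('e \<Rightarrow>\<^sub>L real) \<Rightarrow> bool" where
  "unit_covector x \<epsilon> \<longleftrightarrow> (\<forall>y. blinfun_apply \<epsilon> (d1 x y) = 0)"

lemma unit_covector_tt: "unit_covector (tgt g) (cotangent_tgt g \<xi>)"
  by (simp add: unit_covector_def cotangent_tgt_apply)

lemma unit_covector_ss: "unit_covector (src g) (cotangent_src g \<xi>)"
  by (simp add: unit_covector_def cotangent_src_apply)

lemma cotangent_tgt_unit: "unit_covector x \<epsilon> \<Longrightarrow> cotangent_tgt (one x) \<epsilon> = \<epsilon>"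
  by (rule blinfun_eqI) (simp add: cotangent_tgt_apply Tm_one_vertical unit_covector_def prA_def[of x] blinfun.diff_right
      linear_diff[OF dS_linear])

lemma cotangent_product_unit: "unit_covector x \<epsilon> \<Longrightarrow> cotangent_product (one x) (one x) \<epsilon> \<epsilon> \<epsilon>"
  using cotangent_product_unit_left[of "one x" \<epsilon>] by (simp add: cotangent_tgt_unit)

lemma cotangent_src_unit: "unit_covector x \<epsilon> \<Longrightarrow> cotangent_src (one x) \<epsilon> = \<epsilon>"
  using cotangent_product_src_tgt[OF _ cotangent_product_unit] by (simp add: cotangent_tgt_unit)

section \<open>Multiplicative and affine functions of covectors\<close>

definition right_trans :: "('g, 'e) covector_function \<Rightarrow> ('g, 'e) covector_function" where
  "right_trans \<Lambda> g \<xi> = \<Lambda> (one (tgt g)) (\<lambda>i. cotangent_tgt g (\<xi> i))"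

definition left_trans :: "('g, 'e) covector_function \<Rightarrow> ('g, 'e) covector_function" where
  "left_trans \<Lambda> g \<xi> = \<Lambda> (one (src g)) (\<lambda>i. cotangent_src g (\<xi> i))"

text \<open>Relations between covectors are available for indices below \<open>k\<close> only; this
  property lets them be substituted into \<open>\<Lambda>\<close>.\<close>

definition local_field :: "nat \<Rightarrow> ('g, 'e) covector_function \<Rightarrow> bool" where
  "local_field k \<Lambda> \<longleftrightarrow> (\<forall>g \<xi> \<eta>. (\<forall>i<k. \<xi> i = \<eta> i) \<longrightarrow> \<Lambda> g \<xi> = \<Lambda> g \<eta>)"

definition mult_field :: "nat \<Rightarrow> ('g, 'e) covector_function \<Rightarrow> bool" where
  "mult_field k \<Lambda> \<longleftrightarrow> (\<forall>g h \<alpha> \<beta> \<gamma>. src g = tgt h \<longrightarrow> (\<forall>i<k. cotangent_product g h (\<alpha> i) (\<beta> i) (\<gamma> i)) \<longrightarrow>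
     \<Lambda> (mul g h) \<gamma> = \<Lambda> g \<alpha> + \<Lambda> h \<beta>)"

definition pair_field :: "nat \<Rightarrow> ('g, 'e) covector_function \<Rightarrow> bool" where
  "pair_field k \<Lambda> \<longleftrightarrow> (\<forall>g h \<alpha> \<beta> \<gamma>. src g = tgt h \<longrightarrow> (\<forall>i<k. cotangent_product g h (\<alpha> i) (\<beta> i) (\<gamma> i)) \<longrightarrow>
     \<Lambda> (mul g h) \<gamma> = \<Lambda> g \<alpha> + \<Lambda> h \<beta> - left_trans \<Lambda> g \<alpha>)"

text \<open>The relation \<delta> = \<beta> \<alpha>^-1 \<gamma> in the cotangent groupoid:
  conormality to the four-term graph after negating the covectors at \<open>h\<close> and
  \<open>l\<close>.\<close>

definition quad :: "'g \<Rightarrow> 'g \<Rightarrow> 'g \<Rightarrow> ('e \<Rightarrow>\<^sub>L real) \<Rightarrow> ('e \<Rightarrow>\<^sub>L real) \<Rightarrow> ('e \<Rightarrow>\<^sub>L real) \<Rightarrow> ('e \<Rightarrow>\<^sub>L real) \<Rightarrow> bool" where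
  "quad g h l \<alpha> \<beta> \<gamma> \<delta> \<longleftrightarrow> (\<forall>u v w. dS g u = dS h v \<longrightarrow> dT g u = dT l w \<longrightarrow>
     blinfun_apply \<delta> (Tm (mul h (ginv g)) l (Tm h (ginv g) v (dI g u)) w) =
       blinfun_apply \<beta> v - blinfun_apply \<alpha> u + blinfun_apply \<gamma> w)"

definition affine_field :: "nat \<Rightarrow> ('g, 'e) covector_function \<Rightarrow> bool" where
  "affine_field k \<Lambda> \<longleftrightarrow> (\<forall>g h l \<alpha> \<beta> \<gamma> \<delta>. src g = src h \<longrightarrow> tgt g = tgt l \<longrightarrow>
     (\<forall>i<k. quad g h l (\<alpha> i) (\<beta> i) (\<gamma> i) (\<delta> i)) \<longrightarrow>
     \<Lambda> (mul (mul h (ginv g)) l) \<delta> = \<Lambda> h \<beta> - \<Lambda> g \<alpha> + \<Lambda> l \<gamma>)"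

text \<open>A product is a three-term expression with a unit in the middle, here the unit covector
  at the source of \<open>\<alpha>\<close>.\<close>

lemma quad_unit:
  assumes gh: "src g = tgt h" and c: "cotangent_product g h \<alpha> \<beta> \<gamma>"
  shows "quad (one (src g)) g h (cotangent_src g \<alpha>) \<alpha> \<beta> \<gamma>"
  unfolding quad_def
proof (intro allI impI)
  fix u v w
  let ?x = "src g"
  assume S: "dS (one ?x) u = dS g v" and T: "dT (one ?x) u = dT h w"
  have m: "mul g (one ?x) = g" "mul (one ?x) (one ?x) = one ?x"
    by (simp_all add: mul_one_right)
  \<comment> \<open>With p = v u^-1 one has p u = v, so the right unit law computes
    \<open>\<alpha>\<close> on \<open>p\<close>.\<close>
  define p where "p = Tm g (one ?x) v (dI (one ?x) u)"
  have Sp: "dS g p = dT (one ?x) u"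
    using dS_Tm[of g "one ?x" v "dI (one ?x) u"] S m by (simp add: p_def)
  have "Tm g (one ?x) p u = Tm g (one ?x) v (Tm (one ?x) (one ?x) (dI (one ?x) u) u)"
    using Tm_assoc[of g "one ?x" "one ?x" v "dI (one ?x) u" u] S m by (simp add: p_def)
  also have "Tm (one ?x) (one ?x) (dI (one ?x) u) u = d1 ?x (dS g v)"
    using Tm_dI_left[of "one ?x" u] S by simp
  finally have "Tm g (one ?x) p u = v"
    by (simp add: Tm_one_right)
  then have "blinfun_apply \<alpha> p = blinfun_apply \<alpha> v - blinfun_apply (cotangent_src g \<alpha>) u"
    using cotangent_productD[OF cotangent_product_unit_right, of g p u \<alpha>] Sp by simp
  then show "blinfun_apply \<gamma> (Tm (mul g (ginv (one ?x))) h (Tm g (ginv (one ?x)) v (dI (one ?x) u)) w) =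
      blinfun_apply \<alpha> v - blinfun_apply (cotangent_src g \<alpha>) u + blinfun_apply \<beta> w"
    using cotangent_productD[OF c, of p w] Sp T m by (simp add: p_def)
qed

text \<open>The covector \<kappa> = \<alpha>^-1 \<gamma> is recovered from the relation: its value
  at \<open>z\<close> is \<gamma>(u z) - \<alpha>(u) for any \<open>u\<close> composable with
  \<open>z\<close>.\<close>

lemma quad_factor:
  assumes gh: "src g = src h" and gl: "tgt g = tgt l" and q: "quad g h l \<alpha> \<beta> \<gamma> \<delta>"
  shows "\<exists>\<kappa>. cotangent_product g (mul (ginv g) l) \<alpha> \<kappa> \<gamma> \<and> cotangent_product h (mul (ginv g) l) \<beta> \<kappa> \<delta>"
proof -
  let ?m = "mul (ginv g) l"
  have tm: "tgt ?m = src g"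
    using gl by (simp add: tgt_mul)
  have gm: "mul g ?m = l"
    using mul_assoc[of g "ginv g" l] gl by (simp add: mul_ginv mul_one_left)
  \<comment> \<open>A linear section of \<open>dS g\<close> selects a vector composable with
    \<open>z\<close>, linearly in \<open>z\<close>, so that \<open>\<kappa>\<close> becomes
    linear.\<close>
  obtain K where K: "linear K" "dS g \<circ> K = id"
    using linear_surjective_right_inverse[OF dS_linear dS_surj] by blast
  have SK: "dS g (K y) = y" for y
    using fun_cong[OF K(2), of y] by simp
  \<comment> \<open>The cancellation (v u^-1)(u z) = v z in the tangent groupoid.\<close>
  have cancel: "Tm (mul h (ginv g)) l (Tm h (ginv g) v (dI g u)) (Tm g ?m u z) = Tm h ?m v z"
    if "dS g u = dT ?m z" "dS h v = dS g u" for u v z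
  proof -
    have Tl: "dT l (Tm g ?m u z) = dT g u"
      using dT_Tm[of g ?m u z] that tm gm by simp
    have "Tm (ginv g) l (dI g u) (Tm g ?m u z) = Tm (mul (ginv g) g) ?m (Tm (ginv g) g (dI g u) u) z"
      using Tm_assoc[of "ginv g" g ?m "dI g u" u z] that tm gm by simp
    also have "\<dots> = z"
      using that tm by (simp add: ginv_mul Tm_dI_left Tm_one_left)
    finally show ?thesis
      using Tm_assoc[of h "ginv g" l v "dI g u" "Tm g ?m u z"] that gh gl Tl by simp
  qed
  \<comment> \<open>The relation at \<open>v = 0\<close>. It makes \<open>\<kappa>\<close>
    independent of the chosen \<open>u\<close>: adding a vertical vector changes \<gamma>(u z) and
    \<alpha>(u) by the same amount.\<close>
  have vert: "blinfun_apply \<gamma> (Tm g ?m u 0) = blinfun_apply \<alpha> u" if "dS g u = 0" for u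
  proof -
    have "dT l (Tm g ?m u 0) = dT g u"
      using dT_Tm[of g ?m u 0] that tm gm by simp
    then show ?thesis
      using q[unfolded quad_def, rule_format, of u 0 "Tm g ?m u 0"] cancel[of u 0 0] that gh tm by simp
  qed
  define \<kappa> where "\<kappa> z = blinfun_apply \<gamma> (Tm g ?m (K (dT ?m z)) z) - blinfun_apply \<alpha> (K (dT ?m z))" for z
  have linK: "linear (\<lambda>z. K (dT ?m z))"
    using linear_compose[OF dT_linear K(1)] by (simp add: o_def)
  have "linear (\<lambda>z. (K (dT ?m z), z))"
    using linear_add[OF linK] linear_scale[OF linK] by (auto intro!: linearI)
  from linear_compose[OF this Tm_linear[of g ?m]] have linT: "linear (\<lambda>z. Tm g ?m (K (dT ?m z)) z)"
    using tm by (simp add: o_def)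
  have lin: "linear \<kappa>"
    unfolding \<kappa>_def
    using linear_add[OF linK] linear_scale[OF linK] linear_add[OF linT] linear_scale[OF linT]
    by (auto intro!: linearI simp: blinfun.add_right blinfun.scaleR_right algebra_simps)
  have ap: "blinfun_apply (Blinfun \<kappa>) = \<kappa>"
    by (rule bounded_linear_Blinfun_apply[OF findim_linear_bounded[OF fin lin]])
  have "blinfun_apply \<gamma> (Tm g ?m u z) = blinfun_apply \<alpha> u + \<kappa> z" if "dS g u = dT ?m z" for u z
  proof -
    let ?u = "u - K (dT ?m z)"
    have "Tm g ?m (K (dT ?m z) + ?u) (z + 0) = Tm g ?m (K (dT ?m z)) z + Tm g ?m ?u 0"
      using tm by (intro Tm_add) simp
    moreover have "dS g ?u = 0"
      using that by (simp add: linear_diff[OF dS_linear] SK)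
    ultimately show ?thesis
      using vert[of ?u] by (simp add: \<kappa>_def blinfun.add_right blinfun.diff_right)
  qed
  then have 1: "cotangent_product g ?m \<alpha> (Blinfun \<kappa>) \<gamma>"
    by (simp add: cotangent_product_def ap)
  have "blinfun_apply \<delta> (Tm h ?m v z) = blinfun_apply \<beta> v + \<kappa> z" if "dS h v = dT ?m z" for v z
  proof -
    let ?u = "K (dT ?m z)"
    have "dT l (Tm g ?m ?u z) = dT g ?u"
      using dT_Tm[of g ?m ?u z] tm gm by (simp add: SK)
    then show ?thesis
      using q[unfolded quad_def, rule_format, of ?u v "Tm g ?m ?u z"] cancel[of ?u z v] that
      by (simp add: SK \<kappa>_def)
  qed
  then have "cotangent_product h ?m \<beta> (Blinfun \<kappa>) \<delta>"
    by (simp add: cotangent_product_def ap)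
  with 1 show ?thesis by blast
qed

lemma local_fieldD: "local_field k \<Lambda> \<Longrightarrow> (\<And>i. i < k \<Longrightarrow> \<xi> i = \<eta> i) \<Longrightarrow> \<Lambda> g \<xi> = \<Lambda> g \<eta>"
  by (simp add: local_field_def)

lemma
  assumes loc: "local_field k \<Lambda>" and gh: "src g = tgt h" and c: "\<And>i. i < k \<Longrightarrow> cotangent_product g h (\<alpha> i) (\<beta> i) (\<gamma> i)"
  shows left_trans_eq_right_trans: "left_trans \<Lambda> g \<alpha> = right_trans \<Lambda> h \<beta>"
    and left_trans_mul: "left_trans \<Lambda> (mul g h) \<gamma> = left_trans \<Lambda> h \<beta>"
    and right_trans_mul: "right_trans \<Lambda> (mul g h) \<gamma> = right_trans \<Lambda> g \<alpha>"
  unfolding left_trans_def right_trans_def using gh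
  by (auto simp: src_mul tgt_mul intro!: local_fieldD[OF loc] cotangent_product_src_tgt[OF gh] cotangent_product_src[OF gh] cotangent_product_tgt[OF gh] c)

lemma pair_fieldD: "pair_field k \<Lambda> \<Longrightarrow> src g = tgt h \<Longrightarrow> (\<And>i. i < k \<Longrightarrow> cotangent_product g h (\<alpha> i) (\<beta> i) (\<gamma> i)) \<Longrightarrow>
    \<Lambda> (mul g h) \<gamma> = \<Lambda> g \<alpha> + \<Lambda> h \<beta> - left_trans \<Lambda> g \<alpha>"
  by (simp add: pair_field_def)

text \<open>One direction puts a unit in the middle. For the other, \<gamma> = \<alpha> \<kappa> and
  \<delta> = \<beta> \<kappa> give two pair relations whose correction terms are both the right
  translate at \<kappa>; they cancel in the difference.\<close>

lemma affine_iff_pair: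
  assumes loc: "local_field k \<Lambda>"
  shows "affine_field k \<Lambda> \<longleftrightarrow> pair_field k \<Lambda>"
proof
  assume a: "affine_field k \<Lambda>"
  show "pair_field k \<Lambda>"
    unfolding pair_field_def
  proof (intro allI impI)
    fix g h \<alpha> \<beta> \<gamma> assume gh: "src g = tgt h" and c: "\<forall>i<k. cotangent_product g h (\<alpha> i) (\<beta> i) (\<gamma> i)"
    have q: "quad (one (src g)) g h (cotangent_src g (\<alpha> i)) (\<alpha> i) (\<beta> i) (\<gamma> i)" if "i < k" for i
      using quad_unit[OF gh] c that by blast
    have "\<Lambda> (mul (mul g (ginv (one (src g)))) h) \<gamma> = \<Lambda> g \<alpha> - \<Lambda> (one (src g)) (\<lambda>i. cotangent_src g (\<alpha> i)) + \<Lambda> h \<beta>"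
      by (rule a[unfolded affine_field_def, rule_format]) (simp_all add: gh q[unfolded gh])
    then show "\<Lambda> (mul g h) \<gamma> = \<Lambda> g \<alpha> + \<Lambda> h \<beta> - left_trans \<Lambda> g \<alpha>"
      by (simp add: mul_one_right left_trans_def)
  qed
next
  assume p: "pair_field k \<Lambda>"
  show "affine_field k \<Lambda>"
    unfolding affine_field_def
  proof (intro allI impI)
    fix g h l \<alpha> \<beta> \<gamma> \<delta>
    assume gh: "src g = src h" and gl: "tgt g = tgt l" and q: "\<forall>i<k. quad g h l (\<alpha> i) (\<beta> i) (\<gamma> i) (\<delta> i)"
    let ?m = "mul (ginv g) l"
    have tm: "tgt ?m = src g"
      using gl by (simp add: tgt_mul)
    have gm: "mul g ?m = l" "mul (mul h (ginv g)) l = mul h ?m"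
      using mul_assoc[of g "ginv g" l] mul_assoc[of h "ginv g" l] gh gl by (simp_all add: mul_ginv mul_one_left)
    have "\<forall>i. \<exists>\<kappa>. i < k \<longrightarrow> cotangent_product g ?m (\<alpha> i) \<kappa> (\<gamma> i) \<and> cotangent_product h ?m (\<beta> i) \<kappa> (\<delta> i)"
      using quad_factor[OF gh gl] q by blast
    then obtain \<kappa> where k: "\<And>i. i < k \<Longrightarrow> cotangent_product g ?m (\<alpha> i) (\<kappa> i) (\<gamma> i)" "\<And>i. i < k \<Longrightarrow> cotangent_product h ?m (\<beta> i) (\<kappa> i) (\<delta> i)"
      by metis
    have "\<Lambda> l \<gamma> = \<Lambda> g \<alpha> + \<Lambda> ?m \<kappa> - right_trans \<Lambda> ?m \<kappa>"
      using pair_fieldD[OF p _ k(1)] left_trans_eq_right_trans[OF loc _ k(1)] tm gm by simp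
    moreover have "\<Lambda> (mul h ?m) \<delta> = \<Lambda> h \<beta> + \<Lambda> ?m \<kappa> - right_trans \<Lambda> ?m \<kappa>"
      using pair_fieldD[OF p _ k(2)] left_trans_eq_right_trans[OF loc _ k(2)] tm gm gh by simp
    ultimately show "\<Lambda> (mul (mul h (ginv g)) l) \<delta> = \<Lambda> h \<beta> - \<Lambda> g \<alpha> + \<Lambda> l \<gamma>"
      by (simp add: gm)
  qed
qed

text \<open>A unit covector is its own source and target, so an inner translation is invisible at
  units and the outer one decides.\<close>

lemma translates_idempotent:
  "right_trans (right_trans \<Lambda>) = right_trans \<Lambda>" "left_trans (left_trans \<Lambda>) = left_trans \<Lambda>" "right_trans (left_trans \<Lambda>) = right_trans \<Lambda>" "left_trans (right_trans \<Lambda>) = left_trans \<Lambda>"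
  by (simp_all add: fun_eq_iff right_trans_def left_trans_def cotangent_tgt_unit[OF unit_covector_tt] cotangent_tgt_unit[OF unit_covector_ss]
      cotangent_src_unit[OF unit_covector_tt] cotangent_src_unit[OF unit_covector_ss])

lemma right_trans_add: "right_trans (\<Lambda> + \<Lambda>') = right_trans \<Lambda> + right_trans \<Lambda>'" and left_trans_add: "left_trans (\<Lambda> + \<Lambda>') = left_trans \<Lambda> + left_trans \<Lambda>'"
  and right_trans_diff: "right_trans (\<Lambda> - \<Lambda>') = right_trans \<Lambda> - right_trans \<Lambda>'" and left_trans_diff: "left_trans (\<Lambda> - \<Lambda>') = left_trans \<Lambda> - left_trans \<Lambda>'"
  and right_trans_scaleR: "right_trans (r *\<^sub>R \<Lambda>) = r *\<^sub>R right_trans \<Lambda>" and left_trans_scaleR: "left_trans (r *\<^sub>R \<Lambda>) = r *\<^sub>R left_trans \<Lambda>"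
  by (simp_all add: fun_eq_iff right_trans_def left_trans_def scaleR_fun_def)

text \<open>A unit covector is its own square, so the value equals twice itself.\<close>

lemma mult_units:
  assumes "mult_field k \<Lambda>" "\<And>i. i < k \<Longrightarrow> unit_covector x (\<epsilon> i)"
  shows "\<Lambda> (one x) \<epsilon> = 0"
  using assms(1)[unfolded mult_field_def, rule_format, of "one x" "one x" \<epsilon> \<epsilon> \<epsilon>] assms(2)
  by (simp add: cotangent_product_unit mul_one_left)

lemma mult_translates:
  assumes "mult_field k \<Lambda>"
  shows "right_trans \<Lambda> = 0" "left_trans \<Lambda> = 0"
  by (auto simp: fun_eq_iff right_trans_def left_trans_def intro!: mult_units[OF assms] unit_covector_tt unit_covector_ss)

lemma mult_imp_pair: "mult_field k \<Lambda> \<Longrightarrow> pair_field k \<Lambda>"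
  using mult_translates[of k \<Lambda>] by (simp add: mult_field_def pair_field_def)

text \<open>The correction term at the first factor equals the right translate at the second, while
  the right translate of the product is that of the first factor; subtracting leaves an additive
  function.\<close>

lemma pair_diff_right_trans:
  assumes "local_field k \<Lambda>" "pair_field k \<Lambda>"
  shows "mult_field k (\<Lambda> - right_trans \<Lambda>)"
  unfolding mult_field_def
proof (intro allI impI)
  fix g h \<alpha> \<beta> \<gamma> assume gh: "src g = tgt h" and "\<forall>i<k. cotangent_product g h (\<alpha> i) (\<beta> i) (\<gamma> i)"
  then have c: "\<And>i. i < k \<Longrightarrow> cotangent_product g h (\<alpha> i) (\<beta> i) (\<gamma> i)" by blast
  show "(\<Lambda> - right_trans \<Lambda>) (mul g h) \<gamma> = (\<Lambda> - right_trans \<Lambda>) g \<alpha> + (\<Lambda> - right_trans \<Lambda>) h \<beta>"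
    using pair_fieldD[OF assms(2) gh c] left_trans_eq_right_trans[OF assms(1) gh c] right_trans_mul[OF assms(1) gh c] by simp
qed

lemma pair_diff_left_trans:
  assumes "local_field k \<Lambda>" "pair_field k \<Lambda>"
  shows "mult_field k (\<Lambda> - left_trans \<Lambda>)"
  unfolding mult_field_def
proof (intro allI impI)
  fix g h \<alpha> \<beta> \<gamma> assume gh: "src g = tgt h" and "\<forall>i<k. cotangent_product g h (\<alpha> i) (\<beta> i) (\<gamma> i)"
  then have c: "\<And>i. i < k \<Longrightarrow> cotangent_product g h (\<alpha> i) (\<beta> i) (\<gamma> i)" by blast
  show "(\<Lambda> - left_trans \<Lambda>) (mul g h) \<gamma> = (\<Lambda> - left_trans \<Lambda>) g \<alpha> + (\<Lambda> - left_trans \<Lambda>) h \<beta>"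
    using pair_fieldD[OF assms(2) gh c] left_trans_mul[OF assms(1) gh c] by simp
qed

lemma pair_left_trans:
  assumes "local_field k \<Lambda>"
  shows "pair_field k (left_trans \<Lambda>)"
  unfolding pair_field_def translates_idempotent
proof (intro allI impI)
  fix g h \<alpha> \<beta> \<gamma> assume gh: "src g = tgt h" and "\<forall>i<k. cotangent_product g h (\<alpha> i) (\<beta> i) (\<gamma> i)"
  then have c: "\<And>i. i < k \<Longrightarrow> cotangent_product g h (\<alpha> i) (\<beta> i) (\<gamma> i)" by blast
  show "left_trans \<Lambda> (mul g h) \<gamma> = left_trans \<Lambda> g \<alpha> + left_trans \<Lambda> h \<beta> - left_trans \<Lambda> g \<alpha>"
    using left_trans_mul[OF assms gh c] by simp
qed

lemma pair_right_trans:
  assumes "local_field k \<Lambda>"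
  shows "pair_field k (right_trans \<Lambda>)"
  unfolding pair_field_def translates_idempotent
proof (intro allI impI)
  fix g h \<alpha> \<beta> \<gamma> assume gh: "src g = tgt h" and "\<forall>i<k. cotangent_product g h (\<alpha> i) (\<beta> i) (\<gamma> i)"
  then have c: "\<And>i. i < k \<Longrightarrow> cotangent_product g h (\<alpha> i) (\<beta> i) (\<gamma> i)" by blast
  show "right_trans \<Lambda> (mul g h) \<gamma> = right_trans \<Lambda> g \<alpha> + right_trans \<Lambda> h \<beta> - left_trans \<Lambda> g \<alpha>"
    using right_trans_mul[OF assms gh c] left_trans_eq_right_trans[OF assms gh c] by simp
qed

lemma pair_add: "pair_field k \<Lambda> \<Longrightarrow> pair_field k \<Lambda>' \<Longrightarrow> pair_field k (\<Lambda> + \<Lambda>')"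
  unfolding pair_field_def left_trans_add by simp

lemma pair_scaleR: "pair_field k \<Lambda> \<Longrightarrow> pair_field k (r *\<^sub>R \<Lambda>)"
  unfolding pair_field_def left_trans_scaleR by (auto simp: scaleR_fun_def distrib_left[symmetric] right_diff_distrib[symmetric])

lemma mult_add: "mult_field k \<Lambda> \<Longrightarrow> mult_field k \<Lambda>' \<Longrightarrow> mult_field k (\<Lambda> + \<Lambda>')"
  unfolding mult_field_def by simp

lemma mult_scaleR: "mult_field k \<Lambda> \<Longrightarrow> mult_field k (r *\<^sub>R \<Lambda>)"
  unfolding mult_field_def by (auto simp: scaleR_fun_def distrib_left[symmetric])

end

section \<open>The tangent groupoid of a Lie groupoid\<close>

locale lie =
  fixes G :: "('g::topological_space, 'e::banach, 'm::topological_space, 'f::banach) groupoid"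
  assumes lie: "lie_groupoid G"
begin

abbreviation "A \<equiv> Arr G"
abbreviation "M \<equiv> Obj G"
abbreviation "dS \<equiv> tangent_map A M (src G)"
abbreviation "dT \<equiv> tangent_map A M (tgt G)"
abbreviation "d1 \<equiv> tangent_map M A (one G)"
abbreviation "dI \<equiv> tangent_map A A (ginv G)"

lemma groupoid_laws:
  "src G g = tgt G h \<Longrightarrow> src G (gmul G g h) = src G h"
  "src G g = tgt G h \<Longrightarrow> tgt G (gmul G g h) = tgt G g"
  "src G g = tgt G h \<Longrightarrow> src G h = tgt G l \<Longrightarrow> gmul G (gmul G g h) l = gmul G g (gmul G h l)"
  "src G (one G x) = x" "tgt G (one G x) = x"
  "gmul G g (one G (src G g)) = g" "gmul G (one G (tgt G g)) g = g"
  "src G (ginv G g) = tgt G g" "tgt G (ginv G g) = src G g"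
  "gmul G g (ginv G g) = one G (tgt G g)" "gmul G (ginv G g) g = one G (src G g)"
  using lie unfolding lie_groupoid_def by blast+

lemma mA: "smooth_manifold A" and mM: "smooth_manifold M"
  using lie unfolding lie_groupoid_def by blast+

lemmas mR = smooth_manifold_model_real

lemma mAA: "smooth_manifold (A \<times>\<^sub>M A)"
  by (rule smooth_manifold_prod[OF mA mA])

lemma smooth_structure_maps:
  "smooth_near A M (src G) g" "smooth_near A M (tgt G) g" "smooth_near M A (one G) x" "smooth_near A A (ginv G) g"
  using lie unfolding lie_groupoid_def by (auto intro: smooth_map_on_near)

lemma surj_dS: "surj (dS g)" and surj_dT: "surj (dT g)"
  using lie unfolding lie_groupoid_def by blast+

section \<open>The tangent product and its laws\<close>

text \<open>The product is given only on composable pairs; to differentiate it, a smooth extension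
  near \<open>(g, h)\<close> is used, constrained through its germ.\<close>

definition is_local_mul :: "'g \<Rightarrow> 'g \<Rightarrow> ('g \<times> 'g \<Rightarrow> 'g) \<Rightarrow> bool" where
  "is_local_mul g h F \<longleftrightarrow> smooth_near (A \<times>\<^sub>M A) A F (g, h) \<and>
     eventually (\<lambda>p. src G (fst p) = tgt G (snd p) \<longrightarrow> F p = gmul G (fst p) (snd p)) (nhds (g, h))"

definition local_mul :: "'g \<Rightarrow> 'g \<Rightarrow> 'g \<times> 'g \<Rightarrow> 'g" where
  "local_mul g h = (SOME F. is_local_mul g h F)"

text \<open>The derivative of one chosen extension. On composable vectors it does not depend on the
  choice, see \<open>Tm_eq\<close>.\<close>

definition Tm :: "'g \<Rightarrow> 'g \<Rightarrow> 'e \<Rightarrow> 'e \<Rightarrow> 'e" where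
  "Tm g h v w = tangent_map (A \<times>\<^sub>M A) A (local_mul g h) (g, h) (v, w)"

lemma is_local_mul: 
  assumes "src G g = tgt G h" shows "is_local_mul g h (local_mul g h)"
proof -
  have "smooth_map_on_subset (A \<times>\<^sub>M A) A {(g, h). src G g = tgt G h} (\<lambda>(g, h). gmul G g h)"
    using lie unfolding lie_groupoid_def by blast
  then have "\<exists>W F. (g, h) \<in> W \<and> smooth_map_on (A \<times>\<^sub>M A) A W F \<and>
      (\<forall>p\<in>W \<inter> {(g, h). src G g = tgt G h}. F p = (\<lambda>(g, h). gmul G g h) p)"
    unfolding smooth_map_on_subset_def by (rule bspec) (simp add: assms)
  then obtain W F where F: "(g, h) \<in> W" "smooth_map_on (A \<times>\<^sub>M A) A W F"
    "\<forall>p\<in>W \<inter> {(g, h). src G g = tgt G h}. F p = (\<lambda>(g, h). gmul G g h) p"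
    by (elim exE conjE)
  have "open W"
    using F(2) by (simp add: smooth_map_on_def)
  have "eventually (\<lambda>p. src G (fst p) = tgt G (snd p) \<longrightarrow> F p = gmul G (fst p) (snd p)) (nhds (g, h))"
    unfolding eventually_nhds
  proof (intro exI[of _ W] conjI ballI impI)
    show "F p = gmul G (fst p) (snd p)" if "p \<in> W" "src G (fst p) = tgt G (snd p)" for p
      using F(3)[rule_format, of p] that by (simp add: case_prod_beta')
  qed (use \<open>open W\<close> F(1) in auto)
  then have "is_local_mul g h F"
    using F(1,2) by (auto simp: is_local_mul_def intro: smooth_map_on_near)
  then show ?thesis
    unfolding local_mul_def by (rule someI[of "is_local_mul g h"])
qed

text \<open>The chain rule through a local extension. The parameter manifold is left arbitrary: it
  is the real line for curves, and \<open>A\<close> itself when the unit and inverse laws are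
  differentiated.\<close>

lemma
  assumes N: "smooth_manifold N" and a: "smooth_near N A a x" and b: "smooth_near N A b x"
    and ev: "eventually (\<lambda>y. src G (a y) = tgt G (b y)) (nhds x)"
  shows smooth_near_mul: "smooth_near N A (\<lambda>y. gmul G (a y) (b y)) x"
    and tangent_map_mul: "tangent_map N A (\<lambda>y. gmul G (a y) (b y)) x v =
      Tm (a x) (b x) (tangent_map N A a x v) (tangent_map N A b x v)"
proof -
  let ?F = "local_mul (a x) (b x)"
  have "src G (a x) = tgt G (b x)"
    using eventually_nhds_x_imp_x[OF ev] .
  then have F: "smooth_near (A \<times>\<^sub>M A) A ?F (a x, b x)"
    "eventually (\<lambda>p. src G (fst p) = tgt G (snd p) \<longrightarrow> ?F p = gmul G (fst p) (snd p)) (nhds (a x, b x))"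
    using is_local_mul by (auto simp: is_local_mul_def)
  have P: "smooth_near N (A \<times>\<^sub>M A) (\<lambda>y. (a y, b y)) x"
    by (rule smooth_near_Pair[OF N mA mA a b])
  have "eventually (\<lambda>y. ?F (a y, b y) = gmul G (a y) (b y)) (nhds x)"
    using smooth_near_eventually_compose[OF P F(2)] ev by eventually_elim simp
  note cong = smooth_near_cong[OF N mA _ this] tangent_map_cong[OF N this]
  show "smooth_near N A (\<lambda>y. gmul G (a y) (b y)) x"
    by (rule cong(1)[OF smooth_near_compose[OF N mAA mA P F(1)]])
  show "tangent_map N A (\<lambda>y. gmul G (a y) (b y)) x v =
      Tm (a x) (b x) (tangent_map N A a x v) (tangent_map N A b x v)"
    unfolding cong(2)[symmetric] Tm_def tangent_map_Pair[OF N mA mA a b, symmetric]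
    by (rule tangent_map_compose[OF N mAA mA P F(1)])
qed

lemma velocity_mul:
  assumes "smooth_near model_manifold A a 0" "smooth_near model_manifold A b 0"
    "eventually (\<lambda>\<tau>. src G (a \<tau>) = tgt G (b \<tau>)) (nhds 0)"
  shows "velocity A (\<lambda>\<tau>. gmul G (a \<tau>) (b \<tau>)) = Tm (a 0) (b 0) (velocity A a) (velocity A b)"
  unfolding velocity_def by (rule tangent_map_mul[OF mR assms])

lemma velocity_cong: "eventually (\<lambda>\<tau>. a \<tau> = b \<tau>) (nhds 0) \<Longrightarrow> velocity N a = velocity N b"
  unfolding velocity_def using tangent_map_cong[OF mR] by metis

lemma velocity_structure_maps:
  assumes "smooth_near model_manifold A a 0"
  shows "velocity M (\<lambda>\<tau>. src G (a \<tau>)) = dS (a 0) (velocity A a)"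
    "velocity M (\<lambda>\<tau>. tgt G (a \<tau>)) = dT (a 0) (velocity A a)"
    "velocity A (\<lambda>\<tau>. ginv G (a \<tau>)) = dI (a 0) (velocity A a)"
  by (rule velocity_compose[OF mA mM assms smooth_structure_maps(1)]
      velocity_compose[OF mA mM assms smooth_structure_maps(2)]
      velocity_compose[OF mA mA assms smooth_structure_maps(4)])+

lemma smooth_structure_curves:
  fixes a :: "real \<Rightarrow> 'g"
  assumes "smooth_near model_manifold A a 0"
  shows "smooth_near model_manifold M (\<lambda>\<tau>. src G (a \<tau>)) 0"
    "smooth_near model_manifold M (\<lambda>\<tau>. tgt G (a \<tau>)) 0"
    "smooth_near model_manifold A (\<lambda>\<tau>. ginv G (a \<tau>)) 0"
  by (rule smooth_near_compose[OF mR mA mM assms smooth_structure_maps(1)]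
      smooth_near_compose[OF mR mA mM assms smooth_structure_maps(2)]
      smooth_near_compose[OF mR mA mA assms smooth_structure_maps(4)])+

lemma lift_src:
  assumes b: "smooth_near model_manifold M b 0" "b 0 = src G g" "velocity M b = dS g v"
  obtains a where "a 0 = g" "smooth_near model_manifold A a 0" "velocity A a = v"
    "eventually (\<lambda>\<tau>. src G (a \<tau>) = b \<tau>) (nhds 0)"
  using curve_lift[OF mA mM smooth_structure_maps(1) surj_dS b] by blast

lemma lift_tgt:
  assumes b: "smooth_near model_manifold M b 0" "b 0 = tgt G g" "velocity M b = dT g v"
  obtains a where "a 0 = g" "smooth_near model_manifold A a 0" "velocity A a = v"
    "eventually (\<lambda>\<tau>. tgt G (a \<tau>) = b \<tau>) (nhds 0)"
  using curve_lift[OF mA mM smooth_structure_maps(2) surj_dT b] by blast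

lemma extend_composable:
  assumes gh: "src G g = tgt G (b 0)" and b: "smooth_near model_manifold A b 0" and e: "dS g v = dT (b 0) (velocity A b)"
  obtains a where "a 0 = g" "smooth_near model_manifold A a 0" "velocity A a = v"
    "eventually (\<lambda>\<tau>. src G (a \<tau>) = tgt G (b \<tau>)) (nhds 0)"
  by (rule lift_src[of "\<lambda>\<tau>. tgt G (b \<tau>)" g v])
    (use gh e smooth_structure_curves(2)[OF b] velocity_structure_maps(2)[OF b] in auto)

text \<open>The curve \<open>b\<close> is arbitrary; its target curve is lifted through the
  submersion \<open>src\<close> to a curve at \<open>g\<close> with the prescribed velocity.\<close>

lemma composable_curves:
  assumes gh: "src G g = tgt G h" and e: "dS g v = dT h w"
  obtains a b where "a 0 = g" "b 0 = h" "smooth_near model_manifold A a 0" "smooth_near model_manifold A b 0"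
    "velocity A a = v" "velocity A b = w" "eventually (\<lambda>\<tau>. src G (a \<tau>) = tgt G (b \<tau>)) (nhds 0)"
proof -
  obtain b where b: "b 0 = h" "smooth_near model_manifold A b 0" "velocity A b = w"
    using curve_with_velocity[OF mA] .
  obtain a where a: "a 0 = g" "smooth_near model_manifold A a 0" "velocity A a = v"
    "eventually (\<lambda>\<tau>. src G (a \<tau>) = tgt G (b \<tau>)) (nhds 0)"
    using extend_composable[of g b v] gh e b by blast
  show thesis
    by (rule that[OF a(1) b(1) a(2) b(2) a(3) b(3) a(4)])
qed

text \<open>Differentiation of s(ab) = s(b) and t(ab) = t(a) along composable curves.\<close>

lemma dS_Tm': assumes gh: "src G g = tgt G h" and e: "dS g v = dT h w"
  shows "dS (gmul G g h) (Tm g h v w) = dS h w" "dT (gmul G g h) (Tm g h v w) = dT g v"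
proof -
  obtain a b where ab: "a 0 = g" "b 0 = h" "smooth_near model_manifold A a 0" "smooth_near model_manifold A b 0"
    "velocity A a = v" "velocity A b = w" and ev: "eventually (\<lambda>\<tau>. src G (a \<tau>) = tgt G (b \<tau>)) (nhds 0)"
    using composable_curves[OF gh e] .
  let ?c = "\<lambda>\<tau>. gmul G (a \<tau>) (b \<tau>)"
  note sm = smooth_near_mul[OF mR ab(3,4) ev]
  have "eventually (\<lambda>\<tau>. src G (?c \<tau>) = src G (b \<tau>)) (nhds 0)" "eventually (\<lambda>\<tau>. tgt G (?c \<tau>) = tgt G (a \<tau>)) (nhds 0)"
    using ev by (eventually_elim, simp add: groupoid_laws)+
  then have "velocity M (\<lambda>\<tau>. src G (?c \<tau>)) = velocity M (\<lambda>\<tau>. src G (b \<tau>))"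
    "velocity M (\<lambda>\<tau>. tgt G (?c \<tau>)) = velocity M (\<lambda>\<tau>. tgt G (a \<tau>))"
    by (auto intro: velocity_cong)
  then show "dS (gmul G g h) (Tm g h v w) = dS h w" "dT (gmul G g h) (Tm g h v w) = dT g v"
    unfolding velocity_structure_maps[OF sm] velocity_structure_maps[OF ab(3)] velocity_structure_maps[OF ab(4)]
      velocity_mul[OF ab(3,4) ev] ab by simp_all
qed

text \<open>The curves are chosen from right to left, the leftmost lifted over the target of the
  middle one, so that all three are composable at once.\<close>

lemma Tm_assoc':
  assumes gh: "src G g = tgt G h" and hl: "src G h = tgt G l" and uv: "dS g u = dT h v" and vw: "dS h v = dT l w"
  shows "Tm (gmul G g h) l (Tm g h u v) w = Tm g (gmul G h l) u (Tm h l v w)"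
proof -
  obtain b c where bc: "b 0 = h" "c 0 = l" "smooth_near model_manifold A b 0" "smooth_near model_manifold A c 0"
    "velocity A b = v" "velocity A c = w" and ev2: "eventually (\<lambda>\<tau>. src G (b \<tau>) = tgt G (c \<tau>)) (nhds 0)"
    using composable_curves[OF hl vw] .
  obtain a where a: "a 0 = g" "smooth_near model_manifold A a 0" "velocity A a = u"
    and ev1: "eventually (\<lambda>\<tau>. src G (a \<tau>) = tgt G (b \<tau>)) (nhds 0)"
    using extend_composable[of g b u] gh uv bc by blast
  have ev3: "eventually (\<lambda>\<tau>. src G (gmul G (a \<tau>) (b \<tau>)) = tgt G (c \<tau>)) (nhds 0)"
    and ev4: "eventually (\<lambda>\<tau>. src G (a \<tau>) = tgt G (gmul G (b \<tau>) (c \<tau>))) (nhds 0)"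
    and ev5: "eventually (\<lambda>\<tau>. gmul G (gmul G (a \<tau>) (b \<tau>)) (c \<tau>) = gmul G (a \<tau>) (gmul G (b \<tau>) (c \<tau>))) (nhds 0)"
    using ev1 ev2 by (eventually_elim, simp add: groupoid_laws)+
  note sab = smooth_near_mul[OF mR a(2) bc(3) ev1] and sbc = smooth_near_mul[OF mR bc(3,4) ev2]
  show ?thesis
    using velocity_mul[OF sab bc(4) ev3] velocity_mul[OF a(2) sbc ev4] velocity_cong[OF ev5, of A]
      velocity_mul[OF a(2) bc(3) ev1] velocity_mul[OF bc(3,4) ev2] a bc by simp
qed

text \<open>Here the identities g 1 = g, 1 g = g, g g^-1 = 1 and g^-1 g = 1 are differentiated
  directly as maps of \<open>g\<close>.\<close>

lemma Tm_unit_inverse_laws: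
  "Tm g (one G (src G g)) v (d1 (src G g) (dS g v)) = v"
  "Tm (one G (tgt G g)) g (d1 (tgt G g) (dT g v)) v = v"
  "Tm g (ginv G g) v (dI g v) = d1 (tgt G g) (dT g v)"
  "Tm (ginv G g) g (dI g v) v = d1 (src G g) (dS g v)"
proof -
  note s = smooth_near_ident[OF mA, of g] smooth_structure_maps(4)[of g]
    smooth_near_compose[OF mA mM mA smooth_structure_maps(1) smooth_structure_maps(3), of g]
    smooth_near_compose[OF mA mM mA smooth_structure_maps(2) smooth_structure_maps(3), of g]
  note t = tangent_map_ident[OF mA, of g]
    tangent_map_compose[OF mA mM mA smooth_structure_maps(1) smooth_structure_maps(3), of g]
    tangent_map_compose[OF mA mM mA smooth_structure_maps(2) smooth_structure_maps(3), of g]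
  show "Tm g (one G (src G g)) v (d1 (src G g) (dS g v)) = v"
    using tangent_map_mul[OF mA s(1,3), of v] by (simp add: groupoid_laws t)
  show "Tm (one G (tgt G g)) g (d1 (tgt G g) (dT g v)) v = v"
    using tangent_map_mul[OF mA s(4,1), of v] by (simp add: groupoid_laws t)
  show "Tm g (ginv G g) v (dI g v) = d1 (tgt G g) (dT g v)"
    using tangent_map_mul[OF mA s(1,2), of v] by (simp add: groupoid_laws t)
  show "Tm (ginv G g) g (dI g v) v = d1 (src G g) (dS g v)"
    using tangent_map_mul[OF mA s(2,1), of v] by (simp add: groupoid_laws t)
qed

lemma d_structure_maps:
  "dS (one G x) (d1 x y) = y" "dT (one G x) (d1 x y) = y"
  "dS (ginv G g) (dI g v) = dT g v" "dT (ginv G g) (dI g v) = dS g v"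
  using tangent_map_compose[OF mM mA mM smooth_structure_maps(3,1), of x y]
    tangent_map_compose[OF mM mA mM smooth_structure_maps(3,2), of x y]
    tangent_map_compose[OF mA mA mM smooth_structure_maps(4,1), of g v]
    tangent_map_compose[OF mA mA mM smooth_structure_maps(4,2), of g v]
  by (simp_all add: groupoid_laws tangent_map_ident[OF mM])

lemma Tm_linear':
  assumes gh: "src G g = tgt G h" shows "linear (\<lambda>p. Tm g h (fst p) (snd p))"
  using tangent_map_linear[OF mAA mA, of "local_mul g h" "(g, h)"] is_local_mul[OF gh]
  by (simp add: Tm_def is_local_mul_def)

lemma unit_laws:
  "x = src G g \<Longrightarrow> gmul G g (one G x) = g" "x = tgt G g \<Longrightarrow> gmul G (one G x) g = g"
  "x = src G g \<Longrightarrow> Tm g (one G x) v (d1 x (dS g v)) = v"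
  "x = tgt G g \<Longrightarrow> Tm (one G x) g (d1 x (dT g v)) v = v"
  by (simp_all add: groupoid_laws Tm_unit_inverse_laws)

sublocale tangent_groupoid "src G" "tgt G" "one G" "ginv G" "gmul G" dS dT d1 dI Tm
proof (rule tangent_groupoid.intro)
qed (rule groupoid_laws unit_laws surj_dS dS_Tm' Tm_assoc' Tm_unit_inverse_laws
      d_structure_maps Tm_linear' smooth_manifold_findim[OF mA]
      tangent_map_linear[OF mA mM smooth_structure_maps(1)] tangent_map_linear[OF mA mM smooth_structure_maps(2)]
      tangent_map_linear[OF mM mA smooth_structure_maps(3)] tangent_map_linear[OF mA mA smooth_structure_maps(4)];
      assumption)+

section \<open>Projection and translations as defined by tangent maps\<close>

text \<open>Uniqueness of the decomposition: applying \<open>dS\<close> at the unit recovers the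
  base vector of the unit component.\<close>

lemma pr_A_eq: "pr_A G x = prA x"
proof
  fix v
  show "pr_A G x v = prA x v"
    unfolding pr_A_def
  proof (rule the_equality)
    have "v - prA x v = d1 x (dS (one G x) v)"
      by (simp add: prA_def)
    then show "prA x v \<in> algebroid G x \<and> v - prA x v \<in> range (d1 x)"
      by (simp add: algebroid_def)
    fix a assume "a \<in> algebroid G x \<and> v - a \<in> range (d1 x)"
    then obtain y where y: "v - a = d1 x y" and a: "dS (one G x) a = 0"
      by (auto simp: algebroid_def)
    have "dS (one G x) (v - a) = y"
      by (simp add: y)
    then have "dS (one G x) v = y"
      by (simp add: linear_diff[OF dS_linear] a)
    then show "a = prA x v"
      using y by (simp add: prA_def algebra_simps)
  qed
qed

text \<open>The description in \<open>tangent_map_on\<close> needs some curve in the source fibre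
  with velocity \<open>a\<close>, found by lifting a constant curve through \<open>src\<close>, and
  the same result for all such curves, which is \<open>velocity_mul\<close> with a constant second
  factor.\<close>

lemma dR_eq:
  assumes a: "dS (one G (tgt G g)) a = 0"
  shows "dR G g a = Tm (one G (tgt G g)) g a 0"
proof -
  let ?x = "one G (tgt G g)" and ?S = "{h. src G h = tgt G g}"
  have vel: "velocity A ((\<lambda>h. gmul G h g) \<circ> \<gamma>) = Tm ?x g (velocity A \<gamma>) 0" if "curve_in A ?S ?x \<gamma>" for \<gamma>
  proof -
    have \<gamma>: "\<gamma> 0 = ?x" "smooth_near model_manifold A \<gamma> 0" "eventually (\<lambda>\<tau>. src G (\<gamma> \<tau>) = tgt G g) (nhds 0)"
      using that unfolding curve_in_iff[OF mA] by auto
    show ?thesis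
      using velocity_mul[OF \<gamma>(2) smooth_near_const[OF mR mA] \<gamma>(3)] \<gamma>(1)
      by (simp add: o_def velocity_def tangent_map_const)
  qed
  obtain \<gamma> where \<gamma>: "\<gamma> 0 = ?x" "smooth_near model_manifold A \<gamma> 0" "velocity A \<gamma> = a"
    "eventually (\<lambda>\<tau>. src G (\<gamma> \<tau>) = tgt G g) (nhds 0)"
    by (rule lift_src[of "\<lambda>\<tau>. tgt G g" ?x a])
      (use a smooth_near_const[OF mR mM] in \<open>auto simp: velocity_def tangent_map_const\<close>)
  then have "curve_in A ?S ?x \<gamma>"
    unfolding curve_in_iff[OF mA] by auto
  then have "\<exists>\<gamma>. curve_in A ?S ?x \<gamma> \<and> velocity A \<gamma> = a \<and> velocity A ((\<lambda>h. gmul G h g) \<circ> \<gamma>) = Tm ?x g a 0"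
    using vel \<gamma>(3) by (intro exI[of _ \<gamma>]) simp
  then show ?thesis
    unfolding dR_def tangent_map_on_def by (rule the_equality) (auto simp: vel[unfolded o_def] o_def)
qed

lemma dL_eq:
  assumes a: "dT (one G (src G g)) a = 0"
  shows "dL G g a = Tm g (one G (src G g)) 0 a"
proof -
  let ?x = "one G (src G g)" and ?S = "{h. tgt G h = src G g}"
  have vel: "velocity A ((\<lambda>h. gmul G g h) \<circ> \<gamma>) = Tm g ?x 0 (velocity A \<gamma>)" if "curve_in A ?S ?x \<gamma>" for \<gamma>
  proof -
    have \<gamma>: "\<gamma> 0 = ?x" "smooth_near model_manifold A \<gamma> 0" "eventually (\<lambda>\<tau>. src G g = tgt G (\<gamma> \<tau>)) (nhds 0)"
      using that unfolding curve_in_iff[OF mA] by (auto simp: eq_commute)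
    show ?thesis
      using velocity_mul[OF smooth_near_const[OF mR mA] \<gamma>(2,3)] \<gamma>(1)
      by (simp add: o_def velocity_def tangent_map_const)
  qed
  obtain \<gamma> where \<gamma>: "\<gamma> 0 = ?x" "smooth_near model_manifold A \<gamma> 0" "velocity A \<gamma> = a"
    "eventually (\<lambda>\<tau>. tgt G (\<gamma> \<tau>) = src G g) (nhds 0)"
    by (rule lift_tgt[of "\<lambda>\<tau>. src G g" ?x a])
      (use a smooth_near_const[OF mR mM] in \<open>auto simp: velocity_def tangent_map_const\<close>)
  then have "curve_in A ?S ?x \<gamma>"
    unfolding curve_in_iff[OF mA] by auto
  then have "\<exists>\<gamma>. curve_in A ?S ?x \<gamma> \<and> velocity A \<gamma> = a \<and> velocity A ((\<lambda>h. gmul G g h) \<circ> \<gamma>) = Tm g ?x 0 a"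
    using vel \<gamma>(3) by (intro exI[of _ \<gamma>]) simp
  then show ?thesis
    unfolding dL_def tangent_map_on_def by (rule the_equality) (auto simp: vel[unfolded o_def] o_def)
qed

text \<open>The projection onto A occurs in \<open>pr_wedge_A\<close> and again in the translation;
  it is idempotent, so both merge into the single transpose \<open>cotangent_tgt\<close>.\<close>

lemma right_translate_eq: "right_translate G (pr_wedge_A G \<Lambda>) = right_trans \<Lambda>"
proof (intro ext)
  fix g and \<xi> :: "nat \<Rightarrow> 'e \<Rightarrow>\<^sub>L real"
  let ?x = "tgt G g"
  have d: "(\<lambda>v. dR G g (prA ?x v)) = (\<lambda>v. Tm (one G ?x) g (prA ?x v) 0)"
    by (simp add: fun_eq_iff dR_eq)
  have "(\<xi> i o\<^sub>L Blinfun (\<lambda>v. Tm (one G ?x) g (prA ?x v) 0)) o\<^sub>L Blinfun (prA ?x) = cotangent_tgt g (\<xi> i)" for i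
    by (rule blinfun_eqI) (simp add: cotangent_tgt_apply prA_ident bounded_linear_Blinfun_apply
        findim_linear_bounded[OF fin prA_linear] findim_linear_bounded[OF fin right_translation_linear])
  then show "right_translate G (pr_wedge_A G \<Lambda>) g \<xi> = right_trans \<Lambda> g \<xi>"
    by (simp add: right_translate_def pr_wedge_A_def pushforward_def d right_trans_def pr_A_eq)
qed

lemma left_translate_eq: "left_translate G (pr_wedge_A G \<Lambda>) = left_trans \<Lambda>"
proof (intro ext)
  fix g and \<xi> :: "nat \<Rightarrow> 'e \<Rightarrow>\<^sub>L real"
  let ?x = "src G g"
  have d: "(\<lambda>v. - dL G g (dI (one G ?x) (prA ?x v))) = (\<lambda>v. - Tm g (one G ?x) 0 (dI (one G ?x) (prA ?x v)))"
    by (simp add: fun_eq_iff dL_eq)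
  have "(\<xi> i o\<^sub>L Blinfun (\<lambda>v. - Tm g (one G ?x) 0 (dI (one G ?x) (prA ?x v)))) o\<^sub>L Blinfun (prA ?x) = cotangent_src g (\<xi> i)" for i
    by (rule blinfun_eqI) (simp add: cotangent_src_apply prA_ident bounded_linear_Blinfun_apply blinfun.minus_right
        findim_linear_bounded[OF fin prA_linear] findim_linear_bounded[OF fin left_translation_linear])
  then show "left_translate G (pr_wedge_A G \<Lambda>) g \<xi> = left_trans \<Lambda> g \<xi>"
    by (simp add: left_translate_def pr_wedge_A_def pushforward_def d left_trans_def pr_A_eq)
qed

end

section \<open>Multivectors and coisotropy\<close>

lemma multivectors_iff: "\<omega> \<in> multivectors k \<longleftrightarrow>
     (\<forall>\<xi> \<eta>. (\<forall>i<k. \<xi> i = \<eta> i) \<longrightarrow> \<omega> \<xi> = \<omega> \<eta>) \<and>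
     (\<forall>\<xi>. \<forall>i<k. linear (\<lambda>\<alpha>. \<omega> (\<xi>(i := \<alpha>)))) \<and>
     (\<forall>\<xi>. \<forall>i<k. \<forall>j<k. i \<noteq> j \<longrightarrow> \<xi> i = \<xi> j \<longrightarrow> \<omega> \<xi> = 0)"
  unfolding multivectors_def mem_Collect_eq ..

lemma multivectors_local:
  assumes "\<omega> \<in> multivectors k" "\<And>i. i < k \<Longrightarrow> \<xi> i = \<eta> i"
  shows "\<omega> \<xi> = \<omega> \<eta>"
  using multivectors_iff[THEN iffD1, OF assms(1), THEN conjunct1, rule_format, of \<xi> \<eta>] assms(2) by simp

lemma multivectors_linear: "\<omega> \<in> multivectors k \<Longrightarrow> i < k \<Longrightarrow> linear (\<lambda>\<alpha>. \<omega> (\<xi>(i := \<alpha>)))"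
  by (rule multivectors_iff[THEN iffD1, THEN conjunct2, THEN conjunct1, rule_format])

lemma multivectors_alternating:
  "\<omega> \<in> multivectors k \<Longrightarrow> i < k \<Longrightarrow> j < k \<Longrightarrow> i \<noteq> j \<Longrightarrow> \<xi> i = \<xi> j \<Longrightarrow> \<omega> \<xi> = 0"
  by (rule multivectors_iff[THEN iffD1, THEN conjunct2, THEN conjunct2, rule_format])

lemma multivectors_minus:
  assumes "\<omega> \<in> multivectors k"
  shows "\<omega> (\<lambda>i. - \<xi> i) = (- 1) ^ k * \<omega> \<xi>"
proof -
  \<comment> \<open>Slots are negated one at a time, each at the cost of one sign.\<close>
  have "\<omega> (\<lambda>i. if i < j then - \<xi> i else \<xi> i) = (- 1) ^ j * \<omega> \<xi>" if "j \<le> k" for j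
    using that
  proof (induction j)
    case (Suc j)
    let ?\<eta> = "\<lambda>i. if i < j then - \<xi> i else \<xi> i"
    have "(\<lambda>i. if i < Suc j then - \<xi> i else \<xi> i) = ?\<eta>(j := - \<xi> j)" "?\<eta>(j := \<xi> j) = ?\<eta>"
      by (auto simp: fun_eq_iff)
    then show ?case
      using linear_neg[OF multivectors_linear[OF assms, of j ?\<eta>], of "\<xi> j"] Suc by simp
  qed simp
  from this[of k] have "\<omega> (\<lambda>i. if i < k then - \<xi> i else \<xi> i) = (- 1) ^ k * \<omega> \<xi>"
    by simp
  moreover have "\<omega> (\<lambda>i. if i < k then - \<xi> i else \<xi> i) = \<omega> (\<lambda>i. - \<xi> i)"
    by (rule multivectors_local[OF assms]) simp
  ultimately show ?thesis by simp
qed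

lemma multivectors_pullback:
  assumes "\<omega> \<in> multivectors k"
  shows "(\<lambda>\<xi>. \<omega> (\<lambda>i. \<xi> i o\<^sub>L L)) \<in> multivectors k"
proof -
  have lin: "linear (\<lambda>\<alpha>. \<omega> (\<lambda>j. (\<xi>(i := \<alpha>)) j o\<^sub>L L))" if "i < k" for \<xi> i
  proof -
    have "(\<lambda>j. (\<xi>(i := \<alpha>)) j o\<^sub>L L) = (\<lambda>j. \<xi> j o\<^sub>L L)(i := \<alpha> o\<^sub>L L)" for \<alpha>
      by (auto simp: fun_eq_iff)
    moreover have "linear (\<lambda>\<alpha>. \<alpha> o\<^sub>L L)"
      using bounded_linear.linear[OF bounded_bilinear.bounded_linear_left[OF bounded_bilinear_blinfun_compose]] .
    ultimately show ?thesis
      using linear_compose[OF _ multivectors_linear[OF assms that], of "\<lambda>\<alpha>. \<alpha> o\<^sub>L L"] by (simp add: o_def)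
  qed
  show ?thesis
    unfolding multivectors_iff
    using lin by (auto intro!: multivectors_local[OF assms] intro: multivectors_alternating[OF assms])
qed

lemma pushforward_multivectors: "\<omega> \<in> multivectors k \<Longrightarrow> pushforward L \<omega> \<in> multivectors k"
  unfolding pushforward_def by (rule multivectors_pullback)

lemma curve_components:
  assumes N: "smooth_manifold N" and P: "smooth_manifold P" and \<gamma>: "smooth_near model_manifold (N \<times>\<^sub>M P) \<gamma> 0"
  shows "smooth_near model_manifold N (\<lambda>\<tau>. fst (\<gamma> \<tau>)) 0" "smooth_near model_manifold P (\<lambda>\<tau>. snd (\<gamma> \<tau>)) 0"
    and "velocity N (\<lambda>\<tau>. fst (\<gamma> \<tau>)) = fst (velocity (N \<times>\<^sub>M P) \<gamma>)"
    and "velocity P (\<lambda>\<tau>. snd (\<gamma> \<tau>)) = snd (velocity (N \<times>\<^sub>M P) \<gamma>)"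
proof -
  note NP = smooth_manifold_prod[OF N P] and R = smooth_manifold_model_real
  note s = smooth_near_fst[OF N P] smooth_near_snd[OF N P]
  show "smooth_near model_manifold N (\<lambda>\<tau>. fst (\<gamma> \<tau>)) 0" "smooth_near model_manifold P (\<lambda>\<tau>. snd (\<gamma> \<tau>)) 0"
    by (rule smooth_near_compose[where f = \<gamma> and x = 0, OF R NP N \<gamma> s(1)]
        smooth_near_compose[where f = \<gamma> and x = 0, OF R NP P \<gamma> s(2)])+
  show "velocity N (\<lambda>\<tau>. fst (\<gamma> \<tau>)) = fst (velocity (N \<times>\<^sub>M P) \<gamma>)"
    "velocity P (\<lambda>\<tau>. snd (\<gamma> \<tau>)) = snd (velocity (N \<times>\<^sub>M P) \<gamma>)"
    using velocity_compose[OF NP N \<gamma> s(1)] velocity_compose[OF NP P \<gamma> s(2)]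
    by (simp_all add: tangent_map_fst[OF N P] tangent_map_snd[OF N P])
qed

lemma velocity_Pair:
  "smooth_manifold N \<Longrightarrow> smooth_manifold P \<Longrightarrow> smooth_near model_manifold N a 0 \<Longrightarrow> smooth_near model_manifold P b 0 \<Longrightarrow>
    velocity (N \<times>\<^sub>M P) (\<lambda>\<tau>. (a \<tau>, b \<tau>)) = (velocity N a, velocity P b)"
  unfolding velocity_def by (rule tangent_map_Pair[OF smooth_manifold_model_real])

lemma bounded_linear_inclusions:
  "bounded_linear (\<lambda>v. (v, 0))" "bounded_linear (\<lambda>w. (0, w))"
  by (intro bounded_linear_Pair bounded_linear_ident bounded_linear_zero)+

lemma oplus_apply:
  "(\<Lambda> \<oplus>\<^sub>M \<Lambda>') (x, y) \<xi> = \<Lambda> x (\<lambda>i. \<xi> i o\<^sub>L Blinfun (\<lambda>v. (v, 0))) + \<Lambda>' y (\<lambda>i. \<xi> i o\<^sub>L Blinfun (\<lambda>w. (0, w)))"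
  by (simp add: oplus_def pushforward_def)

lemma blinfun_split: "blinfun_apply \<xi> (v, w) =
    blinfun_apply (\<xi> o\<^sub>L Blinfun (\<lambda>v. (v, 0))) v + blinfun_apply (\<xi> o\<^sub>L Blinfun (\<lambda>w. (0, w))) w"
  using blinfun.add_right[of \<xi> "(v, 0)" "(0, w)"]
  by (simp add: bounded_linear_Blinfun_apply[OF bounded_linear_inclusions(1)]
      bounded_linear_Blinfun_apply[OF bounded_linear_inclusions(2)])

text \<open>Every covector on a product has this form (\<open>blinfun_eq_copair\<close>), so
  quantifiers over covectors split by \<open>all_copair\<close>.\<close>

definition copair :: "('e::real_normed_vector \<Rightarrow>\<^sub>L real) \<Rightarrow> ('f::real_normed_vector \<Rightarrow>\<^sub>L real) \<Rightarrow> ('e \<times> 'f) \<Rightarrow>\<^sub>L real" where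
  "copair \<alpha> \<beta> = (\<alpha> o\<^sub>L Blinfun fst) + (\<beta> o\<^sub>L Blinfun snd)"

lemma copair_apply [simp]: "blinfun_apply (copair \<alpha> \<beta>) (v, w) = blinfun_apply \<alpha> v + blinfun_apply \<beta> w"
  by (simp add: copair_def blinfun.add_left bounded_linear_Blinfun_apply bounded_linear_fst bounded_linear_snd)

lemma copair_compose [simp]:
  "copair \<alpha> \<beta> o\<^sub>L Blinfun (\<lambda>v. (v, 0)) = \<alpha>" "copair \<alpha> \<beta> o\<^sub>L Blinfun (\<lambda>w. (0, w)) = \<beta>"
  by (rule blinfun_eqI; simp add: bounded_linear_Blinfun_apply bounded_linear_inclusions)+

lemma blinfun_eq_copair: "\<xi> = copair (\<xi> o\<^sub>L Blinfun (\<lambda>v. (v, 0))) (\<xi> o\<^sub>L Blinfun (\<lambda>w. (0, w)))"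
proof (rule blinfun_eqI)
  fix p
  show "blinfun_apply \<xi> p = blinfun_apply (copair (\<xi> o\<^sub>L Blinfun (\<lambda>v. (v, 0))) (\<xi> o\<^sub>L Blinfun (\<lambda>w. (0, w)))) p"
    using blinfun_split[of \<xi> "fst p" "snd p"] by (metis copair_apply prod.collapse)
qed

lemma all_copair: "(\<forall>\<xi>::nat \<Rightarrow> ('e::real_normed_vector \<times> 'f::real_normed_vector) \<Rightarrow>\<^sub>L real. P \<xi>) \<longleftrightarrow>
    (\<forall>\<alpha> \<beta>. P (\<lambda>i. copair (\<alpha> i) (\<beta> i)))"
proof
  assume a: "\<forall>\<alpha> \<beta>. P (\<lambda>i. copair (\<alpha> i) (\<beta> i))"
  show "\<forall>\<xi>. P \<xi>"
  proof
    fix \<xi> :: "nat \<Rightarrow> ('e \<times> 'f) \<Rightarrow>\<^sub>L real"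
    show "P \<xi>"
      using a[rule_format, of "\<lambda>i. \<xi> i o\<^sub>L Blinfun (\<lambda>v. (v, 0))" "\<lambda>i. \<xi> i o\<^sub>L Blinfun (\<lambda>w. (0, w))"]
      unfolding blinfun_eq_copair[symmetric] .
  qed
qed blast

text \<open>A change of variables, used to flip the sign of individual covectors in the coisotropy
  conditions.\<close>

lemma all_minus:
  fixes P :: "(nat \<Rightarrow> 'e::real_normed_vector \<Rightarrow>\<^sub>L real) \<Rightarrow> bool"
  shows "(\<forall>\<alpha>. P \<alpha>) \<longleftrightarrow> (\<forall>\<alpha>. P (\<lambda>i. - \<alpha> i))"
proof
  assume a: "\<forall>\<alpha>. P (\<lambda>i. - \<alpha> i)"
  show "\<forall>\<alpha>. P \<alpha>"
  proof
    show "P \<alpha>" for \<alpha>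
      using a[rule_format, of "\<lambda>i. - \<alpha> i"] by simp
  qed
qed blast

section \<open>Conormals of the two graphs\<close>

context lie
begin

abbreviation "graph3 \<equiv> {(g, h, gmul G g h) | g h. src G g = tgt G h}"
abbreviation "graph4 \<equiv> {(g, h, l, gmul G (gmul G h (ginv G g)) l) | g h l. src G g = src G h \<and> tgt G g = tgt G l}"

lemma mAAA: "smooth_manifold (A \<times>\<^sub>M A \<times>\<^sub>M A)" and mAAAA: "smooth_manifold (A \<times>\<^sub>M A \<times>\<^sub>M A \<times>\<^sub>M A)"
  by (intro smooth_manifold_prod mA)+

text \<open>The first two components of a curve in the graph determine the third, whose velocity is
  given by \<open>velocity_mul\<close>. Conversely, composable vectors come from composable
  curves.\<close>

lemma tangent_space_graph3:
  assumes gh: "src G g = tgt G h"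
  shows "tangent_space (A \<times>\<^sub>M A \<times>\<^sub>M A) graph3 (g, h, gmul G g h) = {(v, w, Tm g h v w) | v w. dS g v = dT h w}"
proof (intro equalityI subsetI)
  fix z assume "z \<in> tangent_space (A \<times>\<^sub>M A \<times>\<^sub>M A) graph3 (g, h, gmul G g h)"
  then obtain \<gamma> where z: "z = velocity (A \<times>\<^sub>M A \<times>\<^sub>M A) \<gamma>" and \<gamma>0: "\<gamma> 0 = (g, h, gmul G g h)"
    and \<gamma>: "smooth_near model_manifold (A \<times>\<^sub>M A \<times>\<^sub>M A) \<gamma> 0" and ev: "eventually (\<lambda>\<tau>. \<gamma> \<tau> \<in> graph3) (nhds 0)"
    unfolding tangent_space_def curve_in_iff[OF mAAA] by auto
  note s = curve_components[OF mA mAA \<gamma>]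
  note s2 = curve_components[OF mA mA s(2)]
  have ev1: "eventually (\<lambda>\<tau>. src G (fst (\<gamma> \<tau>)) = tgt G (fst (snd (\<gamma> \<tau>)))) (nhds 0)"
    and ev2: "eventually (\<lambda>\<tau>. snd (snd (\<gamma> \<tau>)) = gmul G (fst (\<gamma> \<tau>)) (fst (snd (\<gamma> \<tau>)))) (nhds 0)"
    using ev by (eventually_elim, force)+
  let ?v = "fst z" and ?w = "fst (snd z)"
  have "snd (snd z) = Tm g h ?v ?w"
    using velocity_mul[OF s(1) s2(1) ev1] velocity_cong[OF ev2, of A] by (simp add: s s2 z \<gamma>0)
  moreover have "dS g ?v = dT h ?w"
    using velocity_cong[OF ev1, of M] velocity_structure_maps(1)[OF s(1)] velocity_structure_maps(2)[OF s2(1)]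
    by (simp add: s s2 z \<gamma>0)
  ultimately show "z \<in> {(v, w, Tm g h v w) | v w. dS g v = dT h w}"
    by (auto intro!: exI[of _ ?v] exI[of _ ?w] simp: prod_eq_iff)
next
  fix z assume "z \<in> {(v, w, Tm g h v w) | v w. dS g v = dT h w}"
  then obtain v w where z: "z = (v, w, Tm g h v w)" and e: "dS g v = dT h w"
    by auto
  obtain a b where ab: "a 0 = g" "b 0 = h" "smooth_near model_manifold A a 0" "smooth_near model_manifold A b 0"
    "velocity A a = v" "velocity A b = w" and ev: "eventually (\<lambda>\<tau>. src G (a \<tau>) = tgt G (b \<tau>)) (nhds 0)"
    using composable_curves[OF gh e] .
  let ?c = "\<lambda>\<tau>. gmul G (a \<tau>) (b \<tau>)"
  note sm = smooth_near_mul[OF mR ab(3,4) ev]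
  note sp = smooth_near_Pair[OF mR mA mA ab(4) sm]
  have "velocity (A \<times>\<^sub>M A \<times>\<^sub>M A) (\<lambda>\<tau>. (a \<tau>, b \<tau>, ?c \<tau>)) = z"
    using velocity_mul[OF ab(3,4) ev]
    by (simp add: velocity_Pair[OF mA mAA ab(3) sp] velocity_Pair[OF mA mA ab(4) sm] ab z)
  moreover have "curve_in (A \<times>\<^sub>M A \<times>\<^sub>M A) graph3 (g, h, gmul G g h) (\<lambda>\<tau>. (a \<tau>, b \<tau>, ?c \<tau>))"
    unfolding curve_in_iff[OF mAAA] using ab smooth_near_Pair[OF mR mA mAA ab(3) sp]
    by (auto intro!: eventually_mono[OF ev])
  ultimately show "z \<in> tangent_space (A \<times>\<^sub>M A \<times>\<^sub>M A) graph3 (g, h, gmul G g h)"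
    unfolding tangent_space_def by blast
qed

text \<open>For the converse inclusion \<open>a\<close> is chosen freely, and \<open>b\<close> and
  \<open>c\<close> are lifted over its source curve and its target curve.\<close>

lemma tangent_space_graph4:
  assumes gh: "src G g = src G h" and gl: "tgt G g = tgt G l"
  shows "tangent_space (A \<times>\<^sub>M A \<times>\<^sub>M A \<times>\<^sub>M A) graph4 (g, h, l, gmul G (gmul G h (ginv G g)) l) =
    {(u, v, w, Tm (gmul G h (ginv G g)) l (Tm h (ginv G g) v (dI g u)) w) | u v w. dS g u = dS h v \<and> dT g u = dT l w}"
    (is "tangent_space _ _ ?p = ?T")
proof (intro equalityI subsetI)
  fix z assume "z \<in> tangent_space (A \<times>\<^sub>M A \<times>\<^sub>M A \<times>\<^sub>M A) graph4 ?p"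
  then obtain \<gamma> where z: "z = velocity (A \<times>\<^sub>M A \<times>\<^sub>M A \<times>\<^sub>M A) \<gamma>" and \<gamma>0: "\<gamma> 0 = ?p"
    and \<gamma>: "smooth_near model_manifold (A \<times>\<^sub>M A \<times>\<^sub>M A \<times>\<^sub>M A) \<gamma> 0" and ev: "eventually (\<lambda>\<tau>. \<gamma> \<tau> \<in> graph4) (nhds 0)"
    unfolding tangent_space_def curve_in_iff[OF mAAAA] by auto
  note s = curve_components[OF mA mAAA \<gamma>]
  note s2 = curve_components[OF mA mAA s(2)]
  note s3 = curve_components[OF mA mA s2(2)]
  let ?a = "\<lambda>\<tau>. fst (\<gamma> \<tau>)" and ?b = "\<lambda>\<tau>. fst (snd (\<gamma> \<tau>))" and ?c = "\<lambda>\<tau>. fst (snd (snd (\<gamma> \<tau>)))"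
  have ev1: "eventually (\<lambda>\<tau>. src G (?a \<tau>) = src G (?b \<tau>)) (nhds 0)"
    and ev2: "eventually (\<lambda>\<tau>. tgt G (?a \<tau>) = tgt G (?c \<tau>)) (nhds 0)"
    and ev3: "eventually (\<lambda>\<tau>. src G (?b \<tau>) = tgt G (ginv G (?a \<tau>))) (nhds 0)"
    and ev4: "eventually (\<lambda>\<tau>. src G (gmul G (?b \<tau>) (ginv G (?a \<tau>))) = tgt G (?c \<tau>)) (nhds 0)"
    and ev5: "eventually (\<lambda>\<tau>. snd (snd (snd (\<gamma> \<tau>))) = gmul G (gmul G (?b \<tau>) (ginv G (?a \<tau>))) (?c \<tau>)) (nhds 0)"
    using ev by (eventually_elim, force simp: src_mul)+
  note si = smooth_structure_curves(3)[OF s(1)]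
  note sm = smooth_near_mul[OF mR s2(1) si ev3]
  let ?u = "fst z" and ?v = "fst (snd z)" and ?w = "fst (snd (snd z))"
  have "snd (snd (snd z)) = Tm (gmul G h (ginv G g)) l (Tm h (ginv G g) ?v (dI g ?u)) ?w"
    using velocity_mul[OF sm s3(1) ev4] velocity_mul[OF s2(1) si ev3] velocity_cong[OF ev5, of A]
      velocity_structure_maps(3)[OF s(1)] by (simp add: s s2 s3 z \<gamma>0)
  moreover have "dS g ?u = dS h ?v"
    using velocity_cong[OF ev1, of M] velocity_structure_maps(1)[OF s(1)] velocity_structure_maps(1)[OF s2(1)]
    by (simp add: s s2 s3 z \<gamma>0)
  moreover have "dT g ?u = dT l ?w"
    using velocity_cong[OF ev2, of M] velocity_structure_maps(2)[OF s(1)] velocity_structure_maps(2)[OF s3(1)]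
    by (simp add: s s2 s3 z \<gamma>0)
  ultimately show "z \<in> ?T"
    by (auto intro!: exI[of _ ?u] exI[of _ ?v] exI[of _ ?w] simp: prod_eq_iff)
next
  fix z assume "z \<in> ?T"
  then obtain u v w where z: "z = (u, v, w, Tm (gmul G h (ginv G g)) l (Tm h (ginv G g) v (dI g u)) w)"
    and e: "dS g u = dS h v" "dT g u = dT l w"
    by auto
  obtain a where a: "a 0 = g" "smooth_near model_manifold A a 0" "velocity A a = u"
    using curve_with_velocity[OF mA] .
  obtain b where b: "b 0 = h" "smooth_near model_manifold A b 0" "velocity A b = v"
    "eventually (\<lambda>\<tau>. src G (b \<tau>) = src G (a \<tau>)) (nhds 0)"
    by (rule lift_src[of "\<lambda>\<tau>. src G (a \<tau>)" h v])
      (use a gh e smooth_structure_curves(1)[OF a(2)] velocity_structure_maps(1)[OF a(2)] in auto)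
  obtain c where c: "c 0 = l" "smooth_near model_manifold A c 0" "velocity A c = w"
    "eventually (\<lambda>\<tau>. tgt G (c \<tau>) = tgt G (a \<tau>)) (nhds 0)"
    by (rule lift_tgt[of "\<lambda>\<tau>. tgt G (a \<tau>)" l w])
      (use a gl e smooth_structure_curves(2)[OF a(2)] velocity_structure_maps(2)[OF a(2)] in auto)
  have ev3: "eventually (\<lambda>\<tau>. src G (b \<tau>) = tgt G (ginv G (a \<tau>))) (nhds 0)"
    and ev4: "eventually (\<lambda>\<tau>. src G (gmul G (b \<tau>) (ginv G (a \<tau>))) = tgt G (c \<tau>)) (nhds 0)"
    and ev5: "eventually (\<lambda>\<tau>. (a \<tau>, b \<tau>, c \<tau>, gmul G (gmul G (b \<tau>) (ginv G (a \<tau>))) (c \<tau>)) \<in> graph4) (nhds 0)"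
    using b(4) c(4) by (eventually_elim, simp add: src_mul)+
  note si = smooth_structure_curves(3)[OF a(2)]
  note sm = smooth_near_mul[OF mR b(2) si ev3]
  note sq = smooth_near_mul[OF mR sm c(2) ev4]
  note p1 = smooth_near_Pair[OF mR mA mA c(2) sq]
  note p2 = smooth_near_Pair[OF mR mA mAA b(2) p1]
  note p3 = smooth_near_Pair[OF mR mA mAAA a(2) p2]
  let ?\<gamma> = "\<lambda>\<tau>. (a \<tau>, b \<tau>, c \<tau>, gmul G (gmul G (b \<tau>) (ginv G (a \<tau>))) (c \<tau>))"
  have "velocity (A \<times>\<^sub>M A \<times>\<^sub>M A \<times>\<^sub>M A) ?\<gamma> = z"
    using velocity_mul[OF sm c(2) ev4] velocity_mul[OF b(2) si ev3] velocity_structure_maps(3)[OF a(2)]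
    by (simp add: velocity_Pair[OF mA mAAA a(2) p2] velocity_Pair[OF mA mAA b(2) p1] velocity_Pair[OF mA mA c(2) sq]
        a b c z)
  moreover have "curve_in (A \<times>\<^sub>M A \<times>\<^sub>M A \<times>\<^sub>M A) graph4 ?p ?\<gamma>"
    unfolding curve_in_iff[OF mAAAA] using a(1) b(1) c(1) p3 ev5 by simp
  ultimately show "z \<in> tangent_space (A \<times>\<^sub>M A \<times>\<^sub>M A \<times>\<^sub>M A) graph4 ?p"
    unfolding tangent_space_def by blast
qed

text \<open>Negating all \<open>k\<close> covectors costs the sign (-1)^k, so a sign depending on
  parity becomes a change of variables.\<close>

lemma scaleR_sign:
  assumes "\<Lambda> x \<in> multivectors k"
  shows "(((- 1) ^ (k + 1) *\<^sub>R \<Lambda>) x \<xi>) = - \<Lambda> x (\<lambda>i. - \<xi> i)"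
  using multivectors_minus[OF assms, of \<xi>] by (simp add: scaleR_fun_def)

lemma coisotropic3_iff:
  assumes \<Lambda>: "\<And>x. \<Lambda> x \<in> multivectors k"
  shows "coisotropic k (A \<times>\<^sub>M A \<times>\<^sub>M A) graph3 (\<Lambda> \<oplus>\<^sub>M \<Lambda> \<oplus>\<^sub>M (-1) ^ (k + 1) *\<^sub>R \<Lambda>) \<longleftrightarrow> mult_field k \<Lambda>"
proof -
  let ?F = "\<Lambda> \<oplus>\<^sub>M \<Lambda> \<oplus>\<^sub>M (-1) ^ (k + 1) *\<^sub>R \<Lambda>"
  have pt: "(\<forall>\<xi>. (\<forall>i<k. \<forall>z\<in>tangent_space (A \<times>\<^sub>M A \<times>\<^sub>M A) graph3 (g, h, gmul G g h). blinfun_apply (\<xi> i) z = 0) \<longrightarrow>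
        ?F (g, h, gmul G g h) \<xi> = 0) \<longleftrightarrow>
      (\<forall>\<alpha> \<beta> \<gamma>. (\<forall>i<k. cotangent_product g h (\<alpha> i) (\<beta> i) (\<gamma> i)) \<longrightarrow> \<Lambda> (gmul G g h) \<gamma> = \<Lambda> g \<alpha> + \<Lambda> h \<beta>)"
    (is "?L \<longleftrightarrow> ?R") if gh: "src G g = tgt G h" for g h
  proof -
    have "?L \<longleftrightarrow> (\<forall>\<alpha> \<beta> \<gamma>. (\<forall>i<k. \<forall>v w. dS g v = dT h w \<longrightarrow>
        blinfun_apply (\<alpha> i) v + (blinfun_apply (\<beta> i) w + blinfun_apply (- \<gamma> i) (Tm g h v w)) = 0) \<longrightarrow>
        \<Lambda> g \<alpha> + (\<Lambda> h \<beta> - \<Lambda> (gmul G g h) \<gamma>) = 0)"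
      unfolding tangent_space_graph3[OF gh] all_copair oplus_apply copair_compose scaleR_sign[OF \<Lambda>]
      \<comment> \<open>The third quantifier ranges over the covectors at the product; negating them
        turns annihilation into \<open>cotangent_product\<close>.\<close>
      by (subst (3) all_minus) (simp add: Ball_def)
    also have "\<dots> \<longleftrightarrow> ?R"
    proof -
      have "x + (y + - z) = 0 \<longleftrightarrow> z = x + y" "x + (y - z) = 0 \<longleftrightarrow> z = x + y" for x y z :: real
        by auto
      then show ?thesis
        by (simp only: cotangent_product_def blinfun.minus_left)
    qed
    finally show ?thesis .
  qed
  have "coisotropic k (A \<times>\<^sub>M A \<times>\<^sub>M A) graph3 ?F \<longleftrightarrow> (\<forall>g h. src G g = tgt G h \<longrightarrow>
      (\<forall>\<xi>. (\<forall>i<k. \<forall>z\<in>tangent_space (A \<times>\<^sub>M A \<times>\<^sub>M A) graph3 (g, h, gmul G g h). blinfun_apply (\<xi> i) z = 0) \<longrightarrow>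
        ?F (g, h, gmul G g h) \<xi> = 0))"
    unfolding coisotropic_def by blast
  then show ?thesis
    unfolding mult_field_def using pt by simp
qed

lemma coisotropic4_iff:
  assumes \<Lambda>: "\<And>x. \<Lambda> x \<in> multivectors k"
  shows "coisotropic k (A \<times>\<^sub>M A \<times>\<^sub>M A \<times>\<^sub>M A) graph4
      (\<Lambda> \<oplus>\<^sub>M (-1) ^ (k + 1) *\<^sub>R \<Lambda> \<oplus>\<^sub>M (-1) ^ (k + 1) *\<^sub>R \<Lambda> \<oplus>\<^sub>M \<Lambda>) \<longleftrightarrow> affine_field k \<Lambda>"
proof -
  let ?F = "\<Lambda> \<oplus>\<^sub>M (-1) ^ (k + 1) *\<^sub>R \<Lambda> \<oplus>\<^sub>M (-1) ^ (k + 1) *\<^sub>R \<Lambda> \<oplus>\<^sub>M \<Lambda>"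
  let ?m = "\<lambda>g h l. gmul G (gmul G h (ginv G g)) l"
  have pt: "(\<forall>\<xi>. (\<forall>i<k. \<forall>z\<in>tangent_space (A \<times>\<^sub>M A \<times>\<^sub>M A \<times>\<^sub>M A) graph4 (g, h, l, ?m g h l).
        blinfun_apply (\<xi> i) z = 0) \<longrightarrow> ?F (g, h, l, ?m g h l) \<xi> = 0) \<longleftrightarrow>
      (\<forall>\<alpha> \<beta> \<gamma> \<delta>. (\<forall>i<k. quad g h l (\<alpha> i) (\<beta> i) (\<gamma> i) (\<delta> i)) \<longrightarrow>
        \<Lambda> (?m g h l) \<delta> = \<Lambda> h \<beta> - \<Lambda> g \<alpha> + \<Lambda> l \<gamma>)"
    (is "?L \<longleftrightarrow> ?R") if gh: "src G g = src G h" and gl: "tgt G g = tgt G l" for g h l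
  proof -
    have "?L \<longleftrightarrow> (\<forall>\<alpha> \<beta> \<gamma> \<delta>. (\<forall>i<k. \<forall>u v w. dS g u = dS h v \<and> dT g u = dT l w \<longrightarrow>
        blinfun_apply (\<alpha> i) u + (blinfun_apply (- \<beta> i) v + (blinfun_apply (- \<gamma> i) w +
          blinfun_apply (\<delta> i) (Tm (gmul G h (ginv G g)) l (Tm h (ginv G g) v (dI g u)) w))) = 0) \<longrightarrow>
        \<Lambda> g \<alpha> + (- \<Lambda> h \<beta> + (- \<Lambda> l \<gamma> + \<Lambda> (?m g h l) \<delta>)) = 0)"
      unfolding tangent_space_graph4[OF gh gl] all_copair oplus_apply copair_compose scaleR_sign[OF \<Lambda>]
      \<comment> \<open>Negating the covectors at \<open>h\<close> and at \<open>l\<close> produces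
        the signs of \<open>quad\<close>.\<close>
      by (subst (2) all_minus, subst (3) all_minus) (simp add: Ball_def)
    also have "\<dots> \<longleftrightarrow> ?R"
    proof -
      have "x + (- y + (- z + w)) = 0 \<longleftrightarrow> w = y - x + z" for x y z w :: real
        by auto
      then show ?thesis
        by (simp only: quad_def blinfun.minus_left imp_conjL)
    qed
    finally show ?thesis .
  qed
  have "coisotropic k (A \<times>\<^sub>M A \<times>\<^sub>M A \<times>\<^sub>M A) graph4 ?F \<longleftrightarrow> (\<forall>g h l. src G g = src G h \<longrightarrow> tgt G g = tgt G l \<longrightarrow>
      (\<forall>\<xi>. (\<forall>i<k. \<forall>z\<in>tangent_space (A \<times>\<^sub>M A \<times>\<^sub>M A \<times>\<^sub>M A) graph4 (g, h, l, ?m g h l). blinfun_apply (\<xi> i) z = 0) \<longrightarrow>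
        ?F (g, h, l, ?m g h l) \<xi> = 0))"
    unfolding coisotropic_def by blast
  then show ?thesis
    unfolding affine_field_def using pt by simp
qed

lemma multiplicative_fields_iff:
  "\<Lambda> \<in> multiplicative_fields G k \<longleftrightarrow> \<Lambda> \<in> multivector_fields k A \<and> mult_field k \<Lambda>"
  using coisotropic3_iff[of \<Lambda> k] by (auto simp: multiplicative_fields_def multivector_fields_def)

lemma affine_fields_iff:
  "\<Lambda> \<in> affine_fields G k \<longleftrightarrow> \<Lambda> \<in> multivector_fields k A \<and> affine_field k \<Lambda>"
  using coisotropic4_iff[of \<Lambda> k] by (auto simp: affine_fields_def multivector_fields_def)

end

section \<open>Smoothness of the translates\<close>

lemma multivectors_add:
  assumes "\<omega> \<in> multivectors k" "\<omega>' \<in> multivectors k"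
  shows "\<omega> + \<omega>' \<in> multivectors k"
  unfolding multivectors_iff plus_fun_def
proof (intro conjI allI impI)
  show "\<omega> \<xi> + \<omega>' \<xi> = \<omega> \<eta> + \<omega>' \<eta>" if "\<forall>i<k. \<xi> i = \<eta> i" for \<xi> \<eta>
    using multivectors_local[OF assms(1), of \<xi> \<eta>] multivectors_local[OF assms(2), of \<xi> \<eta>] that by simp
  show "linear (\<lambda>\<alpha>. \<omega> (\<xi>(i := \<alpha>)) + \<omega>' (\<xi>(i := \<alpha>)))" if "i < k" for \<xi> i
    by (intro linear_compose_add multivectors_linear[OF _ that] assms)
  show "\<omega> \<xi> + \<omega>' \<xi> = 0" if "i < k" "j < k" "i \<noteq> j" "\<xi> i = \<xi> j" for \<xi> i j
    using multivectors_alternating[OF assms(1) that] multivectors_alternating[OF assms(2) that] by simp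
qed

lemma multivectors_scaleR:
  assumes "\<omega> \<in> multivectors k"
  shows "r *\<^sub>R \<omega> \<in> multivectors k"
  unfolding multivectors_iff scaleR_fun_def
proof (intro conjI allI impI)
  show "r *\<^sub>R \<omega> \<xi> = r *\<^sub>R \<omega> \<eta>" if "\<forall>i<k. \<xi> i = \<eta> i" for \<xi> \<eta>
    using multivectors_local[OF assms(1), of \<xi> \<eta>] that by simp
  show "linear (\<lambda>\<alpha>. r *\<^sub>R \<omega> (\<xi>(i := \<alpha>)))" if "i < k" for \<xi> i
    by (intro linear_compose_scale_right multivectors_linear[OF _ that] assms)
  show "r *\<^sub>R \<omega> \<xi> = 0" if "i < k" "j < k" "i \<noteq> j" "\<xi> i = \<xi> j" for \<xi> i j
    using multivectors_alternating[OF assms(1) that] by simp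
qed

lemma multivector_fieldsD:
  assumes "\<Lambda> \<in> multivector_fields k N"
  shows "\<Lambda> x \<in> multivectors k"
    and "c \<in> Atlas N \<Longrightarrow> smooth_on (snd c ` fst c)
      (\<lambda>y. pushforward (tangent_map N model_manifold (snd c) (chart_inv c y)) (\<Lambda> (chart_inv c y)) \<eta>)"
  using assms by (auto simp: multivector_fields_def Let_def)

lemma multivector_fieldsI:
  assumes "\<And>x. \<Lambda> x \<in> multivectors k"
    and "\<And>c \<eta>. c \<in> Atlas N \<Longrightarrow> smooth_on (snd c ` fst c)
      (\<lambda>y. pushforward (tangent_map N model_manifold (snd c) (chart_inv c y)) (\<Lambda> (chart_inv c y)) \<eta>)"
  shows "\<Lambda> \<in> multivector_fields k N"
  using assms by (simp add: multivector_fields_def Let_def)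

lemma subspace_multivector_fields:
  assumes N: "smooth_manifold N"
  shows "subspace (multivector_fields k N)"
  unfolding subspace_def
proof (intro conjI ballI allI)
  show "0 \<in> multivector_fields k N"
    by (rule multivector_fieldsI)
      (auto simp: multivectors_iff pushforward_def zero_fun_def smooth_on_const intro: linear_zero)
  show "\<Lambda> + \<Lambda>' \<in> multivector_fields k N" if "\<Lambda> \<in> multivector_fields k N" "\<Lambda>' \<in> multivector_fields k N" for \<Lambda> \<Lambda>'
  proof (rule multivector_fieldsI)
    show "(\<Lambda> + \<Lambda>') x \<in> multivectors k" for x
      using multivectors_add[OF multivector_fieldsD(1)[OF that(1)] multivector_fieldsD(1)[OF that(2)], of x] by simp
    show "smooth_on (snd c ` fst c)
      (\<lambda>y. pushforward (tangent_map N model_manifold (snd c) (chart_inv c y)) ((\<Lambda> + \<Lambda>') (chart_inv c y)) \<eta>)"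
      if c: "c \<in> Atlas N" for c \<eta>
      using smooth_on_add[OF chart_image_open_all[OF N c] multivector_fieldsD(2)[OF \<open>\<Lambda> \<in> multivector_fields k N\<close> c]
          multivector_fieldsD(2)[OF \<open>\<Lambda>' \<in> multivector_fields k N\<close> c]] by (simp add: pushforward_def)
  qed
  show "r *\<^sub>R \<Lambda> \<in> multivector_fields k N" if "\<Lambda> \<in> multivector_fields k N" for r \<Lambda>
  proof (rule multivector_fieldsI)
    show "(r *\<^sub>R \<Lambda>) x \<in> multivectors k" for x
      using multivectors_scaleR[OF multivector_fieldsD(1)[OF that], of r x] by (simp add: scaleR_fun_def)
    show "smooth_on (snd c ` fst c)
      (\<lambda>y. pushforward (tangent_map N model_manifold (snd c) (chart_inv c y)) ((r *\<^sub>R \<Lambda>) (chart_inv c y)) \<eta>)"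
      if c: "c \<in> Atlas N" for c \<eta>
      using smooth_on_bounded_linear_compose[OF bounded_linear_scaleR_right[of r] chart_image_open_all[OF N c]
          multivector_fieldsD(2)[OF \<open>\<Lambda> \<in> multivector_fields k N\<close> c]] by (simp add: pushforward_def scaleR_fun_def)
  qed
qed

text \<open>Smooth components on constant covectors are transferred to moving ones slot by slot,
  expanding \<open>\<zeta> x j\<close> in the functionals \<open>cf b\<close> with smooth
  coefficients.\<close>

lemma smooth_on_multivector_apply:
  fixes \<omega> :: "'a::real_normed_vector \<Rightarrow> 'e::real_normed_vector multivector" and \<zeta> :: "'a \<Rightarrow> nat \<Rightarrow> 'e \<Rightarrow>\<^sub>L real"
  assumes fin: "findim TYPE('e)" and V: "open V" and \<omega>: "\<And>x. x \<in> V \<Longrightarrow> \<omega> x \<in> multivectors k"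
    and sm: "\<And>\<xi>. smooth_on V (\<lambda>x. \<omega> x \<xi>)" and \<zeta>: "\<And>i b. smooth_on V (\<lambda>x. blinfun_apply (\<zeta> x i) b)"
  shows "smooth_on V (\<lambda>x. \<omega> x (\<zeta> x))"
proof -
  obtain B and cf :: "'e \<Rightarrow> 'e \<Rightarrow>\<^sub>L real" where B: "coordinates B cf"
    using fin by (rule findimE)
  \<comment> \<open>The coordinate functionals span the dual space, with the values on
    \<open>B\<close> as coefficients.\<close>
  have expand: "(\<Sum>b\<in>B. blinfun_apply \<beta> b *\<^sub>R cf b) = \<beta>" for \<beta> :: "'e \<Rightarrow>\<^sub>L real"
  proof (rule blinfun_eqI)
    fix v
    have "blinfun_apply \<beta> v = (\<Sum>b\<in>B. blinfun_apply (cf b) v *\<^sub>R blinfun_apply \<beta> b)"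
      by (rule linear_coordinates[OF B bounded_linear.linear[OF blinfun.bounded_linear_right]])
    then show "blinfun_apply (\<Sum>b\<in>B. blinfun_apply \<beta> b *\<^sub>R cf b) v = blinfun_apply \<beta> v"
      by (simp add: blinfun.sum_left blinfun.scaleR_left mult.commute)
  qed
  \<comment> \<open>Slots below \<open>j\<close> move and the others are fixed; \<open>\<xi>\<close>
    stays arbitrary so that slot \<open>j\<close> can be set to each \<open>cf b\<close>.\<close>
  have "smooth_on V (\<lambda>x. \<omega> x (\<lambda>i. if i < j then \<zeta> x i else \<xi> i))" if "j \<le> k" for j \<xi>
    using that
  proof (induction j arbitrary: \<xi>)
    case 0
    show ?case
      using sm by simp
  next
    case (Suc j)
    let ?\<eta> = "\<lambda>x i. if i < j then \<zeta> x i else \<xi> i"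
    have eq: "\<omega> x (\<lambda>i. if i < Suc j then \<zeta> x i else \<xi> i) =
        (\<Sum>b\<in>B. blinfun_apply (\<zeta> x j) b * \<omega> x (\<lambda>i. if i < j then \<zeta> x i else (\<xi>(j := cf b)) i))" if "x \<in> V" for x
    proof -
      note lin = multivectors_linear[OF \<omega>[OF that] Suc_le_lessD[OF Suc.prems], of "?\<eta> x"]
      have upd: "(?\<eta> x)(j := cf b) = (\<lambda>i. if i < j then \<zeta> x i else (\<xi>(j := cf b)) i)" for b
        by (auto simp: fun_eq_iff)
      have "(\<lambda>i. if i < Suc j then \<zeta> x i else \<xi> i) = (?\<eta> x)(j := \<zeta> x j)"
        by (auto simp: fun_eq_iff)
      then have "\<omega> x (\<lambda>i. if i < Suc j then \<zeta> x i else \<xi> i) =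
          \<omega> x ((?\<eta> x)(j := \<Sum>b\<in>B. blinfun_apply (\<zeta> x j) b *\<^sub>R cf b))"
        by (simp only: expand)
      also have "\<dots> = (\<Sum>b\<in>B. blinfun_apply (\<zeta> x j) b * \<omega> x ((?\<eta> x)(j := cf b)))"
        by (simp add: linear_sum[OF lin] linear_scale[OF lin])
      finally show ?thesis
        unfolding upd .
    qed
    have "smooth_on V (\<lambda>x. \<Sum>b\<in>B. blinfun_apply (\<zeta> x j) b * \<omega> x (\<lambda>i. if i < j then \<zeta> x i else (\<xi>(j := cf b)) i))"
      using B Suc by (intro smooth_on_sum V smooth_on_mult \<zeta>) (auto simp: coordinates_def)
    then show ?case
      by (rule iffD1[OF smooth_on_cong[OF V], rotated]) (simp add: eq)
  qed
  from this[of k "\<lambda>_. 0"] have "smooth_on V (\<lambda>x. \<omega> x (\<lambda>i. if i < k then \<zeta> x i else 0))"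
    by simp
  then show ?thesis
    by (rule iffD1[OF smooth_on_cong[OF V], rotated]) (auto intro!: multivectors_local[OF \<omega>])
qed

definition partial_tangent ::
  "('a::topological_space, 'e::banach) manifold \<Rightarrow> ('a \<times> 'a \<Rightarrow> 'a) \<Rightarrow> 'a \<Rightarrow> 'a \<Rightarrow> 'e \<Rightarrow> 'e" where
  "partial_tangent N \<Phi> p g = tangent_map N N (\<lambda>p. \<Phi> (p, g)) p"

text \<open>In charts a partial derivative is the total derivative on vectors \<open>(b, 0)\<close>;
  in this form its smooth dependence on both \<open>p\<close> and \<open>g\<close> is
  visible.\<close>

lemma partial_tangent_in_charts:
  assumes N: "smooth_manifold (N :: ('a::topological_space, 'e::banach) manifold)"
    and c: "c \<in> Atlas N" "g \<in> fst c" and d: "d \<in> Atlas N" "p \<in> fst d"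
    and \<Phi>: "smooth_near (N \<times>\<^sub>M N) N \<Phi> (p, g)" "\<Phi> (p, g) \<in> fst c"
    and W: "open W" "(snd d p, snd c g) \<in> W" "smooth_on W (\<lambda>q. snd c (\<Phi> (chart_inv (chart_prod d c) q)))"
  shows "tangent_map N model_manifold (snd c) (\<Phi> (p, g)) (partial_tangent N \<Phi> p g u) =
    frechet_derivative (\<lambda>q. snd c (\<Phi> (chart_inv (chart_prod d c) q))) (at (snd d p, snd c g))
      (tangent_map N model_manifold (snd d) p u, 0)"
proof -
  define \<psi> where "\<psi> q = snd c (\<Phi> (chart_inv (chart_prod d c) q))" for q
  let ?z = "snd c g"
  note fin = smooth_manifold_findim[OF N] and NN = smooth_manifold_prod[OF N N]
  note mE = smooth_manifold_model[OF fin]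
  have s: "smooth_near N N (\<lambda>p. \<Phi> (p, g)) p"
    by (rule smooth_near_compose[OF N NN N smooth_near_Pair[OF N N N smooth_near_ident[OF N] smooth_near_const[OF N N]] \<Phi>(1)])
  have "tangent_map N model_manifold (snd c) (\<Phi> (p, g)) (partial_tangent N \<Phi> p g u) =
      tangent_map N model_manifold (\<lambda>p. snd c (\<Phi> (p, g))) p u"
    unfolding partial_tangent_def
    by (rule tangent_map_compose[OF N N mE s smooth_near_chart[OF N c(1) \<Phi>(2)], symmetric])
  also have "tangent_map N model_manifold (\<lambda>p. snd c (\<Phi> (p, g))) p = tangent_map N model_manifold (\<lambda>p. \<psi> (snd d p, ?z)) p"
  proof (rule tangent_map_cong[OF N])
    have "snd c (\<Phi> (p, g)) = \<psi> (snd d p, ?z)" if "p \<in> fst d" for p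
      using that c(2) by (simp add: \<psi>_def chart_inv_prod'[OF N d(1) N c(1)] chart_inv_chart[OF N d(1)] chart_inv_chart[OF N c(1)])
    then show "eventually (\<lambda>p. snd c (\<Phi> (p, g)) = \<psi> (snd d p, ?z)) (nhds p)"
      unfolding eventually_nhds using chart_open[OF N d(1)] d(2) by blast
  qed
  also have "\<dots> u = frechet_derivative (\<lambda>b. \<psi> (b, ?z)) (at (snd d p)) (tangent_map N model_manifold (snd d) p u)"
  proof -
    have o: "open ((\<lambda>b. (b, ?z)) -` W)"
      using W(1) by (intro open_vimage continuous_intros)
    have "smooth_on ((\<lambda>b. (b, ?z)) -` W) (\<lambda>b. \<psi> (b, ?z))"
      unfolding \<psi>_def
      by (rule smooth_on_compose[OF findim_prod[OF fin fin] o W(3)])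
        (auto intro!: smooth_on_Pair o smooth_on_ident smooth_on_const)
    then have s2: "smooth_near model_manifold model_manifold (\<lambda>b. \<psi> (b, ?z)) (snd d p)"
      by (rule smooth_near_modelI[OF fin fin o, rotated]) (use W(2) in simp)
    show ?thesis
      unfolding tangent_map_model[symmetric]
      by (rule tangent_map_compose[OF N mE mE smooth_near_chart[OF N d] s2])
  qed
  also have "frechet_derivative (\<lambda>b. \<psi> (b, ?z)) (at (snd d p)) = (\<lambda>b. frechet_derivative \<psi> (at (snd d p, ?z)) (b, 0))"
  proof (rule frechet_derivative_eqI)
    have "(\<psi> has_derivative frechet_derivative \<psi> (at (snd d p, ?z))) (at (snd d p, ?z))"
      using smooth_on_differentiable[OF W(3,2)] unfolding \<psi>_def by (rule has_frechet_derivative)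
    then show "((\<lambda>b. \<psi> (b, ?z)) has_derivative (\<lambda>b. frechet_derivative \<psi> (at (snd d p, ?z)) (b, 0))) (at (snd d p))"
      using has_derivative_compose[of "\<lambda>b. (b, ?z)" "\<lambda>b. (b, 0)" "snd d p" UNIV \<psi>]
      by (simp add: has_derivative_Pair)
  qed
  finally show ?thesis
    by (simp add: \<psi>_def[abs_def])
qed

text \<open>In charts \<open>L\<close> becomes a smooth family of linear maps, whose transposes act
  on the covectors fed to \<open>\<Lambda>\<close> at \<open>\<phi> g\<close>. A difference of two
  partial derivatives is allowed because the projection onto A is one; the equations for
  \<open>\<Phi>\<close> and \<open>\<Phi>'\<close> place both in the tangent space at
  \<open>g\<close>.\<close>

lemma pushforward_family_smooth:
  assumes N: "smooth_manifold (N :: ('a::topological_space, 'e::banach) manifold)"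
    and \<Lambda>: "\<Lambda> \<in> multivector_fields k N"
    and \<phi>: "\<And>g. smooth_near N N \<phi> g"
    and lin: "\<And>g. linear (L g)"
    and L: "\<And>g0. \<exists>\<Phi> \<Phi>'. smooth_near (N \<times>\<^sub>M N) N \<Phi> (\<phi> g0, g0) \<and> smooth_near (N \<times>\<^sub>M N) N \<Phi>' (\<phi> g0, g0) \<and>
      eventually (\<lambda>g. \<Phi> (\<phi> g, g) = g \<and> \<Phi>' (\<phi> g, g) = g \<and>
        (\<forall>u. L g u = partial_tangent N \<Phi> (\<phi> g) g u - partial_tangent N \<Phi>' (\<phi> g) g u)) (nhds g0)"
  shows "(\<lambda>g. pushforward (L g) (\<Lambda> (\<phi> g))) \<in> multivector_fields k N"
proof (rule multivector_fieldsI)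
  show "pushforward (L g) (\<Lambda> (\<phi> g)) \<in> multivectors k" for g
    by (intro pushforward_multivectors multivector_fieldsD(1)[OF \<Lambda>])
  fix c \<eta> assume c: "c \<in> Atlas N"
  note fin = smooth_manifold_findim[OF N] and NN = smooth_manifold_prod[OF N N]
  note mE = smooth_manifold_model[OF fin]
  let ?f = "\<lambda>y. pushforward (tangent_map N model_manifold (snd c) (chart_inv c y))
    (pushforward (L (chart_inv c y)) (\<Lambda> (\<phi> (chart_inv c y)))) \<eta>"
  show "smooth_on (snd c ` fst c) ?f"
  proof (rule smooth_on_locally)
    fix y0 assume y0: "y0 \<in> snd c ` fst c"
    define g0 where "g0 = chart_inv c y0"
    have g0: "g0 \<in> fst c" "snd c g0 = y0"
      using y0 by (auto simp: g0_def chart_inv_in[OF N c] chart_chart_inv[OF N c])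
    let ?d = "chart_at N (\<phi> g0)"
    note d = chart_at_Atlas[OF N, of "\<phi> g0"] and d0 = in_chart_at[OF N, of "\<phi> g0"]
    obtain \<Phi> \<Phi>' where \<Phi>: "smooth_near (N \<times>\<^sub>M N) N \<Phi> (\<phi> g0, g0)" "smooth_near (N \<times>\<^sub>M N) N \<Phi>' (\<phi> g0, g0)"
      and ev: "eventually (\<lambda>g. \<Phi> (\<phi> g, g) = g \<and> \<Phi>' (\<phi> g, g) = g \<and>
        (\<forall>u. L g u = partial_tangent N \<Phi> (\<phi> g) g u - partial_tangent N \<Phi>' (\<phi> g) g u)) (nhds g0)"
      using L by blast
    have at0: "\<Phi> (\<phi> g0, g0) = g0" "\<Phi>' (\<phi> g0, g0) = g0"
      using eventually_nhds_x_imp_x[OF ev] by auto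
    have s\<phi>: "smooth_near N (N \<times>\<^sub>M N) (\<lambda>g. (\<phi> g, g)) g0"
      by (rule smooth_near_Pair[OF N N N \<phi> smooth_near_ident[OF N]])
    have ev2: "eventually (\<lambda>g. smooth_near (N \<times>\<^sub>M N) N \<Phi> (\<phi> g, g) \<and> smooth_near (N \<times>\<^sub>M N) N \<Phi>' (\<phi> g, g)) (nhds g0)"
      using \<Phi>[THEN smooth_near_eventually, THEN smooth_near_eventually_compose[OF s\<phi>]] by (rule eventually_conj)
    have "eventually (\<lambda>y. (\<Phi> (\<phi> (chart_inv c y), chart_inv c y) = chart_inv c y \<and>
        \<Phi>' (\<phi> (chart_inv c y), chart_inv c y) = chart_inv c y \<and>
        (\<forall>u. L (chart_inv c y) u = partial_tangent N \<Phi> (\<phi> (chart_inv c y)) (chart_inv c y) u -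
           partial_tangent N \<Phi>' (\<phi> (chart_inv c y)) (chart_inv c y) u)) \<and>
        smooth_near (N \<times>\<^sub>M N) N \<Phi> (\<phi> (chart_inv c y), chart_inv c y) \<and>
        smooth_near (N \<times>\<^sub>M N) N \<Phi>' (\<phi> (chart_inv c y), chart_inv c y)) (nhds (snd c g0))"
      using filterlim_iff[THEN iffD1, rule_format, OF chart_inv_filterlim[OF N c g0(1)] eventually_conj[OF ev ev2]] .
    then obtain S where S: "open S" "y0 \<in> S" and
      inS: "\<And>y. y \<in> S \<Longrightarrow> \<Phi> (\<phi> (chart_inv c y), chart_inv c y) = chart_inv c y"
        "\<And>y. y \<in> S \<Longrightarrow> \<Phi>' (\<phi> (chart_inv c y), chart_inv c y) = chart_inv c y"
        "\<And>y u. y \<in> S \<Longrightarrow> L (chart_inv c y) u = partial_tangent N \<Phi> (\<phi> (chart_inv c y)) (chart_inv c y) u -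
           partial_tangent N \<Phi>' (\<phi> (chart_inv c y)) (chart_inv c y) u"
        "\<And>y. y \<in> S \<Longrightarrow> smooth_near (N \<times>\<^sub>M N) N \<Phi> (\<phi> (chart_inv c y), chart_inv c y)"
        "\<And>y. y \<in> S \<Longrightarrow> smooth_near (N \<times>\<^sub>M N) N \<Phi>' (\<phi> (chart_inv c y), chart_inv c y)"
      unfolding eventually_nhds g0(2) by (elim exE conjE) simp
    have dc: "chart_prod ?d c \<in> Atlas (N \<times>\<^sub>M N)" "(\<phi> g0, g0) \<in> fst (chart_prod ?d c)"
      using d c d0 g0 by (auto simp: prod_manifold_def)
    obtain V0 where V0: "open V0" "y0 \<in> V0" "V0 \<subseteq> snd c ` fst c" "\<And>y. y \<in> V0 \<Longrightarrow> \<phi> (chart_inv c y) \<in> fst ?d"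
      "smooth_on V0 (\<lambda>y. snd ?d (\<phi> (chart_inv c y)))"
      using smooth_nearD[OF N N \<phi> c g0(1) d d0] unfolding smooth_in_charts_def g0(2) by (elim exE conjE) simp
    let ?q = "\<lambda>y. snd ?d (\<phi> (chart_inv c y))"
    let ?\<psi> = "\<lambda>\<Phi> q. snd c (\<Phi> (chart_inv (chart_prod ?d c) q))"
    have "\<exists>W. open W \<and> (?q y0, y0) \<in> W \<and> smooth_on W (?\<psi> \<Phi>)"
      if "smooth_near (N \<times>\<^sub>M N) N \<Phi> (\<phi> g0, g0)" "\<Phi> (\<phi> g0, g0) = g0" for \<Phi>
      using smooth_nearD[OF NN N that(1) dc c] that(2) g0 unfolding smooth_in_charts_def by (auto simp: g0_def)
    from this[OF \<Phi>(1) at0(1)] this[OF \<Phi>(2) at0(2)]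
    obtain W W' where W: "open W" "(?q y0, y0) \<in> W" "smooth_on W (?\<psi> \<Phi>)"
      and W': "open W'" "(?q y0, y0) \<in> W'" "smooth_on W' (?\<psi> \<Phi>')"
      by blast
    define V where "V = {y \<in> V0. (?q y, y) \<in> W \<inter> W'} \<inter> S"
    have cont: "continuous_on V0 (\<lambda>y. (?q y, y))"
      by (intro continuous_intros smooth_on_continuous_on[OF V0(5)])
    have V: "open V"
      unfolding V_def using W(1) W'(1) S(1) by (intro open_Int open_preimage_on[OF cont V0(1)]) auto
    have y0V: "y0 \<in> V"
      using V0(2) W(2) W'(2) S(2) by (simp add: V_def)
    have smq: "smooth_on V ?q"
      by (rule smooth_on_subset[OF V0(5)]) (auto simp: V_def)
    have smqy: "smooth_on V (\<lambda>y. (?q y, y))"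
      by (intro smooth_on_Pair V smq smooth_on_ident)
    \<comment> \<open>This is \<open>L\<close> at the point with coordinates \<open>y\<close>, read
      in the chart at \<open>\<phi> g0\<close> and in \<open>c\<close>.\<close>
    define P where "P y b = frechet_derivative (?\<psi> \<Phi>) (at (?q y, y)) (b, 0) -
      frechet_derivative (?\<psi> \<Phi>') (at (?q y, y)) (b, 0)" for y b
    have smP: "smooth_on V (\<lambda>y. P y b)" for b
      unfolding P_def
      by (intro smooth_on_diff V smooth_on_compose[OF findim_prod[OF fin fin] V smooth_on_frechet_derivative[OF W(3)] smqy]
          smooth_on_compose[OF findim_prod[OF fin fin] V smooth_on_frechet_derivative[OF W'(3)] smqy]) (auto simp: V_def)
    have linP: "bounded_linear (P y)" if "y \<in> V" for y
    proof -
      have "(?q y, y) \<in> W" "(?q y, y) \<in> W'"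
        using that by (auto simp: V_def)
      then have "bounded_linear (frechet_derivative (?\<psi> \<Phi>) (at (?q y, y)))"
        "bounded_linear (frechet_derivative (?\<psi> \<Phi>') (at (?q y, y)))"
        using smooth_on_differentiable[OF W(3)] smooth_on_differentiable[OF W'(3)]
          has_derivative_bounded_linear has_frechet_derivative by blast+
      then show ?thesis
        unfolding P_def
        by (intro bounded_linear_sub bounded_linear_compose[OF _ bounded_linear_inclusions(1)])
    qed
    define \<omega> where "\<omega> y = pushforward (tangent_map N model_manifold (snd ?d) (\<phi> (chart_inv c y))) (\<Lambda> (\<phi> (chart_inv c y)))" for y
    \<comment> \<open>Components of the new field in \<open>c\<close> are components of
      \<open>\<Lambda>\<close> in the chart at \<open>\<phi> g0\<close>, taken on covectors moved by
      the transpose of \<open>P y\<close>.\<close>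
    have key: "?f y = \<omega> y (\<lambda>i. \<eta> i o\<^sub>L Blinfun (P y))" if y: "y \<in> V" for y
    proof -
      let ?g = "chart_inv c y"
      have yi: "y \<in> snd c ` fst c" and gc: "?g \<in> fst c" and cg: "snd c ?g = y" and \<phi>d: "\<phi> ?g \<in> fst ?d" and yS: "y \<in> S"
        using y V0(3,4) by (auto simp: V_def chart_inv_in[OF N c] chart_chart_inv[OF N c] subset_iff)
      note Tc = tangent_map_bounded_linear[OF N mE smooth_near_chart[OF N c gc]]
      note Td = tangent_map_bounded_linear[OF N mE smooth_near_chart[OF N d \<phi>d]]
      have WW: "(snd ?d (\<phi> ?g), snd c ?g) \<in> W" "(snd ?d (\<phi> ?g), snd c ?g) \<in> W'"
        using y cg by (auto simp: V_def)
      have "tangent_map N model_manifold (snd c) ?g (L ?g u) = P y (tangent_map N model_manifold (snd ?d) (\<phi> ?g) u)" for u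
        using partial_tangent_in_charts[OF N c gc d \<phi>d inS(4)[OF yS] _ W(1) WW(1) W(3), of u]
          partial_tangent_in_charts[OF N c gc d \<phi>d inS(5)[OF yS] _ W'(1) WW(2) W'(3), of u]
        by (simp add: inS(1-3)[OF yS] gc cg P_def linear_diff[OF bounded_linear.linear[OF Tc]])
      then have "(\<eta> i o\<^sub>L Blinfun (tangent_map N model_manifold (snd c) ?g)) o\<^sub>L Blinfun (L ?g) =
          (\<eta> i o\<^sub>L Blinfun (P y)) o\<^sub>L Blinfun (tangent_map N model_manifold (snd ?d) (\<phi> ?g))" for i
        by (intro blinfun_eqI) (simp add: bounded_linear_Blinfun_apply[OF Tc] bounded_linear_Blinfun_apply[OF Td]
            bounded_linear_Blinfun_apply[OF linP[OF y]] bounded_linear_Blinfun_apply[OF findim_linear_bounded[OF fin lin]])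
      then show ?thesis
        by (simp add: pushforward_def \<omega>_def)
    qed
    have "smooth_on V (\<lambda>y. \<omega> y (\<lambda>i. \<eta> i o\<^sub>L Blinfun (P y)))"
    proof (rule smooth_on_multivector_apply[OF fin V])
      show "\<omega> y \<in> multivectors k" for y
        unfolding \<omega>_def by (intro pushforward_multivectors multivector_fieldsD(1)[OF \<Lambda>])
      show "smooth_on V (\<lambda>y. \<omega> y \<xi>)" for \<xi>
      proof -
        have "smooth_on V (\<lambda>y. pushforward (tangent_map N model_manifold (snd ?d) (chart_inv ?d (?q y))) (\<Lambda> (chart_inv ?d (?q y))) \<xi>)"
          by (rule smooth_on_compose[OF fin V multivector_fieldsD(2)[OF \<Lambda> d] smq]) (use V0(4) in \<open>auto simp: V_def\<close>)
        then show ?thesis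
          by (rule iffD1[OF smooth_on_cong[OF V], rotated])
            (use V0(4) in \<open>auto simp: V_def \<omega>_def chart_inv_chart[OF N d]\<close>)
      qed
      show "smooth_on V (\<lambda>y. blinfun_apply (\<eta> i o\<^sub>L Blinfun (P y)) b)" for i b
      proof -
        have "smooth_on V (\<lambda>y. blinfun_apply (\<eta> i) (P y b))"
          by (rule smooth_on_bounded_linear_compose[OF blinfun.bounded_linear_right V smP])
        then show ?thesis
          by (rule iffD1[OF smooth_on_cong[OF V], rotated]) (simp add: bounded_linear_Blinfun_apply[OF linP])
      qed
    qed
    then have "smooth_on V ?f"
      by (rule iffD1[OF smooth_on_cong[OF V], rotated]) (simp add: key)
    then show "\<exists>V. open V \<and> y0 \<in> V \<and> smooth_on V ?f"
      using V y0V by blast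
  qed
qed

section \<open>Smoothness of translates on a Lie groupoid\<close>

context lie
begin

text \<open>Both clauses concern germs and so persist at nearby base points; one extension serves a
  whole neighbourhood.\<close>

lemma is_local_mul_eventually:
  assumes "is_local_mul g h F"
  shows "eventually (\<lambda>p. is_local_mul (fst p) (snd p) F) (nhds (g, h))"
proof -
  have "eventually (smooth_near (A \<times>\<^sub>M A) A F) (nhds (g, h))"
    "eventually (\<lambda>q. eventually (\<lambda>p. src G (fst p) = tgt G (snd p) \<longrightarrow> F p = gmul G (fst p) (snd p)) (nhds q)) (nhds (g, h))"
    using assms by (auto simp: is_local_mul_def eventually_eventually intro: smooth_near_eventually)
  then show ?thesis
    by eventually_elim (simp add: is_local_mul_def)
qed

text \<open>Along composable curves every extension agrees with the true product, so all extensions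
  have the same derivative on composable vectors.\<close>

lemma Tm_eq:
  assumes F: "is_local_mul g h F" and gh: "src G g = tgt G h" and e: "dS g v = dT h w"
  shows "Tm g h v w = tangent_map (A \<times>\<^sub>M A) A F (g, h) (v, w)"
proof -
  obtain a b where ab: "a 0 = g" "b 0 = h" "smooth_near model_manifold A a 0" "smooth_near model_manifold A b 0"
    "velocity A a = v" "velocity A b = w" and ev: "eventually (\<lambda>\<tau>. src G (a \<tau>) = tgt G (b \<tau>)) (nhds 0)"
    using composable_curves[OF gh e] .
  have P: "smooth_near model_manifold (A \<times>\<^sub>M A) (\<lambda>\<tau>. (a \<tau>, b \<tau>)) 0"
    by (rule smooth_near_Pair[OF mR mA mA ab(3,4)])
  have F': "smooth_near (A \<times>\<^sub>M A) A F (a 0, b 0)"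
    "eventually (\<lambda>p. src G (fst p) = tgt G (snd p) \<longrightarrow> F p = gmul G (fst p) (snd p)) (nhds (a 0, b 0))"
    using F ab by (auto simp: is_local_mul_def)
  have ev2: "eventually (\<lambda>\<tau>. gmul G (a \<tau>) (b \<tau>) = F (a \<tau>, b \<tau>)) (nhds 0)"
    using smooth_near_eventually_compose[OF P F'(2)] ev by eventually_elim simp
  have "Tm g h v w = velocity A (\<lambda>\<tau>. F (a \<tau>, b \<tau>))"
    using velocity_mul[OF ab(3,4) ev] velocity_cong[OF ev2, of A] ab by simp
  also have "\<dots> = tangent_map (A \<times>\<^sub>M A) A F (g, h) (v, w)"
    using velocity_compose[OF mAA mA P F'(1)] velocity_Pair[OF mA mA ab(3,4)] ab by simp
  finally show ?thesis .
qed

lemma smooth_src_unit: "smooth_near A A (\<lambda>p. one G (src G p)) g" 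
  and smooth_tgt_unit: "smooth_near A A (\<lambda>p. one G (tgt G p)) g"
  by (rule smooth_near_compose[OF mA mM mA smooth_structure_maps(1,3)]
      smooth_near_compose[OF mA mM mA smooth_structure_maps(2,3)])+

lemma dI_d1: "dI (one G x) (d1 x y) = d1 x y"
  by (simp add: dI_one)

text \<open>The two auxiliary maps are \<open>(p, g) \<mapsto> pg\<close> and \<open>(p, g) \<mapsto> 1\<^bsub>s(p)\<^esub>g\<close>: the difference of their partial
  derivatives at \<open>p = 1\<^bsub>t(g)\<^esub>\<close> is right translation precomposed with the projection onto \<open>A\<close>.\<close>

lemma right_trans_multivector_field:
  assumes "\<Lambda> \<in> multivector_fields k A"
  shows "right_trans \<Lambda> \<in> multivector_fields k A"
proof -
  let ?\<phi> = "\<lambda>g. one G (tgt G g)" and ?L = "\<lambda>g v. Tm (one G (tgt G g)) g (prA (tgt G g) v) 0"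
  have "(\<lambda>g. pushforward (?L g) (\<Lambda> (?\<phi> g))) \<in> multivector_fields k A"
  proof (rule pushforward_family_smooth[OF mA assms smooth_tgt_unit right_translation_linear])
    fix g0
    let ?F = "local_mul (?\<phi> g0) g0"
    let ?F' = "\<lambda>p. ?F (one G (src G (fst p)), snd p)"
    have F: "is_local_mul (?\<phi> g0) g0 ?F"
      by (rule is_local_mul) simp
    have s: "smooth_near (A \<times>\<^sub>M A) (A \<times>\<^sub>M A) (\<lambda>p. (one G (src G (fst p)), snd p)) q" for q
      by (rule smooth_near_Pair[OF mAA mA mA smooth_near_compose[OF mAA mA mA smooth_near_fst[OF mA mA] smooth_src_unit]
            smooth_near_snd[OF mA mA]])
    have s1: "smooth_near (A \<times>\<^sub>M A) A ?F (?\<phi> g0, g0)"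
      using F by (simp add: is_local_mul_def)
    have s2: "smooth_near (A \<times>\<^sub>M A) A ?F' (?\<phi> g0, g0)"
      by (rule smooth_near_compose[OF mAA mAA mA s]) (simp add: s1)
    have "smooth_near A (A \<times>\<^sub>M A) (\<lambda>g. (?\<phi> g, g)) g0"
      by (rule smooth_near_Pair[OF mA mA mA smooth_tgt_unit smooth_near_ident[OF mA]])
    from smooth_near_eventually_compose[OF this is_local_mul_eventually[OF F]]
    have "eventually (\<lambda>g. ?F (?\<phi> g, g) = g \<and> ?F' (?\<phi> g, g) = g \<and>
        (\<forall>u. ?L g u = partial_tangent A ?F (?\<phi> g) g u - partial_tangent A ?F' (?\<phi> g) g u)) (nhds g0)"
    proof eventually_elim
      case (elim g)
      then have Fg: "is_local_mul (?\<phi> g) g ?F"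
        by simp
      have v: "?F (?\<phi> g, g) = g"
        using Fg unfolding is_local_mul_def by (auto dest: eventually_nhds_x_imp_x simp: mul_one_left)
      let ?TF = "tangent_map (A \<times>\<^sub>M A) A ?F (?\<phi> g, g)"
      have sF: "smooth_near (A \<times>\<^sub>M A) A ?F (?\<phi> g, g)"
        using Fg by (simp add: is_local_mul_def)
      have lin: "linear ?TF"
        by (rule tangent_map_linear[OF mAA mA sF])
      have "partial_tangent A ?F (?\<phi> g) g u = ?TF (u, 0)" for u
        unfolding partial_tangent_def
        using tangent_map_compose[OF mA mAA mA smooth_near_Pair[OF mA mA mA smooth_near_ident[OF mA] smooth_near_const[OF mA mA]] sF, of u]
        by (simp add: tangent_map_Pair[OF mA mA mA smooth_near_ident[OF mA] smooth_near_const[OF mA mA]]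
            tangent_map_ident[OF mA] tangent_map_const)
      moreover have "partial_tangent A ?F' (?\<phi> g) g u = ?TF (d1 (tgt G g) (dS (?\<phi> g) u), 0)" for u
      proof -
        have sF': "smooth_near (A \<times>\<^sub>M A) A ?F (one G (src G (?\<phi> g)), g)"
          using sF by simp
        show ?thesis
          unfolding partial_tangent_def
          using tangent_map_compose[OF mA mAA mA smooth_near_Pair[OF mA mA mA smooth_src_unit smooth_near_const[OF mA mA]] sF', of u]
            tangent_map_compose[OF mA mM mA smooth_structure_maps(1,3), of "?\<phi> g" u]
          by (simp add: tangent_map_Pair[OF mA mA mA smooth_src_unit smooth_near_const[OF mA mA]] tangent_map_const)
      qed
      \<comment> \<open>The two pairs on the right need not be composable, but their difference is;
        the splitting uses linearity of the derivative of the extension on all pairs.\<close>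
      moreover have "?L g u = ?TF (u, 0) - ?TF (d1 (tgt G g) (dS (?\<phi> g) u), 0)" for u
      proof -
        have "?L g u = ?TF (prA (tgt G g) u, 0)"
          by (rule Tm_eq[OF Fg]) simp_all
        then show ?thesis
          using linear_diff[OF lin, of "(u, 0)" "(d1 (tgt G g) (dS (?\<phi> g) u), 0)"] by (simp add: prA_def)
      qed
      ultimately show ?case
        using v by simp
    qed
    with s1 s2 show "\<exists>\<Phi> \<Phi>'. smooth_near (A \<times>\<^sub>M A) A \<Phi> (?\<phi> g0, g0) \<and> smooth_near (A \<times>\<^sub>M A) A \<Phi>' (?\<phi> g0, g0) \<and>
      eventually (\<lambda>g. \<Phi> (?\<phi> g, g) = g \<and> \<Phi>' (?\<phi> g, g) = g \<and>
        (\<forall>u. ?L g u = partial_tangent A \<Phi> (?\<phi> g) g u - partial_tangent A \<Phi>' (?\<phi> g) g u)) (nhds g0)"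
      by blast
  qed
  moreover have "(\<lambda>g. pushforward (?L g) (\<Lambda> (?\<phi> g))) = right_trans \<Lambda>"
    by (simp add: fun_eq_iff right_trans_def cotangent_tgt_def pushforward_def)
  ultimately show ?thesis
    by simp
qed

text \<open>The auxiliary maps send (p, g) to g 1_s(p) and to g p^-1. At p = 1_s(g) the partial
  derivatives differ by minus the left translate of dI u - d1(dS u), which is \<open>dI\<close> of
  the A-part of u.\<close>

lemma left_trans_multivector_field:
  assumes "\<Lambda> \<in> multivector_fields k A"
  shows "left_trans \<Lambda> \<in> multivector_fields k A"
proof -
  let ?\<phi> = "\<lambda>g. one G (src G g)" and ?L = "\<lambda>g v. - Tm g (one G (src G g)) 0 (dI (one G (src G g)) (prA (src G g) v))"
  have "(\<lambda>g. pushforward (?L g) (\<Lambda> (?\<phi> g))) \<in> multivector_fields k A"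
  proof (rule pushforward_family_smooth[OF mA assms smooth_src_unit left_translation_linear])
    fix g0
    let ?F = "local_mul g0 (?\<phi> g0)"
    let ?F1 = "\<lambda>p. ?F (snd p, one G (src G (fst p)))" and ?F2 = "\<lambda>p. ?F (snd p, ginv G (fst p))"
    have F: "is_local_mul g0 (?\<phi> g0) ?F"
      by (rule is_local_mul) simp
    have s1: "smooth_near (A \<times>\<^sub>M A) (A \<times>\<^sub>M A) (\<lambda>p. (snd p, one G (src G (fst p)))) q" for q
      by (rule smooth_near_Pair[OF mAA mA mA smooth_near_snd[OF mA mA]
            smooth_near_compose[OF mAA mA mA smooth_near_fst[OF mA mA] smooth_src_unit]])
    have s2: "smooth_near (A \<times>\<^sub>M A) (A \<times>\<^sub>M A) (\<lambda>p. (snd p, ginv G (fst p))) q" for q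
      by (rule smooth_near_Pair[OF mAA mA mA smooth_near_snd[OF mA mA]
            smooth_near_compose[OF mAA mA mA smooth_near_fst[OF mA mA] smooth_structure_maps(4)]])
    have s: "smooth_near (A \<times>\<^sub>M A) A ?F (g0, ?\<phi> g0)"
      using F by (simp add: is_local_mul_def)
    have sF1: "smooth_near (A \<times>\<^sub>M A) A ?F1 (?\<phi> g0, g0)"
      by (rule smooth_near_compose[OF mAA mAA mA s1]) (simp add: s)
    have sF2: "smooth_near (A \<times>\<^sub>M A) A ?F2 (?\<phi> g0, g0)"
      by (rule smooth_near_compose[OF mAA mAA mA s2]) (simp add: s)
    have "smooth_near A (A \<times>\<^sub>M A) (\<lambda>g. (g, ?\<phi> g)) g0"
      by (rule smooth_near_Pair[OF mA mA mA smooth_near_ident[OF mA] smooth_src_unit])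
    from smooth_near_eventually_compose[OF this is_local_mul_eventually[OF F]]
    have "eventually (\<lambda>g. ?F1 (?\<phi> g, g) = g \<and> ?F2 (?\<phi> g, g) = g \<and>
        (\<forall>u. ?L g u = partial_tangent A ?F1 (?\<phi> g) g u - partial_tangent A ?F2 (?\<phi> g) g u)) (nhds g0)"
    proof eventually_elim
      case (elim g)
      then have Fg: "is_local_mul g (?\<phi> g) ?F"
        by simp
      have v: "?F (g, ?\<phi> g) = g"
        using Fg unfolding is_local_mul_def by (auto dest: eventually_nhds_x_imp_x simp: mul_one_right)
      let ?TF = "tangent_map (A \<times>\<^sub>M A) A ?F (g, ?\<phi> g)"
      have sF: "smooth_near (A \<times>\<^sub>M A) A ?F (g, ?\<phi> g)"
        using Fg by (simp add: is_local_mul_def)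
      have lin: "linear ?TF"
        by (rule tangent_map_linear[OF mAA mA sF])
      have "partial_tangent A ?F1 (?\<phi> g) g u = ?TF (0, d1 (src G g) (dS (?\<phi> g) u))" for u
      proof -
        have sF': "smooth_near (A \<times>\<^sub>M A) A ?F (g, one G (src G (?\<phi> g)))"
          using sF by simp
        show ?thesis
          unfolding partial_tangent_def
          using tangent_map_compose[OF mA mAA mA smooth_near_Pair[OF mA mA mA smooth_near_const[OF mA mA] smooth_src_unit] sF', of u]
            tangent_map_compose[OF mA mM mA smooth_structure_maps(1,3), of "?\<phi> g" u]
          by (simp add: tangent_map_Pair[OF mA mA mA smooth_near_const[OF mA mA] smooth_src_unit] tangent_map_const)
      qed
      moreover have "partial_tangent A ?F2 (?\<phi> g) g u = ?TF (0, dI (?\<phi> g) u)" for u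
      proof -
        have sF': "smooth_near (A \<times>\<^sub>M A) A ?F (g, ginv G (?\<phi> g))"
          using sF by simp
        show ?thesis
          unfolding partial_tangent_def
          using tangent_map_compose[OF mA mAA mA smooth_near_Pair[OF mA mA mA smooth_near_const[OF mA mA] smooth_structure_maps(4)] sF', of u]
          by (simp add: tangent_map_Pair[OF mA mA mA smooth_near_const[OF mA mA] smooth_structure_maps(4)] tangent_map_const)
      qed
      moreover have "?L g u = ?TF (0, d1 (src G g) (dS (?\<phi> g) u)) - ?TF (0, dI (?\<phi> g) u)" for u
      proof -
        have 1: "?L g u = - ?TF (0, dI (?\<phi> g) (prA (src G g) u))"
          by (subst Tm_eq[OF Fg]) simp_all
        have 2: "dI (?\<phi> g) (prA (src G g) u) = dI (?\<phi> g) u - d1 (src G g) (dS (?\<phi> g) u)"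
          by (simp add: prA_def linear_diff[OF dI_linear] dI_d1)
        have 3: "?TF (0, dI (?\<phi> g) u - d1 (src G g) (dS (?\<phi> g) u)) = ?TF (0, dI (?\<phi> g) u) - ?TF (0, d1 (src G g) (dS (?\<phi> g) u))"
          using linear_diff[OF lin, of "(0, dI (?\<phi> g) u)" "(0, d1 (src G g) (dS (?\<phi> g) u))"] by simp
        show ?thesis
          using 1 by (simp only: 2 3 minus_diff_eq)
      qed
      ultimately show ?case
        using v by simp
    qed
    with sF1 sF2 show "\<exists>\<Phi> \<Phi>'. smooth_near (A \<times>\<^sub>M A) A \<Phi> (?\<phi> g0, g0) \<and> smooth_near (A \<times>\<^sub>M A) A \<Phi>' (?\<phi> g0, g0) \<and>
      eventually (\<lambda>g. \<Phi> (?\<phi> g, g) = g \<and> \<Phi>' (?\<phi> g, g) = g \<and>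
        (\<forall>u. ?L g u = partial_tangent A \<Phi> (?\<phi> g) g u - partial_tangent A \<Phi>' (?\<phi> g) g u)) (nhds g0)"
      by blast
  qed
  moreover have "(\<lambda>g. pushforward (?L g) (\<Lambda> (?\<phi> g))) = left_trans \<Lambda>"
    by (simp add: fun_eq_iff left_trans_def cotangent_src_def pushforward_def)
  ultimately show ?thesis
    by simp
qed

section \<open>The 2-vector space of affine fields\<close>

lemma multivector_fields_local_field: "\<Lambda> \<in> multivector_fields k A \<Longrightarrow> local_field k \<Lambda>"
  unfolding local_field_def by (blast intro: multivectors_local multivector_fieldsD(1))

lemma affine_fields_iff_pair:
  "\<Lambda> \<in> affine_fields G k \<longleftrightarrow> \<Lambda> \<in> multivector_fields k A \<and> pair_field k \<Lambda>"
  using affine_fields_iff affine_iff_pair multivector_fields_local_field by blast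

lemma affine_fieldsD:
  assumes "\<Lambda> \<in> affine_fields G k"
  shows "\<Lambda> \<in> multivector_fields k A" "local_field k \<Lambda>" "pair_field k \<Lambda>"
  using assms multivector_fields_local_field by (auto simp: affine_fields_iff_pair)

lemma pair_zero: "pair_field k 0" and mult_zero: "mult_field k 0"
  by (simp_all add: pair_field_def mult_field_def left_trans_def)

lemmas fields_subspace = subspace_multivector_fields[OF mA]

lemma subspace_affine_fields: "subspace (affine_fields G k)"
  by (rule subspaceI) (auto simp: affine_fields_iff_pair subspace_0[OF fields_subspace] subspace_add[OF fields_subspace]
      subspace_scale[OF fields_subspace] pair_add pair_scaleR pair_zero)

lemma subspace_multiplicative_fields: "subspace (multiplicative_fields G k)"
  by (rule subspaceI) (auto simp: multiplicative_fields_iff subspace_0[OF fields_subspace] subspace_add[OF fields_subspace]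
      subspace_scale[OF fields_subspace] mult_add mult_scaleR mult_zero)

lemma
  assumes "\<Lambda> \<in> affine_fields G k"
  shows right_trans_affine: "right_trans \<Lambda> \<in> affine_fields G k" and left_trans_affine: "left_trans \<Lambda> \<in> affine_fields G k"
    and diff_right_trans_multiplicative: "\<Lambda> - right_trans \<Lambda> \<in> multiplicative_fields G k"
    and diff_left_trans_multiplicative: "\<Lambda> - left_trans \<Lambda> \<in> multiplicative_fields G k"
  using affine_fieldsD[OF assms] subspace_diff[OF fields_subspace]
  by (simp_all add: affine_fields_iff_pair multiplicative_fields_iff right_trans_multivector_field left_trans_multivector_field
      pair_right_trans pair_left_trans pair_diff_right_trans pair_diff_left_trans)

lemma multiplicative_affine: "\<Lambda> \<in> multiplicative_fields G k \<Longrightarrow> \<Lambda> \<in> affine_fields G k"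
  by (simp add: multiplicative_fields_iff affine_fields_iff_pair mult_imp_pair)

lemma multiplicative_translates:
  "\<Lambda> \<in> multiplicative_fields G k \<Longrightarrow> right_trans \<Lambda> = 0" "\<Lambda> \<in> multiplicative_fields G k \<Longrightarrow> left_trans \<Lambda> = 0"
  by (auto simp: multiplicative_fields_iff intro: mult_translates)

lemma two_vector_space_affine:
  "two_vector_space (affine_fields G k) (multiplicative_fields G k)
     (\<lambda>\<Lambda>. \<Lambda> - right_trans \<Lambda>) (\<lambda>\<Lambda>. \<Lambda> - left_trans \<Lambda>) (\<lambda>\<Lambda>. \<Lambda>) (\<lambda>\<Lambda> \<Lambda>'. \<Lambda> + left_trans \<Lambda>')"
  unfolding two_vector_space_def
proof (intro conjI ballI impI)
  show "subspace (affine_fields G k)" "subspace (multiplicative_fields G k)"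
    by (rule subspace_affine_fields subspace_multiplicative_fields)+
  show "(\<lambda>\<Lambda>. \<Lambda> - right_trans \<Lambda>) ` affine_fields G k \<subseteq> multiplicative_fields G k"
    "(\<lambda>\<Lambda>. \<Lambda> - left_trans \<Lambda>) ` affine_fields G k \<subseteq> multiplicative_fields G k"
    "(\<lambda>\<Lambda>. \<Lambda>) ` multiplicative_fields G k \<subseteq> affine_fields G k"
    by (auto intro: diff_right_trans_multiplicative diff_left_trans_multiplicative multiplicative_affine)
  show "case p of (\<Lambda>, \<Lambda>') \<Rightarrow> \<Lambda> + left_trans \<Lambda>' \<in> affine_fields G k \<and>
      \<Lambda> + left_trans \<Lambda>' - right_trans (\<Lambda> + left_trans \<Lambda>') = \<Lambda>' - right_trans \<Lambda>' \<and> \<Lambda> + left_trans \<Lambda>' - left_trans (\<Lambda> + left_trans \<Lambda>') = \<Lambda> - left_trans \<Lambda>"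
    if "p \<in> composable (affine_fields G k) (\<lambda>\<Lambda>. \<Lambda> - right_trans \<Lambda>) (\<lambda>\<Lambda>. \<Lambda> - left_trans \<Lambda>)" for p
  proof -
    obtain \<Lambda> \<Lambda>' where p: "p = (\<Lambda>, \<Lambda>')" and a: "\<Lambda> \<in> affine_fields G k" "\<Lambda>' \<in> affine_fields G k"
      and eq: "\<Lambda> - right_trans \<Lambda> = \<Lambda>' - left_trans \<Lambda>'"
      using \<open>p \<in> _\<close> by (auto simp: composable_def)
    have "\<Lambda> + left_trans \<Lambda>' \<in> affine_fields G k"
      by (rule subspace_add[OF subspace_affine_fields a(1) left_trans_affine[OF a(2)]])
    \<comment> \<open>Composability enters here: \<open>right_trans (left_trans \<Lambda>')\<close>
      is \<open>right_trans \<Lambda>'\<close>, and \<open>eq\<close> replaces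
      \<open>\<Lambda> - right_trans \<Lambda>\<close>.\<close>
    moreover have "\<Lambda> + left_trans \<Lambda>' - (right_trans \<Lambda> + right_trans \<Lambda>') = \<Lambda>' - right_trans \<Lambda>'"
      using eq by (simp add: algebra_simps)
    ultimately show ?thesis
      by (simp add: p right_trans_add left_trans_add translates_idempotent)
  qed
  show "\<Lambda> - right_trans \<Lambda> = \<Lambda>" "\<Lambda> - left_trans \<Lambda> = \<Lambda>" if "\<Lambda> \<in> multiplicative_fields G k" for \<Lambda>
    using multiplicative_translates[OF that] by simp_all
  show "\<Lambda> + left_trans (\<Lambda> - right_trans \<Lambda>) = \<Lambda>" "\<Lambda> - left_trans \<Lambda> + left_trans \<Lambda> = \<Lambda>" if "\<Lambda> \<in> affine_fields G k" for \<Lambda>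
    by (simp_all add: left_trans_diff translates_idempotent)
  show "\<Lambda> + left_trans \<Lambda>' + left_trans \<Lambda>'' = \<Lambda> + left_trans (\<Lambda>' + left_trans \<Lambda>'')" for \<Lambda> \<Lambda>' \<Lambda>''
    by (simp add: left_trans_add translates_idempotent algebra_simps)
  show "linear_map_on (affine_fields G k) (\<lambda>\<Lambda>. \<Lambda> - right_trans \<Lambda>)" "linear_map_on (affine_fields G k) (\<lambda>\<Lambda>. \<Lambda> - left_trans \<Lambda>)"
    "linear_map_on (multiplicative_fields G k) (\<lambda>\<Lambda>. \<Lambda>)"
    "linear_map_on (composable (affine_fields G k) (\<lambda>\<Lambda>. \<Lambda> - right_trans \<Lambda>) (\<lambda>\<Lambda>. \<Lambda> - left_trans \<Lambda>)) (\<lambda>(\<Lambda>, \<Lambda>'). \<Lambda> + left_trans \<Lambda>')"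
    by (auto simp: linear_map_on_def right_trans_add left_trans_add right_trans_scaleR left_trans_scaleR scaleR_diff_right scaleR_add_right)
qed

lemma arrows_invertible_affine:
  "arrows_invertible (affine_fields G k)
     (\<lambda>\<Lambda>. \<Lambda> - right_trans \<Lambda>) (\<lambda>\<Lambda>. \<Lambda> - left_trans \<Lambda>) (\<lambda>\<Lambda>. \<Lambda>) (\<lambda>\<Lambda> \<Lambda>'. \<Lambda> + left_trans \<Lambda>')"
  unfolding arrows_invertible_def
proof
  fix \<Lambda> assume a: "\<Lambda> \<in> affine_fields G k"
  \<comment> \<open>Both translates of this witness are the negatives of those of
    \<open>\<Lambda>\<close>.\<close>
  have "\<Lambda> - left_trans \<Lambda> - right_trans \<Lambda> \<in> affine_fields G k"
    by (intro subspace_diff[OF subspace_affine_fields] a left_trans_affine right_trans_affine)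
  then show "\<exists>\<Lambda>'\<in>affine_fields G k. \<Lambda>' - right_trans \<Lambda>' = \<Lambda> - left_trans \<Lambda> \<and> \<Lambda>' - left_trans \<Lambda>' = \<Lambda> - right_trans \<Lambda> \<and>
      \<Lambda> + left_trans \<Lambda>' = \<Lambda> - left_trans \<Lambda> \<and> \<Lambda>' + left_trans \<Lambda> = \<Lambda> - right_trans \<Lambda>"
    by (rule bexI[rotated]) (simp add: right_trans_diff left_trans_diff translates_idempotent)
qed

end

theorem theorem3p7:
  fixes G :: "('g::topological_space, 'e::banach,
               'm::{t2_space, second_countable_topology}, 'f::banach) groupoid"
    and k :: nat
  assumes "lie_groupoid G"
  shows "two_vector_space (affine_fields G k) (multiplicative_fields G k)
           (\<lambda>\<Lambda>. \<Lambda> - right_translate G (pr_wedge_A G \<Lambda>))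
           (\<lambda>\<Lambda>. \<Lambda> - left_translate G (pr_wedge_A G \<Lambda>))
           (\<lambda>\<Lambda>. \<Lambda>)
           (\<lambda>\<Lambda> \<Lambda>'. \<Lambda> + left_translate G (pr_wedge_A G \<Lambda>'))
       \<and> arrows_invertible (affine_fields G k)
           (\<lambda>\<Lambda>. \<Lambda> - right_translate G (pr_wedge_A G \<Lambda>))
           (\<lambda>\<Lambda>. \<Lambda> - left_translate G (pr_wedge_A G \<Lambda>))
           (\<lambda>\<Lambda>. \<Lambda>)
           (\<lambda>\<Lambda> \<Lambda>'. \<Lambda> + left_translate G (pr_wedge_A G \<Lambda>'))"
proof -
  interpret lie G
    by (rule lie.intro) (rule assms)
  show ?thesis
    \<comment> \<open>Translates of A-components become \<open>right_trans\<close> and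
      \<open>left_trans\<close>, for which the identities are already available.\<close>
    unfolding right_translate_eq left_translate_eq
    using two_vector_space_affine arrows_invertible_affine ..
qed

end
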